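(* Let $K$ be a field, $S=K[t_1,\dots,t_s]$, and let $(0)\ne I\subset S$ be an unmixed graded ideal minimally generated by forms of degree $e\ge2$ whose associated primes are generated by linear forms. If $1\le r\le\mathrm{ht}(I)$, then $$\mathrm{hyp}_I(1,r)\le e^{\mathrm{ht}(I)-r},$$ $\delta_I(1,r)\ge\deg(S/I)-e^{\mathrm{ht}(I)-r}$, and $\delta_I(1,r)\ge e^{\mathrm{ht}(I)}-e^{\mathrm{ht}(I)-r}$ if $I$ is a complete intersection.
   Context: $S=\bigoplus_{d\ge0}S_d$ has the standard grading; $K$ is arbitrary. An ideal is unmixed if it is proper and all its associated primes have the same height. A complete intersection is an ideal $I$ that can be generated by $\mathrm{ht}(I)$ elements. "Minimally generated by forms of degree $e$" means that all minimal homogeneous generators of $I$ have degree $e$. With $H_I(d)=\dim_K(S_d/I_d)$ and $k=\dim(S/I)$, $\deg(S/I)=(k-1)!\lim_{d\to\infty}H_I(d)/d^{k-1}$ if $k\ge1$ and $\dim_K(S/I)$ if $k=0$. For $d,r\ge 1$ let $\mathcal F_{d,r}$ be the set of all $F=\{f_1,\dots,f_r\}\subset S_d$ such that the classes $\overline f_1,\dots,\overline f_r$ in $S/I$ are linearly independent over $K$ and $(I:(f_1,\dots,f_r))\ne I$. Put $\mathrm{hyp}_I(d,r)=\max\{\deg(S/(I,F)) : F\in\mathcal F_{d,r}\}$ if $\mathcal F_{d,r}\neq\emptyset$ and $\mathrm{hyp}_I(d,r)=0$ otherwise; $\delta_I(d,r)=\deg(S/I)-\mathrm{hyp}_I(d,r)$.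 *)

theory Defs
  imports
    Complex_Main
    "HOL-Library.Extended_Nat"
    "HOL-Library.Poly_Mapping"
    "HOL-Algebra.QuotRing"
    "HOL-Algebra.Embedded_Algebras"
    "HOL-Algebra.Algebraic_Closure_Type"
begin

section \<open>Primes, height and Krull dimension of a commutative ring\<close>

text \<open>A chain \<open>C 0 \<subset> C 1 \<subset> \<dots> \<subset> C n\<close> of prime ideals; it has length \<open>n\<close>.\<close>

definition prime_chain :: "('a, 'b) ring_scheme \<Rightarrow> nat \<Rightarrow> (nat \<Rightarrow> 'a set) \<Rightarrow> bool" where
  "prime_chain R n C \<longleftrightarrow> (\<forall>i\<le>n. primeideal (C i) R) \<and> (\<forall>i<n. C i \<subset> C (Suc i))"

definition krull_dim :: "('a, 'b) ring_scheme \<Rightarrow> enat" where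
  "krull_dim R = Sup {enat n |n. \<exists>C. prime_chain R n C}"

definition prime_height :: "('a, 'b) ring_scheme \<Rightarrow> 'a set \<Rightarrow> enat" where
  "prime_height R P = Sup {enat n |n. \<exists>C. prime_chain R n C \<and> C n = P}"

definition ideal_height :: "('a, 'b) ring_scheme \<Rightarrow> 'a set \<Rightarrow> enat" where
  "ideal_height R I = Inf {prime_height R P |P. primeideal P R \<and> I \<subseteq> P}"

definition colon_ideal :: "('a, 'b) ring_scheme \<Rightarrow> 'a set \<Rightarrow> 'a set \<Rightarrow> 'a set" where
  "colon_ideal R I J = {g \<in> carrier R. \<forall>f\<in>J. g \<otimes>\<^bsub>R\<^esub> f \<in> I}"

text \<open>The associated primes of \<open>R/I\<close>.\<close>

definition assoc_primes :: "('a, 'b) ring_scheme \<Rightarrow> 'a set \<Rightarrow> 'a set set" where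
  "assoc_primes R I = {P. primeideal P R \<and> (\<exists>f\<in>carrier R. P = colon_ideal R I {f})}"

definition unmixed :: "('a, 'b) ring_scheme \<Rightarrow> 'a set \<Rightarrow> bool" where
  "unmixed R I \<longleftrightarrow> ideal I R \<and> I \<noteq> carrier R \<and>
     (\<forall>P\<in>assoc_primes R I. \<forall>Q\<in>assoc_primes R I. prime_height R P = prime_height R Q)"

definition complete_intersection :: "('a, 'b) ring_scheme \<Rightarrow> 'a set \<Rightarrow> bool" where
  "complete_intersection R I \<longleftrightarrow>
     (\<exists>G\<subseteq>carrier R. finite G \<and> enat (card G) = ideal_height R I \<and> I = Idl\<^bsub>R\<^esub> G)"


section \<open>The graded polynomial ring\<close>

text \<open>
  The polynomial ring \<open>K[t\<^sub>1,\<dots>,t\<^sub>s]\<close> has its variables indexed by a finite type \<open>'n\<close> with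
  \<open>s\<close> elements. Exponent vectors are of type \<open>'n \<Rightarrow>\<^sub>0 nat\<close>, and multiplication on the
  type of finitely supported coefficient functions is convolution.
\<close>

type_synonym ('n, 'k) mpoly = "('n \<Rightarrow>\<^sub>0 nat) \<Rightarrow>\<^sub>0 'k"

definition polyring :: "('n::finite, 'k::field) mpoly ring" where
  "polyring = ring_of_type_algebra"

definition forms :: "nat \<Rightarrow> ('n::finite, 'k::field) mpoly set" where
  "forms d = {f. \<forall>m\<in>Poly_Mapping.keys f. (\<Sum>i\<in>UNIV. Poly_Mapping.lookup m i) = d}"

definition graded_ideal :: "('n::finite, 'k::field) mpoly set \<Rightarrow> bool" where
  "graded_ideal I \<longleftrightarrow> (\<exists>G \<subseteq> (\<Union>d. forms d). I = Idl\<^bsub>polyring\<^esub> G)"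

definition minimal_homogeneous_generators ::
    "('n::finite, 'k::field) mpoly set \<Rightarrow> ('n, 'k) mpoly set \<Rightarrow> bool" where
  "minimal_homogeneous_generators I G \<longleftrightarrow>
     G \<subseteq> (\<Union>d. forms d) \<and> I = Idl\<^bsub>polyring\<^esub> G \<and>
     (\<forall>g\<in>G. Idl\<^bsub>polyring\<^esub> (G - {g}) \<noteq> I)"

definition minimally_generated_in_degree :: "('n::finite, 'k::field) mpoly set \<Rightarrow> nat \<Rightarrow> bool" where
  "minimally_generated_in_degree I e \<longleftrightarrow>
     (\<forall>G. minimal_homogeneous_generators I G \<longrightarrow> G \<subseteq> forms e)"

definition generated_by_linear_forms :: "('n::finite, 'k::field) mpoly set \<Rightarrow> bool" where
  "generated_by_linear_forms P \<longleftrightarrow> (\<exists>L \<subseteq> forms 1. P = Idl\<^bsub>polyring\<^esub> L)"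

text \<open>Heights in a polynomial ring in finitely many variables are finite for proper ideals.\<close>

definition ht :: "('n::finite, 'k::field) mpoly set \<Rightarrow> nat" where
  "ht I = the_enat (ideal_height polyring I)"


section \<open>Hilbert function and degree\<close>

definition residue_class ::
    "('n::finite, 'k::field) mpoly set \<Rightarrow> ('n, 'k) mpoly \<Rightarrow> ('n, 'k) mpoly set" where
  "residue_class I f = I +>\<^bsub>polyring\<^esub> f"

text \<open>
  The copy of \<open>K\<close> inside \<open>S/I\<close>: the \<open>K\<close>-vector space structure of \<open>S/I\<close> is the one over this
  subfield (\<open>I\<close> proper), in the sense of \<^theory>\<open>HOL-Algebra.Embedded_Algebras\<close>.
\<close>

definition scalars :: "('n::finite, 'k::field) mpoly set \<Rightarrow> ('n, 'k) mpoly set set" where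
  "scalars I = Set.range (\<lambda>c. residue_class I (Poly_Mapping.single 0 c))"

text \<open>For a graded ideal \<open>I\<close>, the space \<open>S\<^sub>d/I\<^sub>d\<close> is the image of \<open>S\<^sub>d\<close> in \<open>S/I\<close>.\<close>

definition hilbert_function :: "('n::finite, 'k::field) mpoly set \<Rightarrow> nat \<Rightarrow> nat" where
  "hilbert_function I d = ring.dim (polyring Quot I) (scalars I) (residue_class I ` forms d)"

definition quot_degree :: "('n::finite, 'k::field) mpoly set \<Rightarrow> real" where
  "quot_degree I =
     (let k = the_enat (krull_dim (polyring Quot I)) in
      if k \<ge> 1 then fact (k - 1) * lim (\<lambda>d. real (hilbert_function I d) / real d ^ (k - 1))
      else real (ring.dim (polyring Quot I) (scalars I) (carrier (polyring Quot I))))"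


section \<open>The functions hyp and delta\<close>

definition F_sets ::
    "('n::finite, 'k::field) mpoly set \<Rightarrow> nat \<Rightarrow> nat \<Rightarrow> ('n, 'k) mpoly set set" where
  "F_sets I d r = {F. F \<subseteq> forms d \<and>
     (\<exists>fs. length fs = r \<and> set fs = F \<and>
           ring.independent (polyring Quot I) (scalars I) (map (residue_class I) fs)) \<and>
     colon_ideal polyring I (Idl\<^bsub>polyring\<^esub> F) \<noteq> I}"

definition hyp :: "('n::finite, 'k::field) mpoly set \<Rightarrow> nat \<Rightarrow> nat \<Rightarrow> real" where
  "hyp I d r =
     (if F_sets I d r \<noteq> {}
      then Max {quot_degree (Idl\<^bsub>polyring\<^esub> (I \<union> F)) |F. F \<in> F_sets I d r}
      else 0)"

definition delta :: "('n::finite, 'k::field) mpoly set \<Rightarrow> nat \<Rightarrow> nat \<Rightarrow> real" where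
  "delta I d r = quot_degree I - hyp I d r"

end

theory Submission
  imports Defs "HOL-Library.Cardinality"
begin

text \<open>
  A set \<open>F\<close> of \<open>r\<close> linear forms with \<open>(I : F) \<noteq> I\<close> lies in an associated prime of \<open>I\<close>, so
  \<open>J = (I, F)\<close> has the height \<open>h\<close> of \<open>I\<close>. It is generated by \<open>F\<close> and forms of degree \<open>e\<close>.
  Over an infinite field (extend scalars to the algebraic closure) cut \<open>J\<close> down by \<open>n - h\<close>
  general linear forms to an ideal \<open>J'\<close> of finite colength; this does not decrease the
  degree. General elements of degree \<open>e\<close> of \<open>J'\<close> complete \<open>F\<close> and the linear forms to a
  regular sequence, whose quotient has length \<open>e ^ (h - r)\<close>, an upper bound for the length
  of \<open>S / J'\<close>. Conversely, adjoining a form of degree \<open>e\<close> multiplies the degree by at least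
  \<open>e\<close> when the dimension drops, which gives the lower bound for complete intersections.

  All estimates are coefficientwise inequalities of Hilbert series. Since these are of the
  form \<open>N / (1 - X) ^ k\<close> with an integer polynomial \<open>N\<close> and the degree is \<open>N 1\<close>, the degrees
  occurring in the definition of \<open>hyp\<close> form a finite set. Dimension and height are
  controlled by the affine Hilbert function: along a proper inclusion of primes its growth
  drops by at least one order.
\<close>

\<comment> \<open>Origin of the exponent: \<open>F\<close> and the general sections are r + (n - h)
  linear forms, so a regular sequence of length n has room for h - r forms of degree e. Each
  contributes the factor 1 + X + ... + X^(e-1), which is e at X = 1. Every prime over I contains an
  associated prime, that is, a linear prime of height h. Linear primes have explicit Hilbert series
  and explicit chains above and below, so this one fact fixes the height of I, the Krull dimension
  of S/J and the pole order n - h of the series of J. Associated primes may change when the field is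
  extended, Hilbert series do not. Hence linearity is exploited over K only, and the statement
  carried to the closure speaks of forms and series alone. An infinite field matters because a
  general element must avoid finitely many proper subspaces. A prime containing all linear forms
  cannot be avoided in this way, and this obstacle shapes the exchange argument: a general element
  is at first a nonzerodivisor in large degrees only, and a linear nonzerodivisor promotes this to
  all degrees.\<close>
alias lookup = Poly_Mapping.lookup
alias keys = Poly_Mapping.keys
alias single = Poly_Mapping.single

text \<open>Ideals are the submodules of a ring over itself.\<close>

interpretation idl: Modules.module "(*) :: 'a::comm_ring_1 \<Rightarrow> 'a \<Rightarrow> 'a"
  by unfold_locales (simp_all add: algebra_simps)

declare idl.scale_scale [simp del] \<comment> \<open>this is associativity, reversed with respect to \<^emph>\<open>mult.assoc\<close>\<close>

definition smul :: "'k::field \<Rightarrow> ('n::finite, 'k) mpoly \<Rightarrow> ('n, 'k) mpoly" where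
  "smul c f = single 0 c * f"

interpretation vs: Vector_Spaces.vector_space "smul :: 'k::field \<Rightarrow> ('n::finite, 'k) mpoly \<Rightarrow> ('n,
  'k) mpoly"
  by unfold_locales
    (simp_all add: smul_def distrib_left distrib_right single_add mult_single mult.assoc[symmetric])

lemma lookup_smul [simp]: "lookup (smul c g) m = c * lookup g m"
  unfolding smul_def mult_map_scale_conv_mult[symmetric]
  by (simp add: Poly_Mapping.map.rep_eq when_def)

section \<open>Monomials\<close>

definition mdeg :: "('n::finite \<Rightarrow>\<^sub>0 nat) \<Rightarrow> nat" where
  "mdeg m = (\<Sum>i\<in>UNIV. lookup m i)"

lemma mdeg_add: "mdeg (m + n) = mdeg m + mdeg n"
  by (simp add: mdeg_def lookup_add sum.distrib)

lemma mdeg_zero [simp]: "mdeg 0 = 0"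
  by (simp add: mdeg_def)

lemma mdeg_eq_0_iff: "mdeg m = 0 \<longleftrightarrow> m = 0"
  unfolding mdeg_def by (auto intro!: poly_mapping_eqI)

lemma poly_sum_single: "f = (\<Sum>m\<in>keys f. single m (lookup f m))"
  by (rule poly_mapping_eqI)
    (auto simp: lookup_sum lookup_single when_def not_in_keys_iff_lookup_eq_zero
      sum.delta'[OF finite_keys])

lemma mult_as_sum:
  fixes f g :: "'a::comm_monoid_add \<Rightarrow>\<^sub>0 'b::comm_ring_1"
  shows "f * g = (\<Sum>m\<in>keys f. \<Sum>m'\<in>keys g.
    single (m + m') (lookup f m * lookup g m'))"
proof -
  have "f * g = (\<Sum>m\<in>keys f. single m (lookup f m)) *
      (\<Sum>m'\<in>keys g. single m' (lookup g m'))"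
    using poly_sum_single[of f] poly_sum_single[of g] by simp
  then show ?thesis
    by (simp add: sum_product mult_single)
qed

text \<open>Unique factorisation: with a different prime for each variable, the exponents are
  recovered from the product of prime powers as multiplicities.\<close>

lemma ex_prime_coding:
  "\<exists>g::('n::finite \<Rightarrow>\<^sub>0 nat) \<Rightarrow> nat. inj g \<and> (\<forall>m m'. g (m + m') = g m * g m') \<and> (\<forall>m. g m > 0)"
proof -
  have "infinite {p::nat. prime p}" by (rule primes_infinite)
  then obtain T where T: "finite T" "card T = CARD('n)" "T \<subseteq> {p::nat. prime p}"
    using infinite_arbitrarily_large by blast
  obtain p :: "'n \<Rightarrow> nat" where p: "bij_betw p UNIV T"
    using finite_same_card_bij[of "UNIV :: 'n set" T] T by auto
  have inj: "inj p" using p by (auto simp: bij_betw_def)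
  have pr: "prime (p i)" for i using p T by (auto simp: bij_betw_def)
  define g where "g m = (\<Prod>i\<in>UNIV. p i ^ lookup m i)" for m :: "'n \<Rightarrow>\<^sub>0 nat"
  have "multiplicity (p j) (g m) = lookup m j" for m j
  proof -
    have "g m = (\<Prod>q\<in>Set.range p. q ^ lookup m (inv_into UNIV p q))"
      unfolding g_def by (subst prod.reindex) (auto simp: inj)
    also have "multiplicity (p j) \<dots> = lookup m j"
      by (subst multiplicity_prod_prime_powers) (use pr in \<open>auto simp: inj\<close>)
    finally show ?thesis .
  qed
  then have "inj g" by (metis injI poly_mapping_eqI)
  moreover have "g (m + m') = g m * g m'" for m m'
    by (simp add: g_def lookup_add power_add prod.distrib)
  moreover have "g m > 0" for m
    using pr by (auto simp: g_def intro!: prod_pos prime_gt_0_nat)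
  ultimately show ?thesis by blast
qed

text \<open>Comparing monomials through this coding gives a monomial order without any linear order
  on the variables.\<close>

definition gcode :: "('n::finite \<Rightarrow>\<^sub>0 nat) \<Rightarrow> nat" where
  "gcode = (SOME g. inj g \<and> (\<forall>m m'. g (m + m') = g m * g m') \<and> (\<forall>m. g m > 0))"

lemma gcode_inj: "gcode m = gcode m' \<longleftrightarrow> m = m'"
  and gcode_add: "gcode (m + m') = gcode m * gcode m'"
  and gcode_pos: "gcode m > 0"
  using someI_ex[OF ex_prime_coding, folded gcode_def] by (metis inj_eq)+

text \<open>The choice is unique for nonzero \<open>f\<close> because \<open>gcode\<close> is
  injective. At 0 the value is arbitrary, hence the hypotheses \<open>f \<noteq> 0\<close>
  below.\<close>

definition lm :: "('n::finite, 'k::field) mpoly \<Rightarrow> ('n \<Rightarrow>\<^sub>0 nat)" where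
  "lm f = (SOME m. m \<in> keys f \<and> (\<forall>m'\<in>keys f. gcode m' \<le> gcode m))"

lemma lm_props:
  assumes "f \<noteq> 0"
  shows lm_in_keys: "lm f \<in> keys f"
    and lm_max: "m \<in> keys f \<Longrightarrow> gcode m \<le> gcode (lm f)"
proof -
  have fin: "finite (gcode ` keys f)" by simp
  have "keys f \<noteq> {}" using assms poly_sum_single[of f] by auto
  then have "Max (gcode ` keys f) \<in> gcode ` keys f"
    using fin by (intro Max_in) auto
  then obtain k where "k \<in> keys f" "gcode k = Max (gcode ` keys f)"
    by auto
  then have "\<exists>m. m \<in> keys f \<and> (\<forall>m'\<in>keys f. gcode m' \<le> gcode m)"
    using fin by (metis Max_ge imageI)
  from someI_ex[OF this, folded lm_def]
  show "lm f \<in> keys f" "m \<in> keys f \<Longrightarrow> gcode m \<le> gcode (lm f)"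
    by auto
qed

text \<open>Codes are positive and multiply, so a product of two codes reaches the product of their
  bounds only if both factors do. Thus nothing can cancel the product of two leading terms.\<close>

lemma gcode_mult_eq:
  assumes "gcode m \<le> gcode a" "gcode m' \<le> gcode b" "m + m' = a + b"
  shows "m = a \<and> m' = b"
proof -
  have "gcode m * gcode m' = gcode a * gcode b"
    using assms(3) by (metis gcode_add)
  with assms(1,2) gcode_pos[of a] gcode_pos[of b] gcode_pos[of m] gcode_pos[of m']
  have "gcode m = gcode a \<and> gcode m' = gcode b"
    by (metis le_neq_implies_less mult_le_less_imp_less mult_less_le_imp_less nat_less_le
      order_refl)
  then show ?thesis by (simp add: gcode_inj)
qed

lemma lookup_mult_lm:
  assumes "f \<noteq> 0" "g \<noteq> 0"
  shows "lookup (f * g) (lm f + lm g) =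
    lookup f (lm f) * lookup g (lm g)"
proof -
  have "lookup (f * g) (lm f + lm g) =
    (\<Sum>m\<in>keys f. \<Sum>m'\<in>keys g.
      if m = lm f then (if m' = lm g then lookup f m * lookup g m' else 0) else 0)"
    unfolding mult_as_sum lookup_sum lookup_single when_def
  proof (intro sum.cong refl, goal_cases)
    case (1 x y)
    then have "gcode x \<le> gcode (lm f)" "gcode y \<le> gcode (lm g)" using lm_max assms by auto
    from gcode_mult_eq[OF this] show ?case by auto
  qed
  also have "\<dots> = (\<Sum>m\<in>keys f.
      if m = lm f then (\<Sum>m'\<in>keys g. if m' = lm g then lookup f m * lookup g m' else 0) else 0)"
    by (intro sum.cong refl) auto
  also have "\<dots> = lookup f (lm f) * lookup g (lm g)"
    using lm_in_keys[OF assms(1)] lm_in_keys[OF assms(2)] by (simp add: sum.delta in_keys_iff)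
  finally show ?thesis .
qed

lemma lookup_lm_nonzero: "f \<noteq> 0 \<Longrightarrow> lookup f (lm f) \<noteq> 0"
  using lm_in_keys[of f] by (simp add: in_keys_iff)

lemma mpoly_no_zero_divisors:
  fixes f g :: "('n::finite, 'k::field) mpoly"
  assumes "f * g = 0"
  shows "f = 0 \<or> g = 0"
  using lookup_mult_lm[of f g] lookup_lm_nonzero[of f] lookup_lm_nonzero[of g] assms by auto

lemma lm_mult:
  assumes "f \<noteq> 0" "g \<noteq> 0"
  shows "lm (f * g) = lm f + lm g"
proof -
  have nz: "f * g \<noteq> 0" using mpoly_no_zero_divisors assms by blast
  have "lm f + lm g \<in> keys (f * g)"
    using lookup_mult_lm[OF assms] assms lookup_lm_nonzero[of f] lookup_lm_nonzero[of g]
    by (simp add: in_keys_iff)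
  then have 1: "gcode (lm f + lm g) \<le> gcode (lm (f * g))" using lm_max[OF nz] by blast
  obtain a b where ab: "lm (f * g) = a + b" "a \<in> keys f" "b \<in> keys g"
    using lm_in_keys[OF nz] keys_mult[of f g] by auto
  have "gcode (a + b) \<le> gcode (lm f + lm g)"
    unfolding gcode_add using lm_max assms ab by (intro mult_le_mono) auto
  with 1 ab show ?thesis by (simp flip: gcode_inj)
qed

section \<open>Noetherianity\<close>

text \<open>Dickson's lemma, by passing to a subsequence that is monotone in one coordinate after the
  other.\<close>

lemma dickson_subseq:
  fixes s :: "nat \<Rightarrow> 'n \<Rightarrow> nat"
  assumes "finite A"
  shows "\<exists>\<phi>::nat \<Rightarrow> nat. strict_mono \<phi> \<and> (\<forall>x\<in>A. \<forall>i j. i \<le> j \<longrightarrow> s (\<phi> i) x \<le> s (\<phi> j) x)"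
  using assms
proof (induction A)
  case empty
  show ?case by (rule exI[of _ "\<lambda>n. n"]) (auto simp: strict_mono_def)
next
  case (insert x A)
  then obtain \<phi> :: "nat \<Rightarrow> nat" where \<phi>: "strict_mono \<phi>" "\<And>y i j. y \<in> A \<Longrightarrow> i \<le> j \<Longrightarrow> s (\<phi> i) y \<le>
    s (\<phi> j) y"
    by auto
  obtain \<psi> where \<psi>: "strict_mono \<psi>" "monoseq (\<lambda>n. s (\<phi> (\<psi> n)) x)"
    using seq_monosub[of "\<lambda>n. s (\<phi> n) x"] by auto
  define t where "t n = s (\<phi> (\<psi> n)) x" for n
  \<comment> \<open>A decreasing sequence of natural numbers is constant once it attains its
    minimum, so in either case a tail is non-decreasing.\<close>
  have "\<exists>N. \<forall>i j. N \<le> i \<longrightarrow> i \<le> j \<longrightarrow> t i \<le> t j"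
  proof (cases "incseq t")
    case True
    then show ?thesis by (auto simp: incseq_def)
  next
    case False
    then have dec: "decseq t" using \<psi>(2) by (auto simp: monoseq_iff t_def[abs_def])
    define v where "v = (LEAST v. \<exists>n. t n = v)"
    obtain N where N: "t N = v" using LeastI_ex[of "\<lambda>v. \<exists>n. t n = v"] v_def by auto
    have "v \<le> t n" for n unfolding v_def by (rule Least_le) auto
    moreover have "t n \<le> v" if "N \<le> n" for n using dec that N by (auto simp: decseq_def)
    ultimately have "\<And>i j. N \<le> i \<Longrightarrow> t i \<le> t j" using order.trans by blast
    then show ?thesis by blast
  qed
  then obtain N where N: "\<And>i j. N \<le> i \<Longrightarrow> i \<le> j \<Longrightarrow> t i \<le> t j" by auto
  have mono: "i \<le> j \<Longrightarrow> \<psi> (N + i) \<le> \<psi> (N + j)" for i j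
    using \<psi>(1) by (simp add: strict_mono_less_eq)
  show ?case
  proof (intro exI[of _ "\<lambda>n. \<phi> (\<psi> (N + n))"] conjI ballI allI impI)
    show "strict_mono (\<lambda>n. \<phi> (\<psi> (N + n)))"
      using \<phi>(1) \<psi>(1) by (auto simp: strict_mono_def)
    fix y i j assume "y \<in> insert x A" "i \<le> (j::nat)"
    then show "s (\<phi> (\<psi> (N + i))) y \<le> s (\<phi> (\<psi> (N + j))) y"
      using N[of "N + i" "N + j"] \<phi>(2)[of y, OF _ mono] by (auto simp: t_def)
  qed
qed

lemma dickson:
  fixes s :: "nat \<Rightarrow> ('n::finite \<Rightarrow>\<^sub>0 nat)"
  shows "\<exists>i j c. i < j \<and> s j = s i + c"
proof -
  obtain \<phi> :: "nat \<Rightarrow> nat" where \<phi>: "strict_mono \<phi>"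
    "\<And>x i j. i \<le> j \<Longrightarrow> lookup (s (\<phi> i)) x \<le> lookup (s (\<phi> j)) x"
    using dickson_subseq[of "UNIV :: 'n set" "\<lambda>i. lookup (s i)"] by auto
  have "s (\<phi> 1) = s (\<phi> 0) + (s (\<phi> 1) - s (\<phi> 0))"
    using \<phi>(2)[of 0 1] by (intro poly_mapping_eqI) (simp add: lookup_add lookup_minus)
  moreover have "\<phi> 0 < \<phi> 1" using \<phi>(1) by (simp add: strict_mono_def)
  ultimately show ?thesis by blast
qed

text \<open>Division with remainder: cancelling the leading term of \<open>f\<close> by a multiple
  of \<open>g\<close> lowers the code of the leading monomial, and codes are natural
  numbers.\<close>

lemma ideal_eq_if_lm:
  fixes J J' :: "('n::finite, 'k::field) mpoly set"
  assumes J: "idl.subspace J" and J': "idl.subspace J'" and sub: "J \<subseteq> J'"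
    and lms: "\<And>f. f \<in> J' \<Longrightarrow> f \<noteq> 0 \<Longrightarrow> \<exists>g\<in>J. g \<noteq> 0 \<and> lm g = lm f"
  shows "J = J'"
proof -
  have "f \<in> J'  \<Longrightarrow> f \<noteq> 0 \<Longrightarrow> f \<in> J" for f
  proof (induction "gcode (lm f)" arbitrary: f rule: less_induct)
    case less
    obtain g where g: "g \<in> J" "g \<noteq> 0" "lm g = lm f" using lms less by blast
    define c where "c = lookup f (lm f) / lookup g (lm f)"
    define h where "h = f - smul c g"
    have sg: "smul c g \<in> J" using g J by (simp add: smul_def idl.subspace_scale)
    then have "h \<in> J'" unfolding h_def using less J' sub by (auto intro: idl.subspace_diff)
    have "h \<in> J"
    proof (cases "h = 0")
      case False
      have "lm h \<in> keys h" using False by (rule lm_in_keys)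
      then have "lookup f (lm h) \<noteq> 0 \<or> lookup g (lm h) \<noteq> 0"
        by (auto simp: h_def lookup_minus in_keys_iff)
      then have le: "gcode (lm h) \<le> gcode (lm f)"
        using lm_max[OF g(2)] lm_max[OF less(3)] g(3) by (auto simp: in_keys_iff)
      have "lookup h (lm f) = 0"
        using lookup_lm_nonzero[OF g(2)] by (simp add: h_def lookup_minus c_def g(3))
      then have "lm h \<noteq> lm f" using \<open>lm h \<in> _\<close> by (auto simp: in_keys_iff)
      with le have "gcode (lm h) < gcode (lm f)" using gcode_inj le_neq_implies_less by blast
      then show ?thesis using less False \<open>h \<in> J'\<close> by blast
    qed (use J in \<open>simp add: idl.subspace_0\<close>)
    then have "h + smul c g \<in> J" using sg J by (simp add: idl.subspace_add)
    then show ?case by (simp add: h_def)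
  qed
  moreover have "0 \<in> J" using J by (rule idl.subspace_0)
  ultimately show ?thesis using sub by auto
qed

text \<open>Each step of a strictly increasing chain brings in an element whose leading monomial is
  new. By Dickson's lemma an earlier one of these monomials divides a later one, and a monomial
  multiple of the earlier element shows that the later one was not new.\<close>

lemma noetherian:
  "wf {(J', J :: ('n::finite, 'k::field) mpoly set). idl.subspace J \<and> idl.subspace J' \<and> J \<subset> J'}"
  unfolding wf_iff_no_infinite_down_chain
proof (rule notI, elim exE)
  fix J :: "nat \<Rightarrow> ('n, 'k) mpoly set"
  assume "\<forall>i. (J (Suc i), J i) \<in> {(J', J). idl.subspace J \<and> idl.subspace J' \<and> J \<subset> J'}"
  then have J: "\<And>i. idl.subspace (J i)" and st: "\<And>i. J i \<subset> J (Suc i)" by auto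
  have mono: "i \<le> j \<Longrightarrow> J i \<subseteq> J j" for i j
    by (rule lift_Suc_mono_le[of J]) (use st in auto)
  have "\<exists>f. f \<in> J (Suc i) \<and> f \<noteq> 0 \<and> (\<forall>g\<in>J i. g \<noteq> 0 \<longrightarrow> lm g \<noteq> lm f)" for i
    using ideal_eq_if_lm[OF J J, of i "Suc i"] st[of i] by blast
  then obtain f where f: "\<And>i. f i \<in> J (Suc i)" "\<And>i. f i \<noteq> 0"
      "\<And>i g. g \<in> J i \<Longrightarrow> g \<noteq> 0 \<Longrightarrow> lm g \<noteq> lm (f i)"
    by metis
  obtain i j c where ij: "i < j" "lm (f j) = lm (f i) + c"
    using dickson[of "\<lambda>i. lm (f i)"] by blast
  define x :: "('n, 'k) mpoly" where "x = single c 1"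
  have x: "x \<noteq> 0" "keys x = {c}" by (metis single_zero inj_single injD x_def zero_neq_one
    lookup_single_eq lookup_zero) (simp add: x_def)
  then have "lm x = c" using lm_in_keys[of x] by auto
  then have "lm (x * f i) = lm (f j)" using lm_mult[OF x(1) f(2)] ij by (simp add: add.commute)
  moreover have "x * f i \<in> J j"
    using f(1)[of i] mono[of "Suc i" j] ij J by (auto intro: idl.subspace_scale)
  moreover have "x * f i \<noteq> 0" using mpoly_no_zero_divisors x f by blast
  ultimately show False using f(3) by metis
qed

lemma ideal_induct [consumes 1, case_names step]:
  fixes J :: "('n::finite, 'k::field) mpoly set"
  assumes "idl.subspace J"
    and "\<And>J. idl.subspace J \<Longrightarrow> (\<And>J'. idl.subspace J' \<Longrightarrow> J \<subset> J' \<Longrightarrow> P J') \<Longrightarrow> P J"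
  shows "P J"
  using assms(1)
  by (induction J rule: wf_induct[OF noetherian]) (use assms(2) in blast)

lemma ex_maximal_ideal:
  fixes \<A> :: "('n::finite, 'k::field) mpoly set set"
  assumes "J0 \<in> \<A>" "\<And>J. J \<in> \<A> \<Longrightarrow> idl.subspace J"
  shows "\<exists>J\<in>\<A>. J0 \<subseteq> J \<and> (\<forall>J'\<in>\<A>. \<not> J \<subset> J')"
proof -
  have "J \<in> \<A> \<Longrightarrow> \<exists>J'\<in>\<A>. J \<subseteq> J' \<and> (\<forall>J''\<in>\<A>. \<not> J' \<subset> J'')" if "idl.subspace J" for J
    using that
  proof (induction J rule: ideal_induct)
    case (step J)
    show ?case
    proof (cases "\<exists>J'\<in>\<A>. J \<subset> J'")
      case True
      then obtain J' where J': "J' \<in> \<A>" "J \<subset> J'" by blast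
      from step.IH[OF assms(2)[OF J'(1)] J'(2,1)]
      obtain J'' where "J'' \<in> \<A>" "J' \<subseteq> J''" "\<forall>J'\<in>\<A>. \<not> J'' \<subset> J'" by auto
      with J'(2) show ?thesis by (intro bexI[of _ J'']) auto
    next
      case False
      with step(3) show ?thesis by (intro bexI[of _ J]) auto
    qed
  qed
  from this[OF assms(2)[OF assms(1)] assms(1)] show ?thesis .
qed

text \<open>A maximal ideal among the spans of finite subsets of \<open>G\<close> absorbs every
  further generator.\<close>

lemma finite_ideal_generators:
  fixes G :: "('n::finite, 'k::field) mpoly set"
  shows "\<exists>G'\<subseteq>G. finite G' \<and> idl.span G' = idl.span G"
proof -
  let ?A = "{idl.span G' |G'. G' \<subseteq> G \<and> finite G'}"
  have "idl.span {} \<in> ?A" by blast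
  moreover have "\<And>J. J \<in> ?A \<Longrightarrow> idl.subspace J" using idl.subspace_span by auto
  ultimately have "\<exists>J\<in>?A. idl.span {} \<subseteq> J \<and> (\<forall>J'\<in>?A. \<not> J \<subset> J')"
    by (rule ex_maximal_ideal)
  then obtain G' where G': "G' \<subseteq> G" "finite G'" and max: "\<forall>J'\<in>?A. \<not> idl.span G' \<subset> J'" by auto
  have "g \<in> idl.span G'" if "g \<in> G" for g
  proof -
    have "idl.span (insert g G') \<in> ?A" using that G' by blast
    with max have "\<not> idl.span G' \<subset> idl.span (insert g G')" by blast
    moreover have "idl.span G' \<subseteq> idl.span (insert g G')" by (rule idl.span_mono) auto
    ultimately have "idl.span G' = idl.span (insert g G')" by auto
    then show ?thesis by (simp add: idl.span_base)
  qed
  then have "idl.span G = idl.span G'"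
    using G' idl.span_minimal[of G "idl.span G'"] idl.span_mono[of G' G] by auto
  then show ?thesis using G' by metis
qed

section \<open>Grading\<close>

definition hcomp :: "nat \<Rightarrow> ('n::finite, 'k::field) mpoly \<Rightarrow> ('n, 'k) mpoly" where
  "hcomp d f = (\<Sum>m\<in>{m\<in>keys f. mdeg m = d}. single m (lookup f m))"

definition forms_upto :: "nat \<Rightarrow> ('n::finite, 'k::field) mpoly set" where
  "forms_upto d = {f. \<forall>m\<in>keys f. mdeg m \<le> d}"

lemma forms_iff: "f \<in> forms d \<longleftrightarrow> (\<forall>m. lookup f m \<noteq> 0 \<longrightarrow> mdeg m = d)"
  by (auto simp: forms_def mdeg_def in_keys_iff)

lemma upto_iff: "f \<in> forms_upto d \<longleftrightarrow> (\<forall>m. lookup f m \<noteq> 0 \<longrightarrow> mdeg m \<le> d)"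
  by (auto simp: forms_upto_def in_keys_iff)

lemma lookup_hcomp [simp]:
  "lookup (hcomp d f) m = (if mdeg m = d then lookup f m else 0)"
proof -
  have fin: "finite {m\<in>keys f. mdeg m = d}" by simp
  show ?thesis
    by (auto simp: hcomp_def lookup_sum lookup_single when_def in_keys_iff sum.delta'[OF fin])
qed

lemma hcomp_add: "hcomp d (f + g) = hcomp d f + hcomp d g"
  by (rule poly_mapping_eqI) (simp add: lookup_add)

lemma hcomp_diff: "hcomp d (f - g) = hcomp d f - hcomp d g"
  by (rule poly_mapping_eqI) (simp add: lookup_minus)

lemma hcomp_smul: "hcomp d (smul c f) = smul c (hcomp d f)"
  by (rule poly_mapping_eqI) simp

lemma hcomp_zero [simp]: "hcomp d 0 = 0"
  by (rule poly_mapping_eqI) simp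

lemma hcomp_sum: "hcomp d (sum f A) = (\<Sum>x\<in>A. hcomp d (f x))"
  by (rule poly_mapping_eqI) (simp add: lookup_sum)

lemma hcomp_in_forms [simp]: "hcomp d f \<in> forms d"
  by (simp add: forms_iff)

lemma hcomp_form: "f \<in> forms d \<Longrightarrow> hcomp e f = (if e = d then f else 0)"
  by (rule poly_mapping_eqI) (auto simp: forms_iff)

lemma ex_upto: "\<exists>d. f \<in> forms_upto d"
proof -
  have "f \<in> forms_upto (Max (mdeg ` keys f))"
    by (auto simp: forms_upto_def)
  then show ?thesis ..
qed

lemma upto_mono: "d \<le> e \<Longrightarrow> forms_upto d \<subseteq> forms_upto e"
  by (auto simp: forms_upto_def)

lemma forms_subset_upto: "forms d \<subseteq> forms_upto d"
  by (auto simp: upto_iff forms_iff)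

lemma sum_hcomp: "f \<in> forms_upto N \<Longrightarrow> f = (\<Sum>d\<le>N. hcomp d f)"
  by (rule poly_mapping_eqI) (auto simp: lookup_sum upto_iff)

lemma vs_subspace_forms [simp]: "vs.subspace (forms d)"
  unfolding vs.subspace_def by (auto simp: forms_iff lookup_add) (metis add.right_neutral)

lemma vs_subspace_upto [simp]: "vs.subspace (forms_upto d)"
  unfolding vs.subspace_def by (auto simp: upto_iff lookup_add) (metis add.right_neutral)

lemma keys_mult_obtain:
  assumes "lookup (f * g) m \<noteq> 0"
  obtains a b where "m = a + b" "lookup f a \<noteq> 0" "lookup g b \<noteq> 0"
  using keys_mult[of f g] assms by (auto simp: in_keys_iff subset_iff)

lemma forms_mult: "f \<in> forms a \<Longrightarrow> g \<in> forms b \<Longrightarrow> f * g \<in> forms (a + b)"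
  unfolding forms_iff by (metis keys_mult_obtain mdeg_add)

lemma upto_mult: "f \<in> forms_upto a \<Longrightarrow> g \<in> forms_upto b \<Longrightarrow> f * g \<in> forms_upto (a + b)"
  unfolding upto_iff by (metis keys_mult_obtain mdeg_add add_mono)

lemma one_in_forms: "1 \<in> forms 0"
  by (auto simp: forms_iff lookup_one when_def)

lemma forms_0_eq: "f \<in> forms 0 \<Longrightarrow> f = smul (lookup f 0) 1"
  by (rule poly_mapping_eqI) (auto simp: forms_iff mdeg_eq_0_iff lookup_one when_def)

lemma upto_0: "forms_upto 0 = forms 0"
  by (auto simp: upto_iff forms_iff)

lemma hcomp_mult_form:
  assumes "g \<in> forms b"
  shows "hcomp d (f * g) = (if b \<le> d then hcomp (d - b) f * g else 0)"
proof -
  obtain N where "f \<in> forms_upto N" using ex_upto by blast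
  \<comment> \<open>The bound is raised by \<open>d\<close> so that the index \<open>d - b\<close>
    occurs in the sum.\<close>
  then have "f \<in> forms_upto (N + d)" using upto_mono[of N "N + d"] by auto
  then have f: "f = (\<Sum>i\<le>N + d. hcomp i f)" by (rule sum_hcomp)
  have "hcomp d (f * g) = (\<Sum>i\<le>N + d. hcomp d (hcomp i f * g))"
    by (subst f) (simp add: sum_distrib_right hcomp_sum)
  also have "\<dots> = (\<Sum>i\<le>N + d. if d = i + b then hcomp i f * g else 0)"
    by (intro sum.cong refl hcomp_form forms_mult assms hcomp_in_forms)
  also have "\<dots> = (\<Sum>i\<le>N + d. if i = d - b then (if b \<le> d then hcomp i f * g else 0) else 0)"
    by (intro sum.cong) auto
  finally have "hcomp d (f * g) = \<dots>" .
  moreover have "d - b \<le> N + d" by simp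
  ultimately show ?thesis by (simp add: sum.delta)
qed

lemma hcomp_mult:
  "hcomp d (f * g) = (\<Sum>i\<le>d. hcomp i f * hcomp (d - i) g)"
proof -
  obtain N where N: "f \<in> forms_upto N" using ex_upto by blast
  then have "f \<in> forms_upto (N + d)" using upto_mono[of N "N + d"] by auto
  then have f: "f = (\<Sum>i\<le>N + d. hcomp i f)" by (rule sum_hcomp)
  have "hcomp d (f * g) = (\<Sum>i\<le>N + d. hcomp d (g * hcomp i f))"
    by (subst f) (simp add: sum_distrib_left hcomp_sum mult.commute[of _ g])
  also have "\<dots> = (\<Sum>i\<le>N + d. if i \<le> d then hcomp (d - i) g * hcomp i f else 0)"
    by (intro sum.cong refl hcomp_mult_form hcomp_in_forms)
  also have "\<dots> = (\<Sum>i\<in>{..N + d} \<inter> {i. i \<le> d}. hcomp (d - i) g * hcomp i f)"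
    by (subst sum.inter_restrict) auto
  also have "{..N + d} \<inter> {i. i \<le> d} = {..d}" by auto
  finally show ?thesis by (simp add: mult.commute)
qed

lemma vs_subspace_ideal [simp]: "idl.subspace J \<Longrightarrow> vs.subspace J"
  unfolding vs.subspace_def idl.subspace_def by (auto simp: smul_def)

definition homog :: "('n::finite, 'k::field) mpoly set \<Rightarrow> bool" where
  "homog J \<longleftrightarrow> idl.subspace J \<and> (\<forall>f\<in>J. \<forall>d. hcomp d f \<in> J)"

lemma homogD: "homog J \<Longrightarrow> idl.subspace J" "homog J \<Longrightarrow> f \<in> J \<Longrightarrow> hcomp d f \<in> J"
  by (auto simp: homog_def)

lemma homog_span:
  assumes "\<And>g d. g \<in> G \<Longrightarrow> hcomp d g \<in> idl.span G"
  shows "homog (idl.span G)"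
proof -
  have "idl.subspace {f. \<forall>d. hcomp d f \<in> idl.span G}"
    by (intro idl.subspaceI)
      (auto simp: hcomp_add hcomp_mult idl.span_zero intro!: idl.span_add idl.span_sum
        idl.span_scale)
  then have "idl.span G \<subseteq> {f. \<forall>d. hcomp d f \<in> idl.span G}"
    using assms by (intro idl.span_minimal) auto
  then show ?thesis by (auto simp: homog_def)
qed

lemma homog_span_forms:
  assumes "G \<subseteq> (\<Union>d. forms d)"
  shows "homog (idl.span G)"
  by (rule homog_span)
    (use assms in \<open>auto simp: hcomp_form idl.span_base idl.span_zero subset_iff\<close>)

lemma homog_UNIV [simp]: "homog UNIV"
  by (simp add: homog_def)

section \<open>Colon ideals and adjunction of an element\<close>

definition colon :: "('n::finite, 'k::field) mpoly set \<Rightarrow> ('n, 'k) mpoly \<Rightarrow> ('n, 'k) mpoly set" where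
  "colon J a = {g. g * a \<in> J}"

text \<open>The ideal (J, a). For a form \<open>a\<close> of degree e the inductions below run along
  the exact sequence 0 -> S/(J : a)(-e) -> S/J -> S/(J, a) -> 0.\<close>

definition adj :: "('n::finite, 'k::field) mpoly set \<Rightarrow> ('n, 'k) mpoly \<Rightarrow> ('n, 'k) mpoly set" where
  "adj J a = idl.span (insert a J)"

lemma subspace_colon: "idl.subspace J \<Longrightarrow> idl.subspace (colon J a)"
  unfolding idl.subspace_def colon_def by (auto simp: distrib_right mult.assoc)

lemma subset_colon: "idl.subspace J \<Longrightarrow> J \<subseteq> colon J a"
  unfolding colon_def by (auto simp: mult.commute[of _ a] idl.subspace_scale)

lemma subspace_adj [simp]: "idl.subspace (adj J a)"
  by (simp add: adj_def)

lemma subset_adj: "J \<subseteq> adj J a"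
  by (auto simp: adj_def intro: idl.span_base)

lemma in_adj [simp]: "a \<in> adj J a"
  by (auto simp: adj_def intro: idl.span_base)

lemma adj_iff: "idl.subspace J \<Longrightarrow> x \<in> adj J a \<longleftrightarrow> (\<exists>k. x - k * a \<in> J)"
  unfolding adj_def by (simp add: idl.span_breakdown_eq idl.span_eq_iff[THEN iffD2])

lemma adj_span: "adj (idl.span G) a = idl.span (insert a G)"
  unfolding adj_def
  by (rule antisym; rule idl.span_minimal)
    (auto intro: idl.span_base idl.span_mono[THEN subsetD])

lemma homog_colon: "homog J \<Longrightarrow> a \<in> forms e \<Longrightarrow> homog (colon J a)"
  unfolding homog_def
proof (intro conjI ballI allI)
  assume J: "idl.subspace J \<and> (\<forall>f\<in>J. \<forall>d. hcomp d f \<in> J)" and a: "a \<in> forms e"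
  then show "idl.subspace (colon J a)" by (simp add: subspace_colon)
  fix f d assume "f \<in> colon J a"
  then have "hcomp (d + e) (f * a) \<in> J" using J by (auto simp: colon_def)
  then show "hcomp d f \<in> colon J a" using hcomp_mult_form[OF a] by (simp add: colon_def)
qed

lemma homog_adj:
  assumes "homog J" "a \<in> forms e"
  shows "homog (adj J a)"
  unfolding adj_def
proof (rule homog_span)
  fix g d assume g: "g \<in> insert a J"
  show "hcomp d g \<in> idl.span (insert a J)"
  proof (cases "g = a")
    case True
    then show ?thesis using assms(2) by (simp add: hcomp_form idl.span_base idl.span_zero)
  next
    case False
    then show ?thesis using g assms(1) by (intro idl.span_base) (auto simp: homog_def)
  qed
qed

section \<open>Dimensions of finite-dimensional subspaces\<close>

context Vector_Spaces.vector_space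
begin

text \<open>The polynomial ring has infinite dimension over K, so the lemmas on \<open>dim\<close>
  carry a finite set \<open>A\<close> whose span contains the spaces concerned.\<close>

lemma independent_finite_dim:
  assumes "finite A" "V \<subseteq> span A" "B \<subseteq> V" "independent B"
  shows "finite B"
  using independent_span_bound[OF assms(1,4)] assms by auto

lemma fd_basis:
  assumes "finite A" "V \<subseteq> span A"
  obtains B where "B \<subseteq> V" "V \<subseteq> span B" "independent B" "finite B" "card B = dim V"
proof -
  obtain B where B: "B \<subseteq> V" "independent B" "V \<subseteq> span B" "card B = dim V"
    using basis_exists[of V] by blast
  moreover have "finite B" using independent_finite_dim assms B(1,2) by blast
  ultimately show ?thesis using that by blast
qed

lemma dim_mono_fd:
  assumes "finite A" "V \<subseteq> span A" "U \<subseteq> V"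
  shows "dim U \<le> dim V"
proof -
  have "U \<subseteq> span A" using assms(2,3) by (rule subset_trans[rotated])
  from fd_basis[OF assms(1) this] obtain B where
    B: "B \<subseteq> U" "U \<subseteq> span B" "independent B" "card B = dim U" by metis
  from fd_basis[OF assms(1,2)] obtain C where
    C: "C \<subseteq> V" "V \<subseteq> span C" "finite C" "card C = dim V" by metis
  have "B \<subseteq> span C" using B(1) C(2) assms(3) by (meson order_trans)
  then show ?thesis using independent_span_bound[OF C(3) B(3)] B(4) C(4) by simp
qed

lemma dim_insert_fd:
  assumes "finite A" "S \<subseteq> span A" "x \<notin> span S"
  shows "dim (insert x S) = dim S + 1"
proof -
  obtain B where B: "B \<subseteq> S" "S \<subseteq> span B" "independent B" "finite B" "card B = dim S"
    using fd_basis assms by blast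
  have "x \<notin> span B" using assms(3) B(1) span_mono by blast
  then have ind: "independent (insert x B)" using B(3) by (rule independent_insertI)
  have "S \<subseteq> span (insert x B)" using B(2) span_mono[of B "insert x B"] by blast
  then have "insert x S \<subseteq> span (insert x B)" by (simp add: span_base)
  then have "card (insert x B) = dim (insert x S)"
    using basis_card_eq_dim[of "insert x B" "insert x S"] ind B(1) by blast
  moreover have "x \<notin> B" using \<open>x \<notin> span B\<close> span_base by blast
  ultimately show ?thesis using B by simp
qed

lemma subspace_eq_if_dim_eq:
  assumes "finite A" "V \<subseteq> span A" "U \<subseteq> V" "subspace U" "dim U = dim V"
  shows "U = V"
proof (rule ccontr)
  assume "U \<noteq> V"
  then obtain x where x: "x \<in> V" "x \<notin> U" using assms(3) by blast
  have "span U = U" using assms(4) by simp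
  then have "dim (insert x U) = dim U + 1"
    using dim_insert_fd[of A U x] assms x by blast
  moreover have "dim (insert x U) \<le> dim V"
    using dim_mono_fd[of A V "insert x U"] assms x by blast
  ultimately show False using assms(5) by simp
qed

text \<open>The rank-nullity theorem for the map \<open>V \<rightarrow> (T V + W) / W\<close>.\<close>

lemma dim_image_plus:
  assumes lin: "Vector_Spaces.linear scale scale T"
    and fin: "finite A" and V: "subspace V" "V \<subseteq> span A" and W: "subspace W" "W \<subseteq> span A"
  shows "dim {T v + w |v w. v \<in> V \<and> w \<in> W} + dim {v \<in> V. T v \<in> W} = dim V + dim W"
proof -
  interpret T: Vector_Spaces.linear scale scale T by (rule lin)
  let ?Z = "{v \<in> V. T v \<in> W}"
  have Z: "subspace ?Z"
    using subspace_inter[OF V(1) T.subspace_linear_preimage[OF W(1)]] by (simp add: Int_def)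
  obtain B0 where B0: "B0 \<subseteq> ?Z" "?Z \<subseteq> span B0" "independent B0" "finite B0" "card B0 = dim ?Z"
    using fd_basis[OF fin, of ?Z] V by blast
  have "B0 \<subseteq> V" using B0(1) by blast
  then obtain B where B: "B0 \<subseteq> B" "B \<subseteq> V" "independent B" "V \<subseteq> span B"
    using maximal_independent_subset_extend[OF _ B0(3)] by metis
  have finB: "finite B" using independent_finite_dim[OF fin V(2) B(2,3)] .
  have cardB: "card B = dim V" using basis_card_eq_dim[OF B(2,4,3)] .
  have spanB0: "span B0 \<subseteq> ?Z" using span_minimal[OF B0(1) Z] .
  have key: "dim (T ` D \<union> W) = card D + dim W" if "finite D" "D \<subseteq> B - B0" for D
    using that
  proof (induction D)
    case (insert x D)
    have "T x \<notin> span (T ` D \<union> W)"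
    proof
      assume "T x \<in> span (T ` D \<union> W)"
      then obtain a b where ab: "T x = a + b" "a \<in> span (T ` D)" "b \<in> span W"
        unfolding span_Un by blast
      then have "b \<in> W" using span_eq_iff[THEN iffD2, OF W(1)] by simp
      obtain v where v: "v \<in> span D" "a = T v" using ab(2) T.span_image by blast
      have "x \<in> V" using insert B by blast
      moreover have "v \<in> V" using v(1) span_minimal[OF _ V(1), of D] insert B by blast
      ultimately have "x - v \<in> ?Z" using ab v \<open>b \<in> W\<close> V(1) by (simp add: subspace_diff T.diff)
      then have "x - v \<in> span (B0 \<union> D)" using B0(2) span_mono[of B0 "B0 \<union> D"] by blast
      moreover have "v \<in> span (B0 \<union> D)" using v(1) span_mono[of D "B0 \<union> D"] by blast
      ultimately have "x \<in> span (B0 \<union> D)" using span_add[of "x - v" "B0 \<union> D" v] by simp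
      moreover have "B0 \<union> D \<subseteq> B - {x}" using insert B by blast
      ultimately have "x \<in> span (B - {x})" using span_mono by blast
      then show False using B(3) insert(4) unfolding dependent_def by blast
    qed
    moreover have "T ` D \<union> W \<subseteq> span (T ` D \<union> A)"
      using W(2) span_mono[of A "T ` D \<union> A"] by (auto intro: span_base)
    moreover have "finite (T ` D \<union> A)" using insert(1) fin by simp
    ultimately have "dim (insert (T x) (T ` D \<union> W)) = dim (T ` D \<union> W) + 1"
      using dim_insert_fd by blast
    then show ?case using insert by simp
  qed simp
  have "span (T ` (B - B0) \<union> W) = {T v + w |v w. v \<in> V \<and> w \<in> W}" (is "?L = ?R")
  proof
    show "?L \<subseteq> ?R"
    proof (rule span_minimal)
      show "T ` (B - B0) \<union> W \<subseteq> ?R"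
      proof
        fix y assume "y \<in> T ` (B - B0) \<union> W"
        then show "y \<in> ?R"
        proof
          assume "y \<in> T ` (B - B0)"
          then obtain x where "x \<in> V" "y = T x + 0" using B(2) by auto
          then show ?thesis using subspace_0[OF W(1)] by blast
        next
          assume "y \<in> W"
          moreover have "y = T 0 + y" by simp
          ultimately show ?thesis using subspace_0[OF V(1)] by blast
        qed
      qed
      have "?R = {x + y |x y. x \<in> T ` V \<and> y \<in> W}" by blast
      then show "subspace ?R" using subspace_sums[OF T.subspace_image[OF V(1)] W(1)] by simp
    qed
    show "?R \<subseteq> ?L"
    proof
      fix y assume "y \<in> ?R"
      then obtain v w where y: "y = T v + w" "v \<in> V" "w \<in> W" by blast
      have "B = B0 \<union> (B - B0)" using B(1) by blast
      then have "v \<in> span (B0 \<union> (B - B0))" using y B by auto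
      then obtain a b where ab: "v = a + b" "a \<in> span B0" "b \<in> span (B - B0)"
        unfolding span_Un by blast
      have "T a \<in> W" using ab spanB0 by blast
      then have "T a \<in> ?L" by (intro span_base) blast
      moreover have "T b \<in> span (T ` (B - B0))" using ab T.span_image by blast
      then have "T b \<in> ?L" using span_mono[of "T ` (B - B0)" "T ` (B - B0) \<union> W"] by blast
      moreover have "w \<in> ?L" using y by (intro span_base) blast
      ultimately show "y \<in> ?L" using y ab by (simp add: T.add span_add)
    qed
  qed
  then have "dim {T v + w |v w. v \<in> V \<and> w \<in> W} = dim (T ` (B - B0) \<union> W)"
    by (metis dim_span)
  also have "\<dots> = card (B - B0) + dim W" using finB by (intro key) auto
  also have "card (B - B0) = dim V - dim ?Z"
    using B0 B finB cardB by (simp add: card_Diff_subset)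
  finally show ?thesis using card_mono[OF finB B(1)] B0 cardB by simp
qed

end

section \<open>Hilbert functions\<close>

lemma finite_mdeg_le: "finite {m :: 'n::finite \<Rightarrow>\<^sub>0 nat. mdeg m \<le> d}"
proof -
  have "lookup m i \<le> mdeg m" for m :: "'n \<Rightarrow>\<^sub>0 nat" and i
    unfolding mdeg_def by (rule member_le_sum) auto
  then have "lookup ` {m :: 'n \<Rightarrow>\<^sub>0 nat. mdeg m \<le> d} \<subseteq> PiE UNIV (\<lambda>_. {..d})"
    by (auto intro: order_trans)
  moreover have "finite (PiE (UNIV :: 'n set) (\<lambda>_. {..d}))" by (intro finite_PiE) auto
  ultimately have "finite (lookup ` {m :: 'n \<Rightarrow>\<^sub>0 nat. mdeg m \<le> d})"
    using finite_subset by blast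
  then show ?thesis
    by (rule finite_imageD) (auto simp: inj_on_def intro: poly_mapping_eqI)
qed

definition monomials :: "nat \<Rightarrow> ('n::finite, 'k::field) mpoly set" where
  "monomials d = (\<lambda>m. single m 1) ` {m. mdeg m \<le> d}"

lemma finite_monomials [simp]: "finite (monomials d)"
  by (simp add: monomials_def finite_mdeg_le)

lemma smul_single: "smul c (single m b) = single m (c * b)"
  by (simp add: smul_def mult_single)

lemma upto_span: "forms_upto d \<subseteq> vs.span (monomials d)"
proof
  fix f :: "('a, 'b) mpoly" assume f: "f \<in> forms_upto d"
  have "(\<Sum>m\<in>keys f. smul (lookup f m) (single m 1)) \<in> vs.span (monomials d)"
    using f by (intro vs.span_sum vs.span_scale vs.span_base) (auto simp: monomials_def
      forms_upto_def)
  then show "f \<in> vs.span (monomials d)" using poly_sum_single[of f] by (simp add: smul_single)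
qed

lemma upto_fd: "d \<le> e \<Longrightarrow> D \<subseteq> forms_upto d \<Longrightarrow> D \<subseteq> vs.span (monomials e)"
  using upto_span[of e] upto_mono[of d e] by blast

text \<open>The codimension of \<open>J \<inter> V\<close> in \<open>V\<close>.\<close>

definition cod :: "('n::finite, 'k::field) mpoly set \<Rightarrow> ('n, 'k) mpoly set \<Rightarrow> int" where
  "cod V J = int (vs.dim V) - int (vs.dim (J \<inter> V))"

lemma cod_mono:
  assumes "V \<subseteq> forms_upto d" "J \<subseteq> J'"
  shows "cod V J' \<le> cod V J"
proof -
  have "vs.dim (J \<inter> V) \<le> vs.dim (J' \<inter> V)"
    by (rule vs.dim_mono_fd[OF finite_monomials upto_fd[of d d]]) (use assms in auto)
  then show ?thesis by (simp add: cod_def)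
qed

lemma cod_nonneg: "V \<subseteq> forms_upto d \<Longrightarrow> 0 \<le> cod V J"
  using vs.dim_mono_fd[OF finite_monomials upto_fd[of d d], of V "J \<inter> V"] by (simp add: cod_def)

lemma cod_eq_imp:
  assumes "V \<subseteq> forms_upto d" "J \<subseteq> J'" "cod V J' = cod V J" "vs.subspace J" "vs.subspace V"
  shows "J \<inter> V = J' \<inter> V"
proof (rule vs.subspace_eq_if_dim_eq[OF finite_monomials upto_fd[of d d]])
  show "vs.dim (J \<inter> V) = vs.dim (J' \<inter> V)" using assms(3) by (simp add: cod_def)
  show "vs.subspace (J \<inter> V)" using assms by (simp add: vs.subspace_inter)
qed (use assms in auto)

lemma cod_UNIV [simp]: "cod V UNIV = 0"
  by (simp add: cod_def)

lemma linear_mult: "Vector_Spaces.linear smul smul (\<lambda>f. a * f)"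
  unfolding Vector_Spaces.linear_iff
  by (intro conjI vs.vector_space_axioms) (auto simp: distrib_left smul_def mult.left_commute)

text \<open>Rank-nullity for multiplication by \<open>a\<close> from \<open>V\<close> to
  \<open>V' / (J \<inter> V')\<close>. Only the trace of \<open>K\<close> on \<open>V'\<close> is
  prescribed, so the lemma serves graded pieces, where \<open>K\<close> is (J, a), as well as the
  filtration by degree, where \<open>K\<close> is merely a subspace.\<close>

lemma cod_exact:
  assumes V: "vs.subspace V" "V \<subseteq> forms_upto d" "vs.subspace V'" "V' \<subseteq> forms_upto d"
    and J: "vs.subspace J" and aV: "\<And>v. v \<in> V \<Longrightarrow> a * v \<in> V'"
    and K: "K \<inter> V' = {a * v + w |v w. v \<in> V \<and> w \<in> J \<inter> V'}"
  shows "cod V' J = cod V' K + cod V (colon J a)"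
proof -
  have "vs.dim {a * v + w |v w. v \<in> V \<and> w \<in> J \<inter> V'} + vs.dim {v \<in> V. a * v \<in> J \<inter> V'} =
      vs.dim V + vs.dim (J \<inter> V')"
    by (rule vs.dim_image_plus[OF linear_mult finite_monomials[of d]])
      (use V J upto_fd[of d d] in \<open>auto simp: vs.subspace_inter\<close>)
  moreover have "{v \<in> V. a * v \<in> J \<inter> V'} = colon J a \<inter> V"
    using aV by (auto simp: colon_def mult.commute)
  ultimately show ?thesis using K by (simp add: cod_def)
qed

abbreviation HF :: "('n::finite, 'k::field) mpoly set \<Rightarrow> nat \<Rightarrow> int" where
  "HF J d \<equiv> cod (forms d) J"

text \<open>The affine Hilbert function. It also makes sense for ideals that are not homogeneous,
  and chains of primes contain such ideals.\<close>

abbreviation HFa :: "('n::finite, 'k::field) mpoly set \<Rightarrow> nat \<Rightarrow> int" where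
  "HFa J d \<equiv> cod (forms_upto d) J"

lemma HF_exact:
  assumes J: "homog J" and a: "a \<in> forms e"
  shows "HF J (d + e) = HF (adj J a) (d + e) + HF (colon J a) d"
proof (rule cod_exact)
  note sub = homogD(1)[OF J]
  show "forms d \<subseteq> forms_upto (d + e)" "forms (d + e) \<subseteq> forms_upto (d + e)"
    using forms_subset_upto upto_mono[of d "d + e"] by auto
  show "vs.subspace J" using sub by simp
  show "a * v \<in> forms (d + e)" if "v \<in> forms d" for v
    using forms_mult[OF a that] by (simp add: add.commute)
  then show "adj J a \<inter> forms (d + e) = {a * v + w |v w. v \<in> forms d \<and> w \<in> J \<inter> forms (d + e)}"
  proof (intro equalityI subsetI, goal_cases)
    case (1 x)
    then obtain k where k: "x - k * a \<in> J" using adj_iff[OF sub] by blast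
    \<comment> \<open>Taking the component of degree \<open>d + e\<close> replaces the multiplier
      \<open>k\<close> by a form of degree \<open>d\<close>.\<close>
    have "hcomp (d + e) (x - k * a) = x - hcomp d k * a"
      using 1 hcomp_form[of x "d + e" "d + e"] by (simp add: hcomp_diff hcomp_mult_form[OF a])
    then have "x - hcomp d k * a \<in> J" using homogD(2)[OF J k] by metis
    moreover have "x - hcomp d k * a \<in> forms (d + e)"
      using 1 forms_mult[OF hcomp_in_forms a, of d k]
      by (auto intro: vs.subspace_diff[OF vs_subspace_forms])
    moreover have "x = a * hcomp d k + (x - hcomp d k * a)" by (simp add: mult.commute)
    ultimately show ?case using hcomp_in_forms by blast
  next
    case (2 x)
    then obtain v w where vw: "x = a * v + w" "v \<in> forms d" "w \<in> J" "w \<in> forms (d + e)" by blast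
    have "x - v * a \<in> J" using vw by (simp add: mult.commute)
    then have "x \<in> adj J a" using adj_iff[OF sub] by blast
    moreover have "x \<in> forms (d + e)"
      unfolding vw(1) using 2(1) vw by (intro vs.subspace_add[OF vs_subspace_forms]) auto
    ultimately show ?case by blast
  qed
qed simp_all

lemma HF_adj_low:
  assumes J: "homog J" and a: "a \<in> forms e" and d: "d < e"
  shows "HF (adj J a) d = HF J d"
proof -
  note sub = homogD(1)[OF J]
  have "adj J a \<inter> forms d = J \<inter> forms d"
  proof (intro equalityI subsetI)
    fix x assume x: "x \<in> adj J a \<inter> forms d"
    then obtain k where k: "x - k * a \<in> J" using adj_iff[OF sub] by blast
    have "hcomp d (x - k * a) = x"
      using x d hcomp_form[of x d d] by (simp add: hcomp_diff hcomp_mult_form[OF a])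
    then show "x \<in> J \<inter> forms d" using homogD(2)[OF J k, of d] x by simp
  qed (use subset_adj in auto)
  then show ?thesis by (simp add: cod_def)
qed

section \<open>Hilbert series and the exact sequence of a form\<close>

definition HS :: "('n::finite, 'k::field) mpoly set \<Rightarrow> int fps" where
  "HS J = Abs_fps (HF J)"

lemma HS_nth [simp]: "fps_nth (HS J) d = HF J d"
  by (simp add: HS_def)

lemma HS_exact:
  assumes J: "homog J" and a: "a \<in> forms e"
  shows "HS J = HS (adj J a) + fps_X ^ e * HS (colon J a)"
proof (rule fps_ext)
  fix d
  show "fps_nth (HS J) d = fps_nth (HS (adj J a) + fps_X ^ e * HS (colon J a)) d"
    using HF_exact[OF J a, of "d - e"] HF_adj_low[OF J a, of d]
    by (cases "d < e") (simp_all add: fps_X_power_mult_nth)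
qed

lemma HFa_Suc:
  assumes J: "homog J"
  shows "HFa J (Suc d) = HFa J d + HF J (Suc d)"
proof -
  \<comment> \<open>The claim is the difference of this identity for the whole ring and for
    \<open>J\<close>.\<close>
  have *: "vs.dim (K \<inter> forms_upto (Suc d)) = vs.dim (K \<inter> forms_upto d) + vs.dim (K \<inter> forms (Suc d))"
    if K: "homog K" for K :: "('a, 'b) mpoly set"
  proof -
    let ?V = "K \<inter> forms_upto d" and ?W = "K \<inter> forms (Suc d)"
    have up: "forms_upto d \<subseteq> forms_upto (Suc d)" by (rule upto_mono) simp
    have fo: "forms (Suc d) \<subseteq> forms_upto (Suc d)" by (rule forms_subset_upto)
    have "vs.dim {v + w |v w. v \<in> ?V \<and> w \<in> ?W} + vs.dim {v \<in> ?V. v \<in> ?W} = vs.dim ?V + vs.dim ?W"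
      by (rule vs.dim_image_plus[OF vs.linear_ident finite_monomials[of "Suc d"]])
        (use homogD(1)[OF K] up fo upto_span[of "Suc d"] in \<open>auto simp: vs.subspace_inter\<close>)
    moreover have "{v \<in> ?V. v \<in> ?W} = {0}"
    proof -
      have "v = 0" if "v \<in> forms_upto d" "v \<in> forms (Suc d)" for v :: "('a, 'b) mpoly"
        by (rule poly_mapping_eqI) (use that in \<open>auto simp: upto_iff forms_iff; fastforce\<close>)
      moreover have "0 \<in> ?V" "0 \<in> ?W"
        using homogD(1)[OF K] by (auto simp: idl.subspace_0 vs.subspace_0)
      ultimately show ?thesis by blast
    qed
    moreover have "{v + w |v w. v \<in> ?V \<and> w \<in> ?W} = K \<inter> forms_upto (Suc d)"
    proof (intro equalityI subsetI)
      fix x assume "x \<in> {v + w |v w. v \<in> ?V \<and> w \<in> ?W}"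
      then obtain v w where "x = v + w" "v \<in> ?V" "w \<in> ?W" by blast
      then show "x \<in> K \<inter> forms_upto (Suc d)"
        using up fo homogD(1)[OF K] vs.subspace_add[OF vs_subspace_upto, of v "Suc d" w]
        by (auto simp: idl.subspace_add)
    next
      fix x assume x: "x \<in> K \<inter> forms_upto (Suc d)"
      have "x - hcomp (Suc d) x \<in> forms_upto d"
        using x by (auto simp: upto_iff lookup_minus le_Suc_eq)
      moreover have "x - hcomp (Suc d) x \<in> K" "hcomp (Suc d) x \<in> K"
        using x K by (auto simp: homog_def idl.subspace_diff)
      moreover have "x = (x - hcomp (Suc d) x) + hcomp (Suc d) x" by simp
      ultimately show "x \<in> {v + w |v w. v \<in> ?V \<and> w \<in> ?W}" using hcomp_in_forms by blast
    qed
    moreover have "vs.dim {0 :: ('a, 'b) mpoly} = 0"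
      by (metis vs.dim_span vs.span_empty vs.dim_eq_card_independent vs.independent_empty
        card.empty)
    ultimately show ?thesis by simp
  qed
  from *[OF J] *[OF homog_UNIV] show ?thesis by (simp add: cod_def)
qed

lemma HFa_sum:
  assumes "homog J"
  shows "HFa J d = (\<Sum>i\<le>d. HF J i)"
  by (induction d) (simp_all add: upto_0 HFa_Suc[OF assms])

section \<open>Power series with integer coefficients\<close>

definition fle :: "int fps \<Rightarrow> int fps \<Rightarrow> bool" where
  "fle f g \<longleftrightarrow> (\<forall>n. fps_nth f n \<le> fps_nth g n)"

lemma fle_refl [simp]: "fle f f"
  by (simp add: fle_def)

lemma fle_trans: "fle f g \<Longrightarrow> fle g h \<Longrightarrow> fle f h"
  unfolding fle_def by (meson order_trans)

lemma fle_antisym: "fle f g \<Longrightarrow> fle g f \<Longrightarrow> f = g"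
  unfolding fle_def by (intro fps_ext) (meson antisym)

lemma fle_mult_right:
  assumes "fle f g" "fle 0 h"
  shows "fle (f * h) (g * h)"
  using assms unfolding fle_def fps_mult_nth by (auto intro!: sum_mono mult_right_mono)

lemma fle_mult_nonneg: "fle 0 f \<Longrightarrow> fle 0 g \<Longrightarrow> fle 0 (f * g)"
  using fle_mult_right[of 0 f g] by simp

lemma fle_one [simp]: "fle 0 1"
  by (simp add: fle_def)

lemma fle_power_nonneg: "fle 0 f \<Longrightarrow> fle 0 (f ^ n)"
  by (induction n) (simp_all add: fle_mult_nonneg)

lemma fle_add: "fle f g \<Longrightarrow> fle f' g' \<Longrightarrow> fle (f + f') (g + g')"
  by (auto simp: fle_def intro: add_mono)

lemma fle_diff_iff: "fle 0 (g - f) \<longleftrightarrow> fle f g"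
  by (auto simp: fle_def)

text \<open>\<open>geo e\<close> and \<open>gs\<close> are the inverses of \<open>1 - X ^ e\<close> and \<open>1 - X\<close>; the integers are not a field, so
  division of power series is not available.\<close>

definition geo :: "nat \<Rightarrow> int fps" where
  "geo e = Abs_fps (\<lambda>d. if e dvd d then 1 else 0)"

lemma geo_inverse:
  assumes "e \<ge> 1"
  shows "(1 - fps_X ^ e) * geo e = 1"
proof (rule fps_ext)
  fix n
  show "fps_nth ((1 - fps_X ^ e) * geo e) n = fps_nth 1 n"
    using assms
    by (cases "n < e")
      (auto simp: left_diff_distrib fps_X_power_mult_nth geo_def dvd_imp_le not_less dvd_minus_self
        dest: dvd_imp_le)
qed

lemma geo_nonneg [simp]: "fle 0 (geo e)"
  by (simp add: fle_def geo_def)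

definition gs :: "int fps" where
  "gs = Abs_fps (\<lambda>_. 1)"

lemma gs_geo: "geo 1 = gs"
  by (rule fps_ext) (simp add: geo_def gs_def)

lemma gs_nth [simp]: "fps_nth gs n = 1"
  by (simp add: gs_def)

lemma gs_nonneg [simp]: "fle 0 gs"
  by (simp add: fle_def)

lemma gs_inverse: "(1 - fps_X) * gs = 1" "gs * (1 - fps_X) = 1"
  using geo_inverse[of 1] unfolding gs_geo by (simp_all add: mult.commute)

lemma gs_power_inverse: "(1 - fps_X) ^ k * gs ^ k = 1" "gs ^ k * (1 - fps_X) ^ k = 1"
  by (simp_all add: gs_inverse flip: power_mult_distrib)

lemma mult_gs_nth: "fps_nth (f * gs) n = (\<Sum>i\<le>n. fps_nth f i)"
  by (simp add: fps_mult_nth atLeast0AtMost)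

lemma gs_power_nth: "fps_nth (gs ^ Suc k) n = int ((n + k) choose k)"
proof (induction k arbitrary: n)
  case (Suc k)
  have "fps_nth (gs ^ Suc (Suc k)) n = (\<Sum>i\<le>n. fps_nth (gs ^ Suc k) i)"
    by (metis mult_gs_nth power_Suc2)
  also have "\<dots> = int (\<Sum>i\<le>n. (k + i) choose k)"
    unfolding Suc.IH by (simp add: add.commute)
  also have "(\<Sum>i\<le>n. (k + i) choose k) = (n + Suc k) choose Suc k"
    using choose_rising_sum(1)[of k n] by (simp add: add.commute)
  finally show ?case .
qed simp

lemma HS_nonneg [simp]: "fle 0 (HS J)"
  by (simp add: fle_def cod_nonneg[OF forms_subset_upto])

lemma HS_mono: "J \<subseteq> J' \<Longrightarrow> fle (HS J') (HS J)"
  by (simp add: fle_def cod_mono[OF forms_subset_upto])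

lemma HS_UNIV [simp]: "HS UNIV = 0"
  by (rule fps_ext) simp

lemma homog_subset_if_forms:
  assumes "homog J" "\<And>d. J \<inter> forms d \<subseteq> J'" "idl.subspace J'"
  shows "J \<subseteq> J'"
proof
  fix f assume f: "f \<in> J"
  obtain N where "f \<in> forms_upto N" using ex_upto by blast
  then have "f = (\<Sum>d\<le>N. hcomp d f)" by (rule sum_hcomp)
  moreover have "hcomp d f \<in> J'" for d using assms(2)[of d] homogD(2)[OF assms(1) f, of d] by auto
  ultimately show "f \<in> J'" using assms(3) by (metis idl.subspace_sum)
qed

lemma HS_eq_imp:
  assumes "homog J" "homog J'" "J \<subseteq> J'" "HS J = HS J'"
  shows "J = J'"
proof -
  have "J \<inter> forms d = J' \<inter> forms d" for d
  proof (rule cod_eq_imp[OF forms_subset_upto assms(3)])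
    have "fps_nth (HS J) d = fps_nth (HS J') d" using assms(4) by simp
    then show "HF J' d = HF J d" by simp
  qed (use homogD(1)[OF assms(1)] in simp_all)
  then show ?thesis using homog_subset_if_forms[OF assms(2), of J] assms homogD(1) by blast
qed

text \<open>Equality holds iff \<open>a\<close> is a nonzerodivisor modulo \<open>J\<close>.\<close>

lemma HS_adj_ge:
  assumes "homog J" "a \<in> forms e" "e \<ge> 1"
  shows "fle (HS J) (HS (adj J a) * geo e)"
proof -
  have "fle (HS (colon J a)) (HS J)"
    using HS_mono[OF subset_colon[OF homogD(1)[OF assms(1)]]] .
  then have "fle 0 ((HS J - HS (colon J a)) * fps_X ^ e)"
    by (intro fle_mult_nonneg) (auto simp: fle_diff_iff fps_X_power_iff,
      simp add: fle_def fps_X_power_nth)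
  then have "fle (HS J * (1 - fps_X ^ e)) (HS (adj J a))"
    using HS_exact[OF assms(1,2)] by (simp add: fle_def algebra_simps)
  then have "fle (HS J * (1 - fps_X ^ e) * geo e) (HS (adj J a) * geo e)"
    by (rule fle_mult_right) simp
  then show ?thesis by (simp add: geo_inverse[OF assms(3)] mult.assoc)
qed

section \<open>Prime ideals\<close>

definition prm :: "('n::finite, 'k::field) mpoly set \<Rightarrow> bool" where
  "prm P \<longleftrightarrow> idl.subspace P \<and> P \<noteq> UNIV \<and> (\<forall>a b. a * b \<in> P \<longrightarrow> a \<in> P \<or> b \<in> P)"

lemma prmD: "prm P \<Longrightarrow> idl.subspace P" "prm P \<Longrightarrow> P \<noteq> UNIV"
    "prm P \<Longrightarrow> a * b \<in> P \<Longrightarrow> a \<in> P \<or> b \<in> P"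
  by (auto simp: prm_def)

lemma proper_iff: "idl.subspace J \<Longrightarrow> J \<noteq> UNIV \<longleftrightarrow> 1 \<notin> J"
  using idl.subspace_scale[of J 1] by (metis UNIV_I UNIV_eq_I mult.right_neutral)

lemma colon_prm: "prm P \<Longrightarrow> a \<notin> P \<Longrightarrow> colon P a = P"
  using subset_colon[OF prmD(1)] prmD(3)[of P _ a] by (auto simp: colon_def)

lemma prm_power: "prm P \<Longrightarrow> a ^ n \<in> P \<Longrightarrow> a \<in> P"
  by (induction n) (use proper_iff prmD in \<open>auto dest: prmD(3)\<close>)

text \<open>Primality of a homogeneous ideal can be tested on forms: given \<open>f, g\<close> outside \<open>J\<close> with
  \<open>f g\<close> in \<open>J\<close>, look at the lowest components of \<open>f\<close> and \<open>g\<close> that are not in \<open>J\<close>.\<close>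

lemma homog_prm_test:
  assumes J: "homog J" "J \<noteq> UNIV" and not: "\<not> prm J"
  obtains a b i j where "a \<in> forms i" "b \<in> forms j" "a \<notin> J" "b \<notin> J" "a * b \<in> J"
proof -
  note sub = homogD(1)[OF J(1)]
  obtain f g where fg: "f * g \<in> J" "f \<notin> J" "g \<notin> J"
    using not J sub by (auto simp: prm_def)
  have ex: "\<exists>d. hcomp d h \<notin> J" if "h \<notin> J" for h
    using that ex_upto[of h] sum_hcomp[of h] idl.subspace_sum[OF sub] by metis
  define i where "i = (LEAST d. hcomp d f \<notin> J)"
  define j where "j = (LEAST d. hcomp d g \<notin> J)"
  have i: "hcomp i f \<notin> J" "\<And>d. d < i \<Longrightarrow> hcomp d f \<in> J"
    unfolding i_def using LeastI_ex[OF ex[OF fg(2)]] not_less_Least by blast+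
  have j: "hcomp j g \<notin> J" "\<And>d. d < j \<Longrightarrow> hcomp d g \<in> J"
    unfolding j_def using LeastI_ex[OF ex[OF fg(3)]] not_less_Least by blast+
  have "hcomp (i + j) (f * g) \<in> J" using homogD(2)[OF J(1) fg(1)] .
  also have "hcomp (i + j) (f * g) = (\<Sum>d\<le>i + j. hcomp d f * hcomp (i + j - d) g)"
    by (rule hcomp_mult)
  also have "\<dots> = hcomp i f * hcomp j g + (\<Sum>d\<in>{..i + j} - {i}. hcomp d f * hcomp (i + j - d) g)"
    by (subst sum.remove[of _ i]) auto
  finally have "hcomp i f * hcomp j g + (\<Sum>d\<in>{..i + j} - {i}. hcomp d f * hcomp (i + j - d) g) \<in> J" .
  moreover have "(\<Sum>d\<in>{..i + j} - {i}. hcomp d f * hcomp (i + j - d) g) \<in> J"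
  proof (rule idl.subspace_sum[OF sub])
    fix d assume "d \<in> {..i + j} - {i}"
    then consider "d < i" | "i + j - d < j" by force
    then show "hcomp d f * hcomp (i + j - d) g \<in> J"
    proof cases
      case 1
      then show ?thesis using i(2) idl.subspace_scale[OF sub] by (metis mult.commute)
    next
      case 2
      then show ?thesis using j(2) idl.subspace_scale[OF sub] by blast
    qed
  qed
  ultimately have "hcomp i f * hcomp j g \<in> J" using idl.subspace_diff[OF sub] by fastforce
  then show ?thesis using that[OF hcomp_in_forms hcomp_in_forms i(1) j(1)] by blast
qed

text \<open>Localising at \<open>Q\<close>: among the ideals \<open>{x. \<exists>u\<notin>Q. u x f \<in> I}\<close> a maximal proper one is prime, and
  since it is finitely generated it equals \<open>I : u f\<close> for a single \<open>u \<notin> Q\<close>.\<close>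

lemma ex_assoc_prime_below:
  fixes I :: "('n::finite, 'k::field) mpoly set"
  assumes I: "idl.subspace I" and Q: "prm Q" "I \<subseteq> Q"
  shows "\<exists>P f. prm P \<and> P \<subseteq> Q \<and> P = colon I f"
proof -
  note Qs = prmD(1)[OF Q(1)]
  have one: "1 \<notin> Q" using proper_iff Q(1) prmD by blast
  have mulQ: "u * v \<notin> Q" if "u \<notin> Q" "v \<notin> Q" for u v using that prmD(3)[OF Q(1)] by blast
  define L where "L f = {x. \<exists>u. u \<notin> Q \<and> u * x * f \<in> I}" for f
  have Ls: "idl.subspace (L f)" for f
  proof (rule idl.subspaceI)
    show "0 \<in> L f" using one I by (auto simp: L_def idl.subspace_0)
    fix x y assume "x \<in> L f" "y \<in> L f"
    then obtain u v where uv: "u \<notin> Q" "u * x * f \<in> I" "v \<notin> Q" "v * y * f \<in> I"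
      by (auto simp: L_def)
    have "u * v * (x + y) * f = v * (u * x * f) + u * (v * y * f)" by (simp add: algebra_simps)
    also have "\<dots> \<in> I"
      using idl.subspace_add[OF I idl.subspace_scale[OF I uv(2)] idl.subspace_scale[OF I uv(4)]] .
    finally show "x + y \<in> L f" using mulQ[OF uv(1,3)] by (auto simp: L_def)
  next
    fix c x assume "x \<in> L f"
    then obtain u where u: "u \<notin> Q" "u * x * f \<in> I" by (auto simp: L_def)
    have "u * (c * x) * f = c * (u * x * f)" by (simp add: algebra_simps)
    also have "\<dots> \<in> I" using idl.subspace_scale[OF I u(2)] .
    finally show "c * x \<in> L f" using u(1) by (auto simp: L_def)
  qed
  let ?A = "{L f |f. 1 \<notin> L f}"
  have "1 \<notin> L 1" using Q(2) by (auto simp: L_def)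
  then have "L 1 \<in> ?A" by blast
  moreover have "\<And>J. J \<in> ?A \<Longrightarrow> idl.subspace J" using Ls by blast
  ultimately have "\<exists>J\<in>?A. L 1 \<subseteq> J \<and> (\<forall>J'\<in>?A. \<not> J \<subset> J')" by (rule ex_maximal_ideal)
  then obtain J where J: "J \<in> ?A" "L 1 \<subseteq> J \<and> (\<forall>J'\<in>?A. \<not> J \<subset> J')" ..
  then obtain f where f: "1 \<notin> L f" "J = L f" by auto
  have max: "\<not> L f \<subset> L g" if "1 \<notin> L g" for g
    using J(2) f(2) that by auto
  have "prm (L f)"
    unfolding prm_def
  proof (intro conjI allI impI)
    show "L f \<noteq> UNIV" using f(1) by blast
    fix a b assume ab: "a * b \<in> L f"
    show "a \<in> L f \<or> b \<in> L f"
    proof (rule ccontr)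
      assume "\<not> (a \<in> L f \<or> b \<in> L f)"
      then have nab: "a \<notin> L f" "b \<notin> L f" by auto
      \<comment> \<open>That \<open>a\<close> lies outside \<open>L f\<close> says exactly that
        \<open>L (a * f)\<close> is proper. It contains \<open>L f\<close> and the element
        \<open>b\<close>, against maximality.\<close>
      have "1 \<notin> L (a * f)" using nab(1) by (auto simp: L_def mult.assoc)
      moreover have "L f \<subseteq> L (a * f)"
      proof
        fix x assume "x \<in> L f"
        then obtain u where u: "u \<notin> Q" "u * x * f \<in> I" by (auto simp: L_def)
        have "u * x * (a * f) = a * (u * x * f)" by (simp add: algebra_simps)
        then have "u * x * (a * f) \<in> I"
          using idl.subspace_scale[OF I u(2), of a] by (simp only:)
        then show "x \<in> L (a * f)" using u by (auto simp: L_def)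
      qed
      moreover have "b \<in> L (a * f)" using ab by (auto simp: L_def ac_simps)
      ultimately show False using max[of "a * f"] nab(2) by blast
    qed
  qed (rule Ls)
  moreover have "L f \<subseteq> Q"
  proof
    fix x assume "x \<in> L f"
    then obtain u where u: "u \<notin> Q" "u * x * f \<in> I" by (auto simp: L_def)
    show "x \<in> Q"
    proof (rule ccontr)
      assume "x \<notin> Q"
      then have "u * x \<notin> Q" using mulQ u by blast
      then show False using u f(1) by (auto simp: L_def)
    qed
  qed
  moreover have "\<exists>u. u \<notin> Q \<and> L f = colon I (u * f)"
  proof -
    obtain G where G: "finite G" "idl.span G = L f"
      using finite_ideal_generators[of "L f"] idl.span_eq_iff[THEN iffD2, OF Ls] by auto
    \<comment> \<open>A common denominator: the product of the multipliers of the finitely many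
      generators, which stays outside the prime \<open>Q\<close>.\<close>
    have "\<exists>u. u \<notin> Q \<and> (\<forall>g\<in>G'. u * g * f \<in> I)" if "finite G'" "G' \<subseteq> L f" for G'
      using that
    proof (induction G')
      case empty
      then show ?case using one by auto
    next
      case (insert g G')
      then obtain u v where uv: "u \<notin> Q" "\<forall>g\<in>G'. u * g * f \<in> I" "v \<notin> Q" "v * g * f \<in> I"
        by (auto simp: L_def)
      have "u * v * h * f \<in> I" if "h \<in> insert g G'" for h
      proof -
        have "u * v * h * f = v * (u * h * f)" "u * v * h * f = u * (v * h * f)"
          by (simp_all add: algebra_simps)
        then show ?thesis using that uv idl.subspace_scale[OF I] by (metis insert_iff)
      qed
      then show ?case using mulQ[OF uv(1,3)] by blast
    qed
    moreover have "G \<subseteq> L f" using G(2) idl.span_superset by blast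
    ultimately obtain u where u: "u \<notin> Q" "\<forall>g\<in>G. u * g * f \<in> I" using G(1) by blast
    have "G \<subseteq> colon I (u * f)" using u(2) by (auto simp: colon_def ac_simps)
    then have "L f \<subseteq> colon I (u * f)"
      unfolding G(2)[symmetric] by (intro idl.span_minimal subspace_colon I)
    moreover have "colon I (u * f) \<subseteq> L f"
      using u(1) by (auto simp: colon_def L_def ac_simps)
    ultimately show ?thesis using u(1) by blast
  qed
  ultimately show ?thesis by blast
qed

text \<open>A maximal ideal among the annihilators of nonzero elements of S/I is prime: if
  \<open>a * f\<close> is nonzero modulo \<open>I\<close>, its annihilator contains that of
  \<open>f\<close>, hence equals it.\<close>

lemma ex_assoc_prime_above_colon:
  fixes I :: "('n::finite, 'k::field) mpoly set"
  assumes I: "idl.subspace I" and g: "g \<notin> I"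
  shows "\<exists>P f. prm P \<and> P = colon I f \<and> colon I g \<subseteq> P"
proof -
  let ?A = "{colon I f |f. f \<notin> I}"
  have "colon I g \<in> ?A" using g by blast
  moreover have "\<And>J. J \<in> ?A \<Longrightarrow> idl.subspace J" using subspace_colon[OF I] by blast
  ultimately have "\<exists>J\<in>?A. colon I g \<subseteq> J \<and> (\<forall>J'\<in>?A. \<not> J \<subset> J')" by (rule ex_maximal_ideal)
  then obtain J where J1: "J \<in> ?A" and "colon I g \<subseteq> J \<and> (\<forall>J'\<in>?A. \<not> J \<subset> J')" ..
  then have J: "J \<in> ?A" "colon I g \<subseteq> J" "\<forall>J'\<in>?A. \<not> J \<subset> J'" by simp_all
  then obtain f where f: "f \<notin> I" "J = colon I f" by auto
  have max: "\<not> colon I f \<subset> colon I h" if "h \<notin> I" for h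
    using J(3) f(2) that by auto
  have "prm (colon I f)"
    unfolding prm_def
  proof (intro conjI allI impI)
    have "1 \<notin> colon I f" using f(1) by (simp add: colon_def)
    then show "colon I f \<noteq> UNIV" by blast
    fix a b assume ab: "a * b \<in> colon I f"
    show "a \<in> colon I f \<or> b \<in> colon I f"
    proof (rule ccontr)
      assume "\<not> (a \<in> colon I f \<or> b \<in> colon I f)"
      then have nab: "a \<notin> colon I f" "b \<notin> colon I f" by auto
      then have "a * f \<notin> I" by (simp add: colon_def)
      moreover have "colon I f \<subseteq> colon I (a * f)"
      proof
        fix x assume "x \<in> colon I f"
        then have "a * (x * f) \<in> I" using idl.subspace_scale[OF I] by (simp add: colon_def)
        then show "x \<in> colon I (a * f)" by (simp add: colon_def mult.left_commute)
      qed
      moreover have "b \<in> colon I (a * f)" using ab by (simp add: colon_def ac_simps)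
      ultimately show False using max[of "a * f"] nab(2) by blast
    qed
  qed (rule subspace_colon[OF I])
  then show ?thesis using f(2) J(2) by auto
qed

section \<open>Chains of primes and the growth of the affine Hilbert function\<close>

text \<open>Multiplication by \<open>f\<close> is injective on S/P and its image vanishes in S/Q. So
  the part of S/P of degree at most \<open>d\<close> embeds into the kernel of S/P -> S/Q in degrees
  at most \<open>d + a\<close>.\<close>

lemma HFa_prime_step:
  assumes P: "prm P" and Q: "idl.subspace Q" "P \<subseteq> Q" and f: "f \<in> Q" "f \<notin> P" "f \<in> forms_upto a"
  shows "HFa Q (d + a) + HFa P d \<le> HFa P (d + a)"
proof -
  note Ps = prmD(1)[OF P]
  define K where "K = {f * v + w |v w. v \<in> forms_upto d \<and> w \<in> P \<inter> forms_upto (d + a)}"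
  have le: "forms_upto d \<subseteq> forms_upto (d + a)" by (rule upto_mono) simp
  have mul: "f * v \<in> forms_upto (d + a)" if "v \<in> forms_upto d" for v
    using upto_mult[OF f(3) that] by (simp add: add.commute)
  then have K1: "K \<subseteq> forms_upto (d + a)"
    unfolding K_def by (auto intro: vs.subspace_add[OF vs_subspace_upto])
  have K2: "K \<subseteq> Q"
  proof
    fix x assume "x \<in> K"
    then obtain v w where "x = v * f + w" "w \<in> Q" using Q(2) by (auto simp: K_def mult.commute)
    then show "x \<in> Q" using f(1) idl.subspace_add[OF Q(1) idl.subspace_scale[OF Q(1)]] by blast
  qed
  have "HFa P (d + a) = HFa K (d + a) + HFa (colon P f) d"
    by (rule cod_exact[of _ "d + a"])
      (use le Ps mul in \<open>simp_all only: Int_absorb2[OF K1], simp_all add: K_def\<close>)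
  moreover have "HFa Q (d + a) \<le> HFa K (d + a)" using cod_mono[OF order_refl K2] .
  ultimately show ?thesis using colon_prm[OF P f(2)] by simp
qed

lemma HFa_pos:
  assumes "idl.subspace J" "J \<noteq> UNIV"
  shows "1 \<le> HFa J d"
proof -
  have "1 \<in> forms_upto d"
    using one_in_forms forms_subset_upto[of 0] upto_mono[of 0 d] by auto
  moreover have "1 \<notin> J" using proper_iff assms by blast
  ultimately have "J \<inter> forms_upto d \<noteq> UNIV \<inter> forms_upto d" by blast
  then have "HFa J d \<noteq> 0"
    using cod_eq_imp[OF order_refl subset_UNIV, of d J] assms(1) by auto
  moreover have "0 \<le> HFa J d" using cod_nonneg[OF order_refl] .
  ultimately show ?thesis by linarith
qed

lemma HFa_mono_degree:
  assumes J: "idl.subspace J" and le: "d \<le> d'"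
  shows "HFa J d \<le> HFa J d'"
proof -
  \<comment> \<open>With multiplier 1, \<open>cod_exact\<close> compares the two levels of the
    filtration.\<close>
  define K where "K = {1 * v + w |v w. v \<in> forms_upto d \<and> w \<in> J \<inter> forms_upto d'}"
  have sub: "forms_upto d \<subseteq> forms_upto d'" by (rule upto_mono[OF le])
  then have K1: "K \<subseteq> forms_upto d'"
    unfolding K_def by (auto intro: vs.subspace_add[OF vs_subspace_upto])
  have "HFa J d' = HFa K d' + HFa (colon J 1) d"
    by (rule cod_exact[of _ d'])
      (use sub J in \<open>auto simp only: Int_absorb2[OF K1], auto simp: K_def\<close>)
  moreover have "0 \<le> HFa K d'" using cod_nonneg[OF order_refl] .
  moreover have "colon J 1 = J" by (simp add: colon_def)
  ultimately show ?thesis by simp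
qed

text \<open>Binomials measure growth because a link of the chain acts on them by Pascal's rule: the
  increments of the function of the smaller prime dominate the function of the larger one, so the
  order rises by one. Degrees are rescaled by a factor since the elements separating the primes have
  unknown degrees.\<close>

lemma HFa_chain_growth:
  assumes "\<forall>i\<le>n. prm (C i)" "\<forall>i<n. C i \<subset> C (Suc i)"
    and "\<And>m. int (m choose k) \<le> HFa (C n) (a * m)"
  shows "\<exists>a. \<forall>m. int (m choose (n + k)) \<le> HFa (C 0) (a * m)"
  using assms
proof (induction n arbitrary: C)
  case (Suc n)
  have "\<exists>a. \<forall>m. int (m choose (n + k)) \<le> HFa (C (Suc 0)) (a * m)"
    using Suc.prems by (intro Suc.IH[of "\<lambda>i. C (Suc i)"]) auto
  then obtain a where a: "\<And>m. int (m choose (n + k)) \<le> HFa (C (Suc 0)) (a * m)" by blast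
  have P: "prm (C 0)" and Q: "prm (C (Suc 0))" and lt: "C 0 \<subset> C (Suc 0)"
    using Suc.prems by auto
  then obtain f where f: "f \<in> C (Suc 0)" "f \<notin> C 0" by blast
  obtain b where b: "f \<in> forms_upto b" using ex_upto by blast
  \<comment> \<open>One step length that dominates both the scale of the larger prime and the degree
    of \<open>f\<close>.\<close>
  define c where "c = a + b"
  have fc: "f \<in> forms_upto c" using b upto_mono[of b c] by (auto simp: c_def)
  have "int (m choose (Suc n + k)) \<le> HFa (C 0) (c * m)" for m
  proof (induction m)
    case 0
    then show ?case using cod_nonneg[OF order_refl, of _ "C 0"] by simp
  next
    case (Suc m)
    have "HFa (C (Suc 0)) (c * m + c) + HFa (C 0) (c * m) \<le> HFa (C 0) (c * m + c)"
      using HFa_prime_step[OF P prmD(1)[OF Q] _ f fc] lt by blast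
    moreover have "int (Suc m choose (n + k)) \<le> HFa (C (Suc 0)) (c * m + c)"
      using order_trans[OF a HFa_mono_degree[OF prmD(1)[OF Q]], of "Suc m" "c * m + c"]
      by (simp add: c_def algebra_simps)
    moreover have "int (m choose (n + k)) \<le> int (Suc m choose (n + k))"
      by (cases "n + k") simp_all
    moreover have "int (Suc m choose (Suc n + k)) = int (m choose (n + k)) +
      int (m choose (Suc n + k))"
      by simp
    ultimately show ?case using Suc.IH by (simp add: algebra_simps)
  qed
  then show ?case by blast
next
  case 0
  then show ?case by (intro exI[of _ a]) simp
qed

text \<open>The left side grows like m^q and the right side at most like m^k.\<close>

lemma binomial_growth_bound:
  assumes "\<And>m. int (m choose q) \<le> int ((a * m + k) choose k)"
  shows "q \<le> k"
proof (rule ccontr)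
  assume "\<not> q \<le> k"
  then obtain r where q: "q = Suc (k + r)" using less_imp_Suc_add not_le by metis
  \<comment> \<open>\<open>c\<close> collects the constants of the bounds (m/q)^q from below and ((a
    + k + 1) m)^k from above. They give m^(q-k) \<le> c, which fails for the \<open>m\<close> chosen
    next.\<close>
  define c where "c = (a + k + 1) ^ k * q ^ q"
  define m where "m = q + c + 1"
  have "(a * m + k) choose k \<le> (a * m + k) ^ k" by (rule binomial_le_pow) simp
  also have "\<dots> \<le> ((a + k + 1) * m) ^ k"
    by (intro power_mono) (auto simp: m_def algebra_simps)
  finally have 1: "(a * m + k) choose k \<le> (a + k + 1) ^ k * m ^ k" unfolding power_mult_distrib .
  have "(real m / real q) ^ q \<le> real (m choose q)"
    by (rule binomial_ge_n_over_k_pow_k) (simp add: m_def)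
  moreover have "0 < real q ^ q" using q by simp
  ultimately have "real m ^ q \<le> real (m choose q) * real q ^ q"
    by (simp only: power_divide pos_divide_le_eq)
  then have "real (m ^ q) \<le> real ((m choose q) * q ^ q)" by simp
  then have "m ^ q \<le> (m choose q) * q ^ q" by (simp only: of_nat_le_iff)
  also have "\<dots> \<le> (a + k + 1) ^ k * m ^ k * q ^ q"
    using order_trans[OF assms[of m, unfolded of_nat_le_iff] 1] by (rule mult_le_mono1)
  finally have "m ^ k * m ^ Suc r \<le> m ^ k * c" by (simp add: q c_def power_add algebra_simps)
  then have "m ^ Suc r \<le> c" by (simp add: m_def)
  moreover have "m \<le> m ^ Suc r" by (rule self_le_power) (simp_all add: m_def)
  ultimately show False by (simp add: m_def)
qed

declare One_nat_def [simp del] \<comment> \<open>keeps \<open>forms 1\<close> from becoming \<open>forms (Suc 0)\<close>\<close>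

section \<open>Ideals generated by linear forms\<close>

definition indet :: "'n::finite \<Rightarrow> ('n, 'k::field) mpoly" where
  "indet i = single (single i 1) 1"

lemma var_power: "indet i ^ k = single (single i k) 1"
  by (induction k) (simp_all add: indet_def mult_single plus_1_eq_Suc flip: single_add)

lemma prod_var: "finite A \<Longrightarrow>
    (\<Prod>i\<in>A. indet i ^ k i) = single (\<Sum>i\<in>A. single i (k i)) 1"
  by (induction A rule: finite_induct) (simp_all add: var_power mult_single)

lemma single_eq_prod_var: "single m 1 = (\<Prod>i\<in>UNIV. indet i ^ lookup m i)"
proof -
  have "m = (\<Sum>i\<in>UNIV. single i (lookup m i))"
    by (rule poly_mapping_eqI) (simp add: lookup_sum lookup_single when_def)
  then show ?thesis by (simp add: prod_var)
qed

lemma mdeg_single [simp]: "mdeg (single i k) = k"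
  by (simp add: mdeg_def lookup_single when_def)

lemma var_in_forms [simp]: "indet i \<in> forms 1"
  by (auto simp: forms_iff indet_def lookup_single when_def split: if_splits)

lemma mdeg_1_iff: "mdeg m = 1 \<longleftrightarrow> (\<exists>i. m = single i 1)"
proof
  assume m: "mdeg m = 1"
  then obtain i where i: "lookup m i \<noteq> 0" unfolding mdeg_def by (metis sum.neutral zero_neq_one)
  have "(\<Sum>j\<in>UNIV. lookup m j) = lookup m i + (\<Sum>j\<in>UNIV - {i}. lookup m j)"
    by (rule sum.remove) auto
  with m i have "lookup m i = 1" "(\<Sum>j\<in>UNIV - {i}. lookup m j) = 0"
    unfolding mdeg_def by linarith+
  then have "m = single i 1"
    by (intro poly_mapping_eqI) (auto simp: lookup_single when_def)
  then show "\<exists>i. m = single i 1" ..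
qed auto

section \<open>Endomorphisms of the polynomial ring by substitution\<close>

definition psubst :: "('n::finite \<Rightarrow> ('n, 'k::field) mpoly) \<Rightarrow> ('n, 'k) mpoly \<Rightarrow> ('n, 'k) mpoly" where
  "psubst \<sigma> f = (\<Sum>m\<in>keys f.
    smul (lookup f m) (\<Prod>i\<in>UNIV. \<sigma> i ^ lookup m i))"

lemma psubst_superset:
  assumes "finite A" "keys f \<subseteq> A"
  shows "psubst \<sigma> f = (\<Sum>m\<in>A. smul (lookup f m) (\<Prod>i\<in>UNIV. \<sigma> i ^ lookup m i))"
  unfolding psubst_def
  by (rule sum.mono_neutral_left) (use assms in \<open>auto simp: in_keys_iff\<close>)

lemma psubst_add: "psubst \<sigma> (f + g) = psubst \<sigma> f + psubst \<sigma> g"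
proof -
  let ?A = "keys f \<union> keys g"
  have "psubst \<sigma> h = (\<Sum>m\<in>?A. smul (lookup h m) (\<Prod>i\<in>UNIV. \<sigma> i ^ lookup m i))"
    if "h \<in> {f, g, f + g}" for h
    using that keys_add[of f g] by (intro psubst_superset) auto
  then show ?thesis by (simp add: lookup_add vs.scale_left_distrib sum.distrib)
qed

lemma psubst_0 [simp]: "psubst \<sigma> 0 = 0"
  by (simp add: psubst_def)

lemma psubst_sum: "psubst \<sigma> (sum f A) = (\<Sum>x\<in>A. psubst \<sigma> (f x))"
  by (induction A rule: infinite_finite_induct) (simp_all add: psubst_add)

lemma psubst_single:
  "psubst \<sigma> (single m c) = smul c (\<Prod>i\<in>UNIV. \<sigma> i ^ lookup m i)"
  by (subst psubst_superset[of "{m}"]) (auto split: if_splits)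

lemma smul_mult_smul: "smul a f * smul b g = smul (a * b) (f * g)"
proof -
  have "smul a f * smul b g = (single 0 a * single 0 b) * (f * g)"
    unfolding smul_def by (simp only: ac_simps)
  then show ?thesis by (simp add: mult_single smul_def)
qed

lemma psubst_mult: "psubst \<sigma> (f * g) = psubst \<sigma> f * psubst \<sigma> g"
proof -
  have "psubst \<sigma> (f * g) = (\<Sum>m\<in>keys f. \<Sum>m'\<in>keys g.
      smul (lookup f m) (\<Prod>i\<in>UNIV. \<sigma> i ^ lookup m i) *
      smul (lookup g m') (\<Prod>i\<in>UNIV. \<sigma> i ^ lookup m' i))"
    by (subst mult_as_sum)
      (simp add: psubst_sum psubst_single smul_mult_smul lookup_add power_add prod.distrib)
  then show ?thesis by (simp add: psubst_def sum_product)
qed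

lemma psubst_1: "psubst \<sigma> 1 = 1"
  using psubst_single[of \<sigma> 0 1] by simp

lemma psubst_var: "psubst \<sigma> (indet i) = \<sigma> i"
proof -
  have "(\<Prod>j\<in>UNIV. \<sigma> j ^ lookup (single i (1::nat)) j) = (\<Prod>j\<in>UNIV. if j = i then \<sigma> i else 1)"
    by (rule prod.cong) (auto simp: lookup_single when_def)
  then show ?thesis by (simp add: indet_def psubst_single)
qed

lemma ideal_prod_diff:
  assumes J: "idl.subspace J" and "\<And>i. i \<in> A \<Longrightarrow> a i - b i \<in> J"
  shows "prod a A - prod b A \<in> J"
  using assms(2)
proof (induction A rule: infinite_finite_induct)
  case (insert x A)
  have "prod a (insert x A) - prod b (insert x A) = prod a A * (a x - b x) + b x *
    (prod a A - prod b A)"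
    using insert by (simp add: algebra_simps)
  then show ?case
    using insert idl.subspace_add[OF J idl.subspace_scale[OF J] idl.subspace_scale[OF J]] by simp
qed (use J in \<open>simp_all add: idl.subspace_0\<close>)

lemma ideal_power_diff:
  assumes "idl.subspace J" "a - b \<in> J"
  shows "a ^ k - b ^ k \<in> J"
  using ideal_prod_diff[of J "{..<k}" "\<lambda>_. a" "\<lambda>_. b"] assms by simp

lemma psubst_diff_in:
  assumes J: "idl.subspace J" and \<sigma>: "\<And>i. \<sigma> i - indet i \<in> J"
  shows "psubst \<sigma> f - f \<in> J"
proof -
  define g where "g = (\<Sum>m\<in>keys f.
    smul (lookup f m) (\<Prod>i\<in>UNIV. indet i ^ lookup m i))"
  have fg: "f = g"
    using poly_sum_single[of f] by (simp add: g_def smul_single flip: single_eq_prod_var)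
  have "psubst \<sigma> f - g = (\<Sum>m\<in>keys f. smul (lookup f m)
      ((\<Prod>i\<in>UNIV. \<sigma> i ^ lookup m i) - (\<Prod>i\<in>UNIV. indet i ^ lookup m i)))"
    by (simp add: psubst_def g_def sum_subtractf vs.scale_right_diff_distrib)
  also have "\<dots> \<in> J"
    using \<sigma> by (intro idl.subspace_sum[OF J] vs.subspace_scale vs_subspace_ideal J
        ideal_prod_diff ideal_power_diff)
  finally show ?thesis using fg by simp
qed

lemma linear_form_expand:
  fixes f :: "('n::finite, 'k::field) mpoly"
  assumes "f \<in> forms 1"
  shows "f = (\<Sum>i\<in>UNIV. smul (lookup f (single i 1)) (indet i))"
proof (rule poly_mapping_eqI)
  fix m
  have *: "single i (1::nat) = single j 1 \<longleftrightarrow> i = j" for i j :: 'n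
    by (metis lookup_single_eq lookup_single_not_eq zero_neq_one)
  show "lookup f m = lookup
      (\<Sum>i\<in>UNIV. smul (lookup f (single i 1)) (indet i)) m"
  proof (cases "mdeg m = 1")
    case True
    then obtain j where "m = single j 1" using mdeg_1_iff by blast
    then show ?thesis by (simp add: lookup_sum indet_def lookup_single when_def *
      if_distrib[of "\<lambda>x. _ * x"] cong: if_cong)
  next
    case False
    then have "lookup f m = 0" using assms by (auto simp: forms_iff)
    moreover have "lookup (indet i :: ('n, 'k) mpoly) m = 0" for i
      using False by (auto simp: indet_def lookup_single when_def)
    ultimately show ?thesis by (simp add: lookup_sum)
  qed
qed

lemma forms_1_span_var:
  "(forms 1 :: ('n::finite, 'k::field) mpoly set) = vs.span (Set.range indet)"
proof
  show "(forms 1 :: ('n, 'k) mpoly set) \<subseteq> vs.span (Set.range indet)"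
  proof
    fix f :: "('n, 'k) mpoly" assume f: "f \<in> forms 1"
    show "f \<in> vs.span (Set.range indet)"
      by (subst linear_form_expand[OF f], rule vs.span_sum, rule vs.span_scale,
        rule vs.span_base) simp
  qed
  show "vs.span (Set.range indet) \<subseteq> (forms 1 :: ('n, 'k) mpoly set)"
    by (rule vs.span_minimal) auto
qed

lemma inj_var: "inj indet"
  unfolding inj_def indet_def
  by (metis lookup_single_eq lookup_single_not_eq zero_neq_one)

lemma independent_var: "vs.independent (Set.range (indet :: 'n::finite \<Rightarrow> ('n, 'k::field) mpoly))"
proof (rule vs.independent_if_scalars_zero)
  fix f :: "('n, 'k) mpoly \<Rightarrow> 'k" and x :: "('n, 'k) mpoly"
  assume 0: "(\<Sum>x\<in>Set.range indet. smul (f x) x) = 0" and "x \<in> Set.range indet"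
  then obtain i where x: "x = indet i" by blast
  have *: "single i (1::nat) = single j 1 \<longleftrightarrow> i = j" for i j :: 'n
    by (metis lookup_single_eq lookup_single_not_eq zero_neq_one)
  have "0 = lookup (\<Sum>j\<in>UNIV. smul (f (indet j)) (indet j)) (single i 1)"
    using 0 by (simp add: sum.reindex[OF inj_var] o_def)
  also have "\<dots> = f (indet i)"
    by (simp add: lookup_sum indet_def lookup_single when_def * if_distrib[of "\<lambda>x. _ *
      x"] cong: if_cong)
  finally show "f x = 0" using x by simp
qed simp

lemma dim_forms_1: "vs.dim (forms 1 :: ('n::finite, 'k::field) mpoly set) = CARD('n)"
  unfolding forms_1_span_var
  by (simp add: vs.dim_eq_card_independent[OF independent_var] card_image inj_var)

text \<open>A linear projection of the space of linear forms with kernel \<open>span L\<close> extends to an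
  endomorphism of the polynomial ring with kernel \<open>(L)\<close>.\<close>

lemma ex_linear_projection:
  fixes L :: "('n::finite, 'k::field) mpoly set"
  assumes L: "L \<subseteq> forms 1"
  shows "\<exists>p. Vector_Spaces.linear smul smul p \<and> (\<forall>l\<in>vs.span L. p l = 0) \<and>
    (\<forall>v\<in>forms 1. p v - v \<in> vs.span L)"
proof -
  interpret vsp: Vector_Spaces.vector_space_pair
    "smul :: 'k \<Rightarrow> ('n, 'k) mpoly \<Rightarrow> ('n, 'k) mpoly" "smul :: 'k \<Rightarrow> ('n, 'k) mpoly \<Rightarrow> ('n, 'k) mpoly"
    by unfold_locales
  obtain B0 where B0: "B0 \<subseteq> L" "vs.independent B0" "L \<subseteq> vs.span B0"
    using vs.basis_exists[of L] by metis
  have "B0 \<subseteq> forms 1" using B0 L by blast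
  then obtain B where B: "B0 \<subseteq> B" "B \<subseteq> forms 1" "vs.independent B" "forms 1 \<subseteq> vs.span B"
    using vs.maximal_independent_subset_extend[OF _ B0(2)] by metis
  obtain p where p: "Vector_Spaces.linear smul smul p" "\<forall>x\<in>B. p x = (if x \<in> B0 then 0 else x)"
    using vsp.linear_independent_extend[OF B(3), of "\<lambda>x. if x \<in> B0 then 0 else x"] by blast
  interpret p: Vector_Spaces.linear smul smul p by (rule p)
  have spL: "vs.span L = vs.span B0"
    using B0 vs.span_mono[OF B0(1)] vs.span_minimal[OF B0(3)] by auto
  have "vs.span B0 \<subseteq> {l. p l = 0}"
    using p(2) B(1) by (intro vs.span_minimal p.subspace_kernel) auto
  moreover have "vs.subspace {v. p v - v \<in> vs.span L}"
  proof (rule vs.subspaceI; unfold mem_Collect_eq)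
    show "p 0 - 0 \<in> vs.span L" by (simp add: vs.span_zero)
    fix x y assume xy: "p x - x \<in> vs.span L" "p y - y \<in> vs.span L"
    have "p (x + y) - (x + y) = (p x - x) + (p y - y)" by (simp add: p.add)
    then show "p (x + y) - (x + y) \<in> vs.span L" using vs.span_add[OF xy] by (simp only:)
  next
    fix c x assume x: "p x - x \<in> vs.span L"
    have "p (smul c x) - smul c x = smul c (p x - x)"
      by (simp add: p.scale vs.scale_right_diff_distrib)
    then show "p (smul c x) - smul c x \<in> vs.span L" using vs.span_scale[OF x] by (simp only:)
  qed
  then have "vs.span B \<subseteq> {v. p v - v \<in> vs.span L}"
  proof (intro vs.span_minimal subsetI)
    fix x assume "x \<in> B"
    moreover have "- x \<in> vs.span L" if "x \<in> B0"
      using that B0(1) by (intro vs.span_neg vs.span_base) auto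
    ultimately show "x \<in> {v. p v - v \<in> vs.span L}" using p(2) by (auto simp: vs.span_zero)
  qed
  ultimately show ?thesis using p(1) spL B(4) by blast
qed

lemma vs_span_subset_idl_span: "vs.span L \<subseteq> idl.span L"
  by (rule vs.span_minimal) (auto intro: idl.span_base)

lemma idl_span_vs_span: "idl.span (vs.span L) = idl.span L"
  by (rule antisym[OF idl.span_minimal[OF vs_span_subset_idl_span idl.subspace_span]
        idl.span_mono[OF vs.span_superset]])

text \<open>The ideal is the kernel of an endomorphism of a domain, hence prime. On linear forms
  this endomorphism is the projection, whose kernel is the vector space spanned by
  \<open>L\<close>.\<close>

lemma linear_ideal_facts:
  fixes L :: "('n::finite, 'k::field) mpoly set"
  assumes L: "L \<subseteq> forms 1"
  shows linear_ideal_prime: "prm (idl.span L)"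
    and linear_ideal_forms_1: "idl.span L \<inter> forms 1 = vs.span L"
proof -
  obtain p where p: "Vector_Spaces.linear smul smul p" "\<And>l. l \<in> vs.span L \<Longrightarrow> p l = 0"
      "\<And>v. v \<in> forms 1 \<Longrightarrow> p v - v \<in> vs.span L"
    using ex_linear_projection[OF L] by blast
  interpret p: Vector_Spaces.linear smul smul p by (rule p)
  define \<phi> where "\<phi> = psubst (\<lambda>i. p (indet i))"
  have lin: "\<phi> l = p l" if "l \<in> forms 1" for l
  proof -
    let ?c = "\<lambda>i. lookup l (single i 1)"
    have l: "l = (\<Sum>i\<in>UNIV. smul (?c i) (indet i))"
      using that by (rule linear_form_expand)
    have s: "\<phi> (smul c f) = smul c (\<phi> f)" for c f
      using psubst_mult[of "\<lambda>i. p (indet i)" "single 0 c" f]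
        psubst_single[of "\<lambda>i. p (indet i)" 0 c]
      by (simp add: \<phi>_def smul_def)
    have "\<phi> (\<Sum>i\<in>UNIV. smul (?c i) (indet i)) = (\<Sum>i\<in>UNIV. smul (?c i) (p (indet i)))"
      by (simp add: \<phi>_def psubst_sum psubst_var s[unfolded \<phi>_def])
    also have "\<dots> = p (\<Sum>i\<in>UNIV. smul (?c i) (indet i))"
      by (simp add: p.sum p.scale)
    finally show ?thesis using l by simp
  qed
  have diff: "\<phi> f - f \<in> idl.span L" for f
    unfolding \<phi>_def using p(3)[OF var_in_forms] vs_span_subset_idl_span
    by (intro psubst_diff_in) auto
  have "idl.subspace {f. \<phi> f = 0}"
    by (intro idl.subspaceI) (auto simp: \<phi>_def psubst_add psubst_mult)
  then have "idl.span L \<subseteq> {f. \<phi> f = 0}"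
  proof (intro idl.span_minimal subsetI)
    fix l assume "l \<in> L"
    then show "l \<in> {f. \<phi> f = 0}" using lin[of l] p(2)[OF vs.span_base] L by auto
  qed
  \<comment> \<open>If \<open>\<phi> f = 0\<close>, then \<open>f\<close> is the negative of
    \<open>\<phi> f - f\<close>, which lies in the ideal.\<close>
  then have ker: "f \<in> idl.span L \<longleftrightarrow> \<phi> f = 0" for f
    using diff[of f] idl.span_neg[of "\<phi> f - f" L] by auto
  show "prm (idl.span L)"
    unfolding prm_def
  proof (intro conjI allI impI)
    show "idl.span L \<noteq> UNIV" using ker[of 1] by (auto simp: \<phi>_def psubst_1)
    fix a b assume "a * b \<in> idl.span L"
    then show "a \<in> idl.span L \<or> b \<in> idl.span L"
      unfolding ker by (simp add: \<phi>_def psubst_mult mpoly_no_zero_divisors)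
  qed simp
  show "idl.span L \<inter> forms 1 = vs.span L"
  proof
    show "idl.span L \<inter> forms 1 \<subseteq> vs.span L"
    proof
      fix l assume "l \<in> idl.span L \<inter> forms 1"
      then have "p l = 0" "p l - l \<in> vs.span L" using ker lin p(3) by auto
      then show "l \<in> vs.span L" using vs.span_neg[of "p l - l" L] by simp
    qed
    show "vs.span L \<subseteq> idl.span L \<inter> forms 1"
      using vs_span_subset_idl_span vs.span_minimal[OF L] by auto
  qed
qed

section \<open>Hilbert series of ideals generated by linear forms\<close>

lemma homog_linear: "L \<subseteq> forms 1 \<Longrightarrow> homog (idl.span L)"
  by (rule homog_span_forms) blast

text \<open>A further independent form lies outside the prime \<open>idl.span B\<close>, so it is a
  nonzerodivisor and contributes the factor 1 - X. The series of the zero ideal stays symbolic here,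
  since \<open>HS_zero\<close> is deduced from this lemma.\<close>

lemma HS_independent:
  fixes B :: "('n::finite, 'k::field) mpoly set"
  assumes "finite B" "B \<subseteq> forms 1" "vs.independent B"
  shows "HS (idl.span B) = (1 - fps_X) ^ card B * HS ({0} :: ('n, 'k) mpoly set)"
  using assms
proof (induction B)
  case (insert b B)
  have ind: "vs.independent B" using insert(5) vs.independent_mono by blast
  have L: "B \<subseteq> forms 1" and b: "b \<in> forms 1" using insert(4) by auto
  have "b \<notin> vs.span B"
    using insert(2,5) by (metis Diff_insert_absorb insertI1 vs.dependent_def)
  then have "b \<notin> idl.span B" using linear_ideal_forms_1[OF L] b by blast
  then have "colon (idl.span B) b = idl.span B" by (rule colon_prm[OF linear_ideal_prime[OF L]])
  then have "HS (idl.span B) = HS (idl.span (insert b B)) + fps_X * HS (idl.span B)"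
    using HS_exact[OF homog_linear[OF L] b] by (simp add: adj_span)
  then have "HS (idl.span (insert b B)) = (1 - fps_X) * HS (idl.span B)"
    by (simp add: algebra_simps)
  then show ?case using insert.IH[OF L ind] insert(1,2) by (simp add: mult.assoc)
qed simp

lemma forms_pos_subset_irrelevant:
  assumes "d \<ge> 1"
  shows "forms d \<subseteq> idl.span (forms 1)"
proof
  fix f :: "('a, 'b) mpoly" assume f: "f \<in> forms d"
  have "single m c \<in> idl.span (forms 1)" if "mdeg m = d" for m :: "'a \<Rightarrow>\<^sub>0 nat" and c :: 'b
  proof -
    have "m \<noteq> 0" using that assms by auto
    then obtain i where i: "lookup m i \<noteq> 0"
      by (metis poly_mapping_eqI lookup_zero)
    then have "m = (m - single i 1) + single i 1"
      by (intro poly_mapping_eqI) (auto simp: lookup_add lookup_minus lookup_single when_def)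
    then have "single m c = single (m - single i 1) c * indet i"
      by (simp add: mult_single indet_def)
    then show ?thesis using idl.span_scale[OF idl.span_base[OF var_in_forms]] by simp
  qed
  then show "f \<in> idl.span (forms 1)"
    by (subst poly_sum_single) (use f in \<open>auto simp: forms_def mdeg_def intro!: idl.span_sum\<close>)
qed

lemma HS_irrelevant: "HS (idl.span (forms 1) :: ('n::finite, 'k::field) mpoly set) = 1"
proof (rule fps_ext)
  fix d
  let ?M = "idl.span (forms 1) :: ('n, 'k) mpoly set"
  have "idl.subspace {f :: ('n, 'k) mpoly. hcomp 0 f = 0}"
    by (intro idl.subspaceI) (auto simp: hcomp_add hcomp_mult)
  then have "?M \<subseteq> {f. hcomp 0 f = 0}"
    by (intro idl.span_minimal) (auto simp: hcomp_form)
  then have "f = 0" if "f \<in> ?M \<inter> forms 0" for f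
    using that hcomp_form[of f 0 0] by auto
  then have M0: "?M \<inter> forms 0 = {0}"
    using vs.subspace_0[OF vs_subspace_forms[of 0]] idl.span_zero[of "forms 1"] by blast
  have "(forms 0 :: ('n, 'k) mpoly set) = vs.span {1}"
  proof
    show "forms 0 \<subseteq> vs.span {1 :: ('n, 'k) mpoly}"
      using forms_0_eq vs.span_scale[OF vs.span_base] by (metis singletonI subsetI)
    show "vs.span {1 :: ('n, 'k) mpoly} \<subseteq> forms 0"
      by (rule vs.span_minimal) (auto simp: one_in_forms)
  qed
  then have "vs.dim (forms 0 :: ('n, 'k) mpoly set) = 1"
    by (simp add: vs.dim_eq_card_independent)
  moreover have "vs.dim {0 :: ('n, 'k) mpoly} = 0"
    by (metis vs.dim_span vs.span_empty vs.dim_eq_card_independent vs.independent_empty card.empty)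
  ultimately have "HF ?M 0 = 1" by (simp add: cod_def M0)
  moreover have "HF ?M d = 0" if "d \<noteq> 0"
  proof -
    have "?M \<inter> forms d = forms d" using forms_pos_subset_irrelevant[of d] that by auto
    then show ?thesis by (simp add: cod_def)
  qed
  ultimately show "fps_nth (HS ?M) d = fps_nth 1 d" by simp
qed

text \<open>The variables generate the irrelevant ideal, whose series is 1, so
  \<open>HS_independent\<close> can be solved for the series of the ring. No monomials are
  counted.\<close>

lemma HS_zero: "HS ({0} :: ('n::finite, 'k::field) mpoly set) = gs ^ CARD('n)"
proof -
  let ?V = "Set.range (indet :: 'n \<Rightarrow> ('n, 'k) mpoly)"
  have V: "?V \<subseteq> forms 1" by auto
  have c: "card ?V = CARD('n)" by (rule card_image[OF inj_var])
  have "idl.span ?V = idl.span (forms 1)"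
    by (metis forms_1_span_var idl_span_vs_span)
  then have "(1 - fps_X) ^ card ?V * HS ({0} :: ('n, 'k) mpoly set) = 1"
    using HS_independent[OF _ V independent_var] HS_irrelevant by (metis finite finite_imageI)
  then have "gs ^ card ?V * (1 - fps_X) ^ card ?V * HS ({0} :: ('n, 'k) mpoly set) = gs ^ card ?V"
    by (simp add: mult.assoc)
  then show ?thesis by (simp add: gs_power_inverse c)
qed

lemma linear_forms_basis:
  assumes "L \<subseteq> forms 1"
  obtains B where "B \<subseteq> L" "finite B" "vs.independent B" "vs.span B = vs.span L"
    "idl.span B = idl.span L" "card B = vs.dim L"
proof -
  have "L \<subseteq> vs.span (monomials 1)" using upto_fd[of 1 1] assms forms_subset_upto by blast
  from vs.fd_basis[OF finite_monomials this] obtain B where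
    B: "B \<subseteq> L" "L \<subseteq> vs.span B" "vs.independent B" "finite B" "card B = vs.dim L" by metis
  have "vs.span B = vs.span L"
    using vs.span_mono[OF B(1)] vs.span_minimal[OF B(2)] by auto
  then show ?thesis using that[OF B(1,4,3) _ _ B(5)] by (metis idl_span_vs_span)
qed

lemma dim_linear_le:
  fixes L :: "('n::finite, 'k::field) mpoly set"
  assumes "L \<subseteq> forms 1"
  shows "vs.dim L \<le> CARD('n)"
  unfolding dim_forms_1[where 'k = 'k, symmetric]
  by (rule vs.dim_mono_fd[OF finite_monomials upto_fd[OF order_refl forms_subset_upto] assms])

lemma HS_linear:
  fixes L :: "('n::finite, 'k::field) mpoly set"
  assumes "L \<subseteq> forms 1"
  shows "HS (idl.span L) = gs ^ (CARD('n) - vs.dim L)"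
proof -
  obtain B where B: "B \<subseteq> L" "finite B" "vs.independent B" "idl.span B = idl.span L"
    "card B = vs.dim L"
    using linear_forms_basis[OF assms] by metis
  have "HS (idl.span L) = (1 - fps_X) ^ vs.dim L * gs ^ CARD('n)"
    using HS_independent[OF B(2) _ B(3)] B assms HS_zero by (metis subset_trans)
  also have "gs ^ CARD('n) = gs ^ vs.dim L * gs ^ (CARD('n) - vs.dim L)"
    using dim_linear_le[OF assms] by (simp flip: power_add)
  finally show ?thesis by (simp add: gs_power_inverse flip: mult.assoc)
qed

lemma HFa_nth: "homog J \<Longrightarrow> HFa J d = fps_nth (HS J * gs) d"
  by (simp add: HFa_sum mult_gs_nth)

lemma HFa_linear:
  fixes L :: "('n::finite, 'k::field) mpoly set"
  assumes "L \<subseteq> forms 1" and "k = CARD('n) - vs.dim L"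
  shows "HFa (idl.span L) d = int ((d + k) choose k)"
  by (metis HFa_nth[OF homog_linear[OF assms(1)]] HS_linear[OF assms(1)] assms(2) gs_power_nth
    power_Suc2)

section \<open>Chains of primes above and below linear primes\<close>

definition pchain :: "nat \<Rightarrow> (nat \<Rightarrow> ('n::finite, 'k::field) mpoly set) \<Rightarrow> bool" where
  "pchain n C \<longleftrightarrow> (\<forall>i\<le>n. prm (C i)) \<and> (\<forall>i<n. C i \<subset> C (Suc i))"

text \<open>\<open>B0\<close> is the start of the chain: empty for chains that end in a linear
  prime, a basis of its linear forms for chains that start there.\<close>

lemma linear_chain:
  assumes "B0 \<union> set bs \<subseteq> forms 1" "vs.independent (B0 \<union> set bs)" "distinct bs" "B0 \<inter> set bs = {}"
  shows "pchain (length bs) (\<lambda>i. idl.span (B0 \<union> set (take i bs)))"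
  unfolding pchain_def
proof (intro conjI allI impI)
  have sub: "B0 \<union> set (take i bs) \<subseteq> forms 1" for i
    using assms(1) set_take_subset[of i bs] by auto
  show "prm (idl.span (B0 \<union> set (take i bs)))" for i
    by (rule linear_ideal_prime[OF sub])
  fix i assume i: "i < length bs"
  let ?A = "B0 \<union> set (take i bs)"
  have "bs ! i \<notin> set (take i bs)"
    using assms(3) i by (metis distinct_take id_take_nth_drop not_distinct_conv_prefix
      take_Suc_conv_app_nth)
  moreover have "bs ! i \<notin> B0" using assms(4) i nth_mem by blast
  ultimately have "?A \<subseteq> B0 \<union> set bs - {bs ! i}" using set_take_subset[of i bs] by auto
  then have "bs ! i \<notin> vs.span ?A"
    using assms(2) i vs.span_mono[of ?A "B0 \<union> set bs - {bs ! i}"] nth_mem[OF i]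
    unfolding vs.dependent_def by blast
  moreover have "bs ! i \<in> forms 1" using assms(1) i by auto
  ultimately have "bs ! i \<notin> idl.span ?A" using linear_ideal_forms_1[OF sub] by blast
  moreover have "B0 \<union> set (take (Suc i) bs) = insert (bs ! i) ?A"
    using i by (simp add: take_Suc_conv_app_nth)
  moreover have "idl.span ?A \<subseteq> idl.span (insert (bs ! i) ?A)" by (rule idl.span_mono) auto
  ultimately show "idl.span ?A \<subset> idl.span (B0 \<union> set (take (Suc i) bs))"
    using idl.span_base[of "bs ! i" "insert (bs ! i) ?A"] by auto
qed

lemma linear_chain_below:
  assumes "L \<subseteq> forms 1"
  shows "\<exists>C. pchain (vs.dim L) C \<and> C (vs.dim L) = idl.span L"
proof -
  obtain B where B: "B \<subseteq> L" "finite B" "vs.independent B" "idl.span B = idl.span L"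
    "card B = vs.dim L"
    using linear_forms_basis[OF assms] by metis
  obtain bs where bs: "set bs = B" "distinct bs" using finite_distinct_list[OF B(2)] by blast
  then have len: "length bs = vs.dim L" using distinct_card B(5) by metis
  have "pchain (length bs) (\<lambda>i. idl.span ({} \<union> set (take i bs)))"
    using B bs assms by (intro linear_chain) auto
  then show ?thesis using B bs len by (intro exI[of _ "\<lambda>i. idl.span (set (take i bs))"]) auto
qed

lemma linear_chain_above:
  fixes L :: "('n::finite, 'k::field) mpoly set"
  assumes "L \<subseteq> forms 1"
  shows "\<exists>C. pchain (CARD('n) - vs.dim L) C \<and> C 0 = idl.span L"
proof -
  obtain B where B: "B \<subseteq> L" "finite B" "vs.independent B" "idl.span B = idl.span L"
    "card B = vs.dim L"
    using linear_forms_basis[OF assms] by metis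
  have "B \<subseteq> forms 1" using B assms by blast
  then obtain D where D: "B \<subseteq> D" "D \<subseteq> forms 1" "vs.independent D" "forms 1 \<subseteq> vs.span D"
    using vs.maximal_independent_subset_extend[OF _ B(3)] by metis
  have fin: "finite D"
    using vs.independent_finite_dim[OF finite_monomials upto_fd[OF order_refl forms_subset_upto]
      D(2,3)] .
  have "card D = CARD('n)"
    using vs.basis_card_eq_dim[OF D(2,4,3)] dim_forms_1[where 'n = 'n and 'k = 'k] by simp
  then have cd: "card (D - B) = CARD('n) - vs.dim L"
    using B D(1) by (simp add: card_Diff_subset)
  obtain bs where bs: "set bs = D - B" "distinct bs" using finite_distinct_list[of "D - B"] fin
    by blast
  then have len: "length bs = CARD('n) - vs.dim L" using distinct_card cd by metis
  have "B \<union> set bs = D" using bs D(1) by blast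
  then have "pchain (length bs) (\<lambda>i. idl.span (B \<union> set (take i bs)))"
    using D bs by (intro linear_chain) auto
  then show ?thesis using B len by (intro exI[of _ "\<lambda>i. idl.span (B \<union> set (take i bs))"]) auto
qed

text \<open>The linear prime has growth of order CARD('n) - dim L and each of the n links below it
  adds one. No ideal outgrows the zero ideal, whose order is CARD('n).\<close>

lemma chain_length_below_linear:
  fixes L :: "('n::finite, 'k::field) mpoly set"
  assumes L: "L \<subseteq> forms 1" and C: "pchain n C" "C n = idl.span L"
  shows "n \<le> vs.dim L"
proof -
  let ?s = "CARD('n)"
  let ?k = "?s - vs.dim L"
  have "int (m choose ?k) \<le> HFa (C n) (1 * m)" for m
    unfolding C(2) HFa_linear[OF L refl] by (simp add: binomial_right_mono)
  then obtain a where a: "\<And>m. int (m choose (n + ?k)) \<le> HFa (C 0) (a * m)"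
    using HFa_chain_growth[of n C ?k 1] C(1) unfolding pchain_def by blast
  have "HFa (C 0) d \<le> int ((d + ?s) choose ?s)" for d
  proof -
    have "idl.subspace (C 0)" using C(1) prmD(1) by (auto simp: pchain_def)
    then have "HFa (C 0) d \<le> HFa ({0} :: ('n, 'k) mpoly set) d"
      by (intro cod_mono[OF order_refl]) (auto simp: idl.subspace_0)
    also have "\<dots> = int ((d + ?s) choose ?s)"
    proof -
      have "homog ({0} :: ('n, 'k) mpoly set)" by (simp add: homog_def)
      then show ?thesis by (metis HFa_nth HS_zero gs_power_nth power_Suc2)
    qed
    finally show ?thesis .
  qed
  then have "n + ?k \<le> ?s" using binomial_growth_bound[of "n + ?k" a ?s] a order_trans by blast
  then show ?thesis using dim_linear_le[OF L] by linarith
qed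

text \<open>The top prime is proper and so has growth of order at least 0. The n links below it add
  n, and the bottom prime grows no faster than the linear ideal that it contains.\<close>

lemma chain_length_above_linear:
  fixes L :: "('n::finite, 'k::field) mpoly set"
  assumes L: "L \<subseteq> forms 1" and C: "pchain n C" "idl.span L \<subseteq> C 0"
  shows "n \<le> CARD('n) - vs.dim L"
proof -
  let ?k = "CARD('n) - vs.dim L"
  have "prm (C n)" using C(1) by (simp add: pchain_def)
  then have "1 \<le> HFa (C n) d" for d using HFa_pos prmD(1,2) by blast
  then have "int (m choose 0) \<le> HFa (C n) (1 * m)" for m by simp
  then obtain a where a: "\<And>m. int (m choose (n + 0)) \<le> HFa (C 0) (a * m)"
    using HFa_chain_growth[of n C 0 1] C(1) unfolding pchain_def by blast
  have b: "HFa (C 0) d \<le> int ((d + ?k) choose ?k)" for d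
    using cod_mono[OF order_refl C(2), of d] HFa_linear[OF L refl, of d] by simp
  have "int (m choose n) \<le> int ((a * m + ?k) choose ?k)" for m
    using order_trans[OF a[of m] b] by simp
  then show ?thesis by (rule binomial_growth_bound)
qed

section \<open>Rational Hilbert series and their growth\<close>

lemma fps_of_poly_1_minus_X: "fps_of_poly [:1, -1 :: int:] = 1 - fps_X"
  by (rule fps_ext) (auto simp: coeff_pCons fps_X_def split: nat.split)

lemma fps_of_poly_monom_1: "fps_of_poly (Polynomial.monom (1::int) n) = fps_X ^ n"
  by (rule fps_ext) (auto simp: fps_X_power_nth)

lemma eventually_zero_fps_of_poly:
  assumes "\<And>d. d0 \<le> d \<Longrightarrow> fps_nth f d = (0::int)"
  shows "\<exists>p. f = fps_of_poly p"
proof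
  show "f = fps_of_poly (\<Sum>i<d0. Polynomial.monom (fps_nth f i) i)"
    by (rule fps_ext) (use assms in \<open>auto simp: coeff_sum sum.delta not_less\<close>)
qed

text \<open>\<open>j\<close> stands for the index of a coefficient of the numerator. The truncated
  subtraction is exact for all large \<open>d\<close>.\<close>

lemma binomial_limit:
  "(\<lambda>d. real ((d - j + k) choose k) / real d ^ k) \<longlonglongrightarrow> 1 / fact k"
proof (induction k)
  case (Suc k)
  have 1: "(\<lambda>d. 1 + (real k + 1 - real j) / real d) \<longlonglongrightarrow> 1 + 0"
    by (intro tendsto_intros lim_const_over_n)
  have 2: "\<forall>\<^sub>F d in sequentially. 1 + (real k + 1 - real j) / real d = real (d - j +
    Suc k) / real d"
    using eventually_ge_at_top[of "j + 1"] by eventually_elim (simp add: field_simps of_nat_diff)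
  have "(\<lambda>d. real (d - j + Suc k) / real d) \<longlonglongrightarrow> 1"
    using Lim_transform_eventually[OF 1 2] by (simp only: add_0_right)
  from tendsto_mult[OF tendsto_mult[OF Suc.IH this] tendsto_const[of "1 / real (Suc k)"]]
  have "(\<lambda>d. real ((d - j + k) choose k) / real d ^ k * (real (d - j + Suc k) / real d) *
    (1 / real (Suc k)))
      \<longlonglongrightarrow> 1 / fact (Suc k)"
    by (simp add: mult.commute)
  moreover have "real ((d - j + k) choose k) / real d ^ k * (real (d - j + Suc k) / real d) *
    (1 / real (Suc k)) =
      real ((d - j + Suc k) choose Suc k) / real d ^ Suc k" for d
  proof -
    have "real (Suc (d - j + k)) * real ((d - j + k) choose k) = real (Suc (d - j +
      k) choose Suc k) * real (Suc k)"
      using Suc_times_binomial_eq[of "d - j + k" k] by (metis of_nat_mult)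
    then have "real ((d - j + Suc k) choose Suc k) = real (d - j + Suc k) * real ((d - j +
      k) choose k) / real (Suc k)"
      by (simp add: eq_divide_eq del: of_nat_Suc binomial_Suc_Suc)
    then show ?thesis by (simp add: mult_ac del: of_nat_Suc binomial_Suc_Suc)
  qed
  ultimately show ?case by (simp only:)
qed simp

lemma rational_fps_limit:
  "(\<lambda>d. real_of_int (fps_nth (fps_of_poly N * gs ^ Suc k) d) / real d ^ k)
    \<longlonglongrightarrow> real_of_int (poly N 1) / fact k"
proof -
  have "(\<lambda>d. \<Sum>j\<le>degree N. real_of_int (coeff N j) * (real ((d - j + k) choose k) / real d ^ k))
      \<longlonglongrightarrow> (\<Sum>j\<le>degree N. real_of_int (coeff N j) * (1 / fact k))"
    by (intro tendsto_sum tendsto_mult tendsto_const binomial_limit)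
  moreover have "(\<Sum>j\<le>degree N. real_of_int (coeff N j) * (1 / fact k)) =
    real_of_int (poly N 1) / fact k"
    by (simp add: poly_altdef sum_divide_distrib)
  moreover have "\<forall>\<^sub>F d in sequentially.
      (\<Sum>j\<le>degree N. real_of_int (coeff N j) * (real ((d - j + k) choose k) / real d ^ k)) =
      real_of_int (fps_nth (fps_of_poly N * gs ^ Suc k) d) / real d ^ k"
    using eventually_ge_at_top[of "degree N"]
  proof eventually_elim
    case (elim d)
    have "fps_nth (fps_of_poly N * gs ^ Suc k) d = (\<Sum>j=0..d. coeff N j * int ((d - j +
      k) choose k))"
      by (simp add: fps_mult_nth gs_power_nth del: power_Suc)
    also have "\<dots> = (\<Sum>j\<le>degree N. coeff N j * int ((d - j + k) choose k))"
      by (rule sum.mono_neutral_right) (use elim in \<open>auto simp: coeff_eq_0 not_le\<close>)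
    finally show ?case by (simp add: sum_divide_distrib)
  qed
  ultimately show ?thesis using Lim_transform_eventually by force
qed

lemma rational_fps_le:
  assumes "fle (fps_of_poly N * gs ^ k) (fps_of_poly M * gs ^ k)"
  shows "poly N 1 \<le> poly M 1"
proof -
  \<comment> \<open>The additional factor \<open>gs\<close> makes the exponent a successor, so the
    limit also covers \<open>k = 0\<close>.\<close>
  have "fle (fps_of_poly N * gs ^ Suc k) (fps_of_poly M * gs ^ Suc k)"
    using fle_mult_right[OF assms gs_nonneg] by (simp add: ac_simps)
  then have "real_of_int (fps_nth (fps_of_poly N * gs ^ Suc k) d) / real d ^ k
      \<le> real_of_int (fps_nth (fps_of_poly M * gs ^ Suc k) d) / real d ^ k" for d
    unfolding fle_def by (intro divide_right_mono) auto
  then have "real_of_int (poly N 1) / fact k \<le> real_of_int (poly M 1) / fact k"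
    by (intro LIMSEQ_le[OF rational_fps_limit rational_fps_limit]) blast
  then show ?thesis by (simp add: divide_le_cancel)
qed

text \<open>The numerator vanishes at \<open>1\<close> as long as the pole order exceeds the growth rate.\<close>

lemma reduce_pole_order:
  assumes "f = fps_of_poly N * gs ^ n" "fle 0 f" "fle f (fps_of_poly M * gs ^ k)"
  shows "\<exists>N'. f = fps_of_poly N' * gs ^ k"
  using assms(1)
proof (induction n arbitrary: N)
  case 0
  have "f = fps_of_poly (N * [:1, -1:] ^ k) * gs ^ k"
    using 0 by (simp add: fps_of_poly_mult fps_of_poly_power fps_of_poly_1_minus_X mult.assoc
      gs_power_inverse)
  then show ?case by blast
next
  case (Suc n)
  show ?case
  proof (cases "Suc n \<le> k")
    case True
    have "gs ^ k = gs ^ Suc n * gs ^ (k - Suc n)" using True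
      by (metis le_add_diff_inverse power_add)
    then have "f = fps_of_poly (N * [:1, -1:] ^ (k - Suc n)) * gs ^ k"
      using Suc.prems gs_power_inverse(1)[of "k - Suc n"]
      by (simp add: fps_of_poly_mult fps_of_poly_power fps_of_poly_1_minus_X ac_simps)
    then show ?thesis by blast
  next
    case False
    then obtain j where j: "Suc n = Suc j + k" by (metis Suc_le_eq add.commute add_Suc
      less_imp_Suc_add not_less)
    have "gs ^ Suc n = gs ^ Suc j * gs ^ k" unfolding j by (rule power_add)
    \<comment> \<open>Over the larger pole order the numerator of the bound vanishes at 1, which
      squeezes \<open>poly N 1\<close> between 0 and 0.\<close>
    then have "fps_of_poly M * gs ^ k = fps_of_poly (M * [:1, -1:] ^ Suc j) * gs ^ Suc n"
      using gs_power_inverse(1)[of "Suc j"]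
      by (simp add: fps_of_poly_mult fps_of_poly_power fps_of_poly_1_minus_X ac_simps del:
        power_Suc)
    then have "poly N 1 \<le> poly (M * [:1, -1:] ^ Suc j) 1"
      using assms(3) Suc.prems by (intro rational_fps_le[of _ "Suc n"]) simp
    moreover have "poly 0 1 \<le> poly N 1"
      using assms(2) Suc.prems by (intro rational_fps_le[of _ "Suc n"]) simp
    ultimately have "poly N 1 = 0" by simp
    then obtain N1 where "N = [:-1, 1:] * N1" by (auto simp: poly_eq_0_iff_dvd dvd_def)
    then have "N = [:1, -1:] * (- N1)" by simp
    then have "f = fps_of_poly (- N1) * ((1 - fps_X) * gs) * gs ^ n"
      using Suc.prems fps_of_poly_mult[of "[:1, -1:]" "- N1"]
        by (simp add: fps_of_poly_1_minus_X ac_simps)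
    then show ?thesis using Suc.IH[of "- N1"] by (simp add: gs_inverse)
  qed
qed

text \<open>Noetherian induction along the exact sequence of a linear form \<open>x\<close> outside
  \<open>J\<close>. If \<open>x\<close> is a nonzerodivisor, the colon ideal is \<open>J\<close>
  itself and no larger ideal, but then the sequence can be solved for \<open>HS J\<close>.\<close>

lemma hilbert_serre:
  assumes "homog J"
  shows "\<exists>n N. HS J = fps_of_poly N * gs ^ n"
  using homogD(1)[OF assms] assms
proof (induction J rule: ideal_induct)
  case (step J)
  note J = step.prems and sub = homogD(1)[OF step.prems]
  show ?case
  proof (cases "forms 1 \<subseteq> J")
    case True
    have "fps_nth (HS J) d = 0" if "1 \<le> d" for d
    proof -
      have "idl.span (forms 1) \<subseteq> J" using True sub by (rule idl.span_minimal)
      then have "J \<inter> forms d = forms d" using forms_pos_subset_irrelevant[OF that] by blast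
      then show ?thesis by (simp add: cod_def)
    qed
    then obtain N where "HS J = fps_of_poly N" using eventually_zero_fps_of_poly by blast
    then show ?thesis by (intro exI[of _ 0] exI[of _ N]) simp
  next
    case False
    then obtain x where x: "x \<in> forms 1" "x \<notin> J" by blast
    have ex: "HS J = HS (adj J x) + fps_X * HS (colon J x)"
      using HS_exact[OF J x(1)] by simp
    have "J \<subset> adj J x" using subset_adj[of J x] in_adj[of x J] x(2) by blast
    then obtain n1 N1 where 1: "HS (adj J x) = fps_of_poly N1 * gs ^ n1"
      using step.IH[OF subspace_adj _ homog_adj[OF J x(1)]] by blast
    show ?thesis
    proof (cases "colon J x = J")
      case True
      then have "HS J * (1 - fps_X) = HS (adj J x)" using ex by (simp add: algebra_simps)
      then have "HS J = HS (adj J x) * gs" by (metis gs_inverse(1) mult.assoc mult.right_neutral)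
      then show ?thesis using 1 by (intro exI[of _ "Suc n1"] exI[of _ N1]) (simp add: ac_simps)
    next
      case False
      then have "J \<subset> colon J x" using subset_colon[OF sub] by blast
      then obtain n2 N2 where 2: "HS (colon J x) = fps_of_poly N2 * gs ^ n2"
        using step.IH[OF subspace_colon[OF sub] _ homog_colon[OF J x(1)]] by blast
      have "fps_of_poly (N1 * [:1, -1:] ^ n2 + Polynomial.monom 1 1 * N2 * [:1, -1:] ^ n1) *
        gs ^ (n1 + n2) =
          fps_of_poly N1 * gs ^ n1 * ((1 - fps_X) ^ n2 * gs ^ n2) +
          fps_X * (fps_of_poly N2 * gs ^ n2) * ((1 - fps_X) ^ n1 * gs ^ n1)"
        by (simp add: fps_of_poly_mult fps_of_poly_add fps_of_poly_power fps_of_poly_1_minus_X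
            fps_of_poly_monom_1 power_add algebra_simps del: fps_of_poly_monom fps_of_poly_monom')
      then have "HS J = fps_of_poly (N1 * [:1, -1:] ^ n2 + Polynomial.monom 1 1 * N2 * [:1,
        -1:] ^ n1) * gs ^ (n1 + n2)"
        using ex 1 2 by (simp add: gs_power_inverse)
      then show ?thesis by blast
    qed
  qed
qed

text \<open>Forms \<open>a\<close>, \<open>b\<close> outside \<open>J\<close> with product in
  \<open>J\<close> make both (J, a) and (J : a) strictly larger, so Noetherian induction reduces the
  estimate to primes. A prime contains a linear ideal of the right dimension, whose series is
  known.\<close>

lemma HS_growth:
  fixes J :: "('n::finite, 'k::field) mpoly set"
  assumes "homog J"
    and "\<And>Q. prm Q \<Longrightarrow> J \<subseteq> Q \<Longrightarrow>
      \<exists>L\<subseteq>forms 1. idl.span L \<subseteq> Q \<and> CARD('n) - vs.dim L = k"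
  shows "\<exists>M. fle (HS J) (fps_of_poly M * gs ^ k)"
  using homogD(1)[OF assms(1)] assms
proof (induction J rule: ideal_induct)
  case (step J)
  note J = step.prems(1) and sub = homogD(1)[OF step.prems(1)]
  consider "J = UNIV" | "prm J" | "J \<noteq> UNIV" "\<not> prm J" by blast
  then show ?case
  proof cases
    case 1
    then show ?thesis by (intro exI[of _ 0]) simp
  next
    case 2
    then obtain L where L: "L \<subseteq> forms 1" "idl.span L \<subseteq> J" "CARD('n) - vs.dim L = k"
      using step.prems(2) by blast
    then show ?thesis using HS_mono[OF L(2)] HS_linear[OF L(1)] by (intro exI[of _ 1]) simp
  next
    case 3
    obtain a b i j where ab: "a \<in> forms i" "b \<in> forms j" "a \<notin> J" "b \<notin> J" "a * b \<in> J"
      using homog_prm_test[OF J 3] by metis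
    have s1: "J \<subset> adj J a" using subset_adj[of J a] in_adj[of a J] ab(3) by blast
    have "b \<in> colon J a" using ab(5) by (simp add: colon_def mult.commute)
    then have s2: "J \<subset> colon J a" using subset_colon[OF sub] ab(4) by blast
    obtain M1 where 1: "fle (HS (adj J a)) (fps_of_poly M1 * gs ^ k)"
      using step.IH[OF subspace_adj s1 homog_adj[OF J ab(1)]] step.prems(2) s1
        by (metis psubsetE subset_trans)
    obtain M2 where 2: "fle (HS (colon J a)) (fps_of_poly M2 * gs ^ k)"
      using step.IH[OF subspace_colon[OF sub] s2 homog_colon[OF J ab(1)]] step.prems(2) s2
      by (metis psubsetE subset_trans)
    have "fle 0 (fps_X ^ i)" by (simp add: fle_def fps_X_power_nth)
    from fle_add[OF 1 fle_mult_right[OF 2 this]]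
    have "fle (HS J) (fps_of_poly M1 * gs ^ k + fps_of_poly M2 * gs ^ k * fps_X ^ i)"
      using HS_exact[OF J ab(1)] by (simp add: mult.commute)
    also have "fps_of_poly M1 * gs ^ k + fps_of_poly M2 * gs ^ k * fps_X ^ i =
        fps_of_poly (M1 + M2 * Polynomial.monom 1 i) * gs ^ k"
      by (simp add: fps_of_poly_mult fps_of_poly_add fps_of_poly_monom_1 algebra_simps
          del: fps_of_poly_monom fps_of_poly_monom')
    finally show ?thesis by blast
  qed
qed

section \<open>General elements\<close>

lemma form_reduce_adj:
  assumes J: "homog J" and a: "a \<in> forms i" and u: "u \<in> forms d" "u \<in> adj J a" and d: "i \<le> d"
  obtains v where "v \<in> forms (d - i)" "u - v * a \<in> J"
proof -
  obtain k where k: "u - k * a \<in> J" using adj_iff[OF homogD(1)[OF J]] u(2) by blast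
  have "hcomp d (u - k * a) = u - hcomp (d - i) k * a"
    using u(1) d hcomp_form[of u d d] by (simp add: hcomp_diff hcomp_mult_form[OF a])
  then have "u - hcomp (d - i) k * a \<in> J" using homogD(2)[OF J k, of d] by simp
  then show ?thesis using that hcomp_in_forms by blast
qed

text \<open>The primes \<open>Qs\<close> are those associated primes that do not contain the irrelevant ideal; leaving
  that one out costs finitely many degrees.\<close>

lemma ex_avoiding_primes:
  fixes J :: "('n::finite, 'k::field) mpoly set"
  assumes "homog J"
  shows "\<exists>Qs. finite Qs \<and> (\<forall>Q\<in>Qs. prm Q \<and> J \<subseteq> Q \<and> \<not> forms 1 \<subseteq> Q) \<and>
    (\<forall>l. l \<notin> \<Union>Qs \<longrightarrow> (\<exists>d0. \<forall>d\<ge>d0. \<forall>u\<in>forms d. u * l \<in> J \<longrightarrow> u \<in> J))"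
  using homogD(1)[OF assms] assms
proof (induction J rule: ideal_induct)
  case (step J)
  note J = step.prems and sub = homogD(1)[OF step.prems]
  consider "J = UNIV" | "prm J" "\<not> forms 1 \<subseteq> J" | "forms 1 \<subseteq> J" | "J \<noteq> UNIV" "\<not> prm J" by blast
  then show ?case
  proof cases
    case 1
    then show ?thesis by (intro exI[of _ "{}"]) simp
  next
    case 2
    then show ?thesis by (intro exI[of _ "{J}"]) (auto dest: prmD(3))
  next
    case 3
    have "forms d \<subseteq> J" if "1 \<le> d" for d
      using forms_pos_subset_irrelevant[OF that] idl.span_minimal[OF 3 sub] by blast
    then show ?thesis by (intro exI[of _ "{}"]) auto
  next
    case 4
    obtain a b i j where ab: "a \<in> forms i" "b \<in> forms j" "a \<notin> J" "b \<notin> J" "a * b \<in> J"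
      using homog_prm_test[OF J 4] by metis
    have s1: "J \<subset> adj J a" using subset_adj[of J a] in_adj[of a J] ab(3) by blast
    have "b \<in> colon J a" using ab(5) by (simp add: colon_def mult.commute)
    then have s2: "J \<subset> colon J a" using subset_colon[OF sub] ab(4) by blast
    obtain Q1 where Q1: "finite Q1" "\<forall>Q\<in>Q1. prm Q \<and> adj J a \<subseteq> Q \<and> \<not> forms 1 \<subseteq> Q"
        "\<And>l. l \<notin> \<Union>Q1 \<Longrightarrow> \<exists>d0. \<forall>d\<ge>d0. \<forall>u\<in>forms d. u * l \<in> adj J a \<longrightarrow> u \<in> adj J a"
      using step.IH[OF subspace_adj s1 homog_adj[OF J ab(1)]] by metis
    obtain Q2 where Q2: "finite Q2" "\<forall>Q\<in>Q2. prm Q \<and> colon J a \<subseteq> Q \<and> \<not> forms 1 \<subseteq> Q"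
        "\<And>l. l \<notin> \<Union>Q2 \<Longrightarrow> \<exists>d0. \<forall>d\<ge>d0. \<forall>u\<in>forms d. u * l \<in> colon J a \<longrightarrow> u \<in> colon J a"
      using step.IH[OF subspace_colon[OF sub] s2 homog_colon[OF J ab(1)]] by metis
    have "\<exists>d0. \<forall>d\<ge>d0. \<forall>u\<in>forms d. u * l \<in> J \<longrightarrow> u \<in> J" if l: "l \<notin> \<Union>(Q1 \<union> Q2)" for l
    proof -
      obtain d1 where d1: "\<And>d u. d1 \<le> d \<Longrightarrow> u \<in> forms d \<Longrightarrow> u * l \<in> adj J a \<Longrightarrow> u \<in> adj J a"
        using Q1(3)[of l] l by auto
      obtain d2 where d2: "\<And>d u. d2 \<le> d \<Longrightarrow> u \<in> forms d \<Longrightarrow> u * l \<in> colon J a \<Longrightarrow> u \<in> colon J a"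
        using Q2(3)[of l] l by auto
      have "u \<in> J" if d: "d1 + d2 + i \<le> d" and u: "u \<in> forms d" "u * l \<in> J" for d u
      proof -
        have "u \<in> adj J a" using d1[of d u] d u s1 by auto
        then obtain v where v: "v \<in> forms (d - i)" "u - v * a \<in> J"
          using form_reduce_adj[OF J ab(1) u(1)] d by auto
        \<comment> \<open>\<open>u\<close> is \<open>v * a\<close> modulo \<open>J\<close>, so the
          claim about \<open>u\<close> and \<open>J\<close> turns into one about \<open>v\<close>
          and \<open>colon J a\<close>, in degree lower by \<open>i\<close>.\<close>
        have "v * l * a = u * l - l * (u - v * a)" by (simp add: algebra_simps)
        then have "v * l \<in> colon J a"
          using idl.subspace_diff[OF sub u(2) idl.subspace_scale[OF sub v(2)]]
            by (simp add: colon_def)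
        then have "v \<in> colon J a" using d2[of "d - i" v] v(1) d by auto
        then have "v * a \<in> J" by (simp add: colon_def)
        then show "u \<in> J" using idl.subspace_add[OF sub v(2)] by fastforce
      qed
      then show ?thesis by blast
    qed
    moreover have "\<forall>Q\<in>Q1 \<union> Q2. prm Q \<and> J \<subseteq> Q \<and> \<not> forms 1 \<subseteq> Q"
      using Q1(2) Q2(2) s1 s2 by (meson UnE psubsetE subset_trans)
    ultimately show ?thesis using Q1(1) Q2(1) by (intro exI[of _ "Q1 \<union> Q2"]) blast
  qed
qed

text \<open>On the line \<open>w + c v\<close> with \<open>v\<close> in \<open>Q\<close> and
  \<open>w\<close> outside it, no point lies in \<open>Q\<close>, and each earlier subspace, avoided
  by \<open>v\<close>, contains at most one point.\<close>

lemma vs_avoid_finite_union: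
  fixes V :: "('n::finite, 'k::field) mpoly set"
  assumes inf: "infinite (UNIV :: 'k set)" and V: "vs.subspace V"
    and fin: "finite Qs" and Qs: "\<And>Q. Q \<in> Qs \<Longrightarrow> vs.subspace Q \<and> \<not> V \<subseteq> Q"
  shows "\<exists>v\<in>V. v \<notin> \<Union>Qs"
  using fin Qs
proof (induction Qs)
  case empty
  then show ?case using vs.subspace_0[OF V] by blast
next
  case (insert Q Qs)
  then obtain v where v: "v \<in> V" "v \<notin> \<Union>Qs" by blast
  obtain w where w: "w \<in> V" "w \<notin> Q" using insert.prems[of Q] by blast
  have Q: "vs.subspace Q" using insert.prems[of Q] by blast
  show ?case
  proof (cases "v \<in> Q")
    case True
    have bad: "finite {c. w + smul c v \<in> P}" if "P \<in> Qs" for P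
    proof -
      have P: "vs.subspace P" using insert.prems that by blast
      have "c = c'" if "w + smul c v \<in> P" "w + smul c' v \<in> P" for c c'
      proof (rule ccontr)
        assume ne: "c \<noteq> c'"
        have "(w + smul c v) - (w + smul c' v) \<in> P" using vs.subspace_diff[OF P that] .
        then have "smul (c - c') v \<in> P" by (simp add: vs.scale_left_diff_distrib)
        then have "smul (1 / (c - c')) (smul (c - c') v) \<in> P" using vs.subspace_scale[OF P] by blast
        then have "v \<in> P" using ne by simp
        then show False using v(2) \<open>P \<in> Qs\<close> by blast
      qed
      then have "{c. w + smul c v \<in> P} \<subseteq> {c}" if "w + smul c v \<in> P" for c using that by blast
      then show ?thesis by (metis (no_types, lifting) empty_Collect_eq finite.emptyI
        finite_insert finite_subset)
    qed
    then have "finite (\<Union>P\<in>Qs. {c. w + smul c v \<in> P})" using insert(1) by blast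
    then obtain c where c: "c \<notin> (\<Union>P\<in>Qs. {c. w + smul c v \<in> P})"
      using inf ex_new_if_finite by blast
    have "w + smul c v \<notin> Q"
    proof
      assume "w + smul c v \<in> Q"
      from vs.subspace_diff[OF Q this vs.subspace_scale[OF Q True, of c]] w(2) show False by simp
    qed
    moreover have "w + smul c v \<in> V"
      using vs.subspace_add[OF V w(1) vs.subspace_scale[OF V v(1)]] .
    ultimately show ?thesis using c by blast
  qed (use v in blast)
qed

section \<open>The upper bound over an infinite field\<close>

text \<open>The polynomial (1 - X^e) / (1 - X): the factor of the Hilbert series gained when a
  linear form of a regular sequence is replaced by a form of degree e.\<close>

definition geosum :: "nat \<Rightarrow> int Polynomial.poly" where
  "geosum e = (\<Sum>i<e. Polynomial.monom 1 i)"

lemma geosum_eval: "poly (geosum e) 1 = int e"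
  by (simp add: geosum_def poly_sum poly_monom)

lemma fps_geosum: "fps_of_poly (geosum e) = (1 - fps_X ^ e) * gs"
proof -
  have "fps_of_poly (geosum e) * (1 - fps_X) = 1 - fps_X ^ e"
  proof (induction e)
    case (Suc e)
    have "fps_of_poly (geosum (Suc e)) = fps_of_poly (geosum e) + fps_X ^ e"
      by (simp add: geosum_def fps_of_poly_add fps_of_poly_monom_1 del: fps_of_poly_monom
        fps_of_poly_monom')
    then show ?case using Suc by (simp add: algebra_simps)
  qed (simp add: geosum_def)
  then show ?thesis by (metis gs_inverse(1) mult.assoc mult.right_neutral)
qed

text \<open>A bound from the number and the degree of the adjoined forms alone. It gives one half of
  the regularity criterion in \<open>exchange_step\<close> and the estimate for complete
  intersections.\<close>

lemma HS_span_list_ge: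
  assumes "homog J" "set as \<subseteq> forms e" "e \<ge> 1"
  shows "fle (HS J) (HS (idl.span (J \<union> set as)) * geo e ^ length as)"
  using assms(2)
proof (induction as)
  case Nil
  then show ?case using homogD(1)[OF assms(1)] by (simp add: idl.span_eq_iff[THEN iffD2])
next
  case (Cons a as)
  let ?K = "idl.span (J \<union> set as)"
  have a: "a \<in> forms e" and as: "set as \<subseteq> forms e" using Cons.prems by auto
  have K: "homog ?K"
  proof (rule homog_span)
    fix g d assume g: "g \<in> J \<union> set as"
    show "hcomp d g \<in> ?K"
    proof (cases "g \<in> J")
      case True
      then show ?thesis using homogD(2)[OF assms(1)] by (intro idl.span_base) blast
    next
      case False
      then have "g \<in> forms e" using g as by blast
      then show ?thesis using g hcomp_form[of g e d] by (simp add: idl.span_zero idl.span_base)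
    qed
  qed
  have "fle (HS ?K * geo e ^ length as) (HS (adj ?K a) * geo e * geo e ^ length as)"
    by (rule fle_mult_right[OF HS_adj_ge[OF K a assms(3)] fle_power_nonneg[OF geo_nonneg]])
  moreover have "adj ?K a = idl.span (J \<union> set (a # as))" by (simp add: adj_span)
  ultimately show ?case using fle_trans[OF Cons.IH[OF as]] by (simp add: ac_simps)
qed

lemma homog_zero: "homog {0}"
  by (simp add: homog_def)

lemma idl_span_insert_0: "idl.span (insert 0 S) = idl.span S"
  by (rule antisym; rule idl.span_minimal) (auto intro: idl.span_base idl.span_zero)

text \<open>A general \<open>l\<close> is a nonzerodivisor in all large degrees, so
  \<open>HS J\<close> and the series of \<open>colon J l\<close> differ by a polynomial. Hence the
  pole order drops by one with each section, and after \<open>k\<close> of them the series is a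
  polynomial.\<close>

lemma general_linear_sections:
  fixes A G :: "('n::finite, 'k::field) mpoly set"
  assumes inf: "infinite (UNIV :: 'k set)"
    and A: "finite A" "A \<subseteq> forms 1" "vs.independent A" and G: "G \<subseteq> (\<Union>d. forms d)"
    and HS: "HS (idl.span (A \<union> G)) = fps_of_poly N * gs ^ k"
    and le: "card A + k \<le> CARD('n)"
  shows "\<exists>B N'. finite B \<and> B \<subseteq> forms 1 \<and> vs.independent B \<and> A \<subseteq> B \<and> card B = card A + k \<and>
    HS (idl.span (B \<union> G)) = fps_of_poly N' \<and>
    fle (HS (idl.span (A \<union> G))) (HS (idl.span (B \<union> G)) * gs ^ k)"
  using A HS le
proof (induction k arbitrary: A N)
  case 0
  then show ?case by (intro exI[of _ A] exI[of _ N]) simp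
next
  case (Suc k)
  let ?J = "idl.span (A \<union> G)"
  have J: "homog ?J" using Suc.prems(2) G by (intro homog_span_forms) auto
  obtain Qs where Qs: "finite Qs" "\<And>Q. Q \<in> Qs \<Longrightarrow> prm Q \<and> ?J \<subseteq> Q \<and> \<not> forms 1 \<subseteq> Q"
      "\<And>l. l \<notin> \<Union>Qs \<Longrightarrow> \<exists>d0. \<forall>d\<ge>d0. \<forall>u\<in>forms d. u * l \<in> ?J \<longrightarrow> u \<in> ?J"
    using ex_avoiding_primes[OF J] by metis
  have dimA: "vs.dim (vs.span A) = card A"
    using vs.dim_eq_card_independent[OF Suc.prems(3)] by simp
  have "\<not> forms 1 \<subseteq> vs.span A"
  proof
    assume "forms 1 \<subseteq> vs.span A"
    then have "vs.dim (forms 1 :: ('n, 'k) mpoly set) \<le> card A"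
      using Suc.prems(1) by (rule vs.dim_le_card)
    then show False using Suc.prems(5) dim_forms_1[where 'n = 'n and 'k = 'k] by simp
  qed
  \<comment> \<open>Avoiding \<open>vs.span A\<close> as well keeps the linear forms independent. It
    is a proper subspace because \<open>card A\<close> is still below the number of
    variables.\<close>
  have "\<exists>l\<in>forms 1. l \<notin> \<Union>(insert (vs.span A) Qs)"
  proof (intro vs_avoid_finite_union[OF inf vs_subspace_forms])
    show "finite (insert (vs.span A) Qs)" using Qs(1) by simp
    fix Q assume "Q \<in> insert (vs.span A) Qs"
    then show "vs.subspace Q \<and> \<not> forms 1 \<subseteq> Q"
      using Qs(2)[of Q] vs_subspace_ideal[OF prmD(1), of Q] \<open>\<not> forms 1 \<subseteq> vs.span A\<close> by auto
  qed
  then obtain l where l: "l \<in> forms 1" "l \<notin> vs.span A" "l \<notin> \<Union>Qs" by auto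
  have lA: "l \<notin> A" using l(2) vs.span_base by blast
  have B: "finite (insert l A)" "insert l A \<subseteq> forms 1" "vs.independent (insert l A)"
    using Suc.prems(1,2) l(1) vs.independent_insertI[OF l(2) Suc.prems(3)] by auto
  have adj: "adj ?J l = idl.span (insert l A \<union> G)" by (simp add: adj_span)
  obtain d0 where d0: "\<And>d u. d0 \<le> d \<Longrightarrow> u \<in> forms d \<Longrightarrow> u * l \<in> ?J \<Longrightarrow> u \<in> ?J"
    using Qs(3)[OF l(3)] by blast
  have "fps_nth (HS ?J - HS (colon ?J l)) d = 0" if "d0 \<le> d" for d
  proof -
    have "colon ?J l \<inter> forms d = ?J \<inter> forms d"
      using d0[OF that] subset_colon[of ?J l] by (auto simp: colon_def)
    then show ?thesis by (simp add: cod_def)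
  qed
  then obtain R where R: "HS ?J - HS (colon ?J l) = fps_of_poly R"
    using eventually_zero_fps_of_poly by blast
  have "HS (adj ?J l) = HS ?J - fps_X * HS (colon ?J l)"
    using HS_exact[OF J l(1)] by simp
  \<comment> \<open>The first summand has lost one pole, and the polynomial in the second only
    changes the numerator.\<close>
  also have "\<dots> = HS ?J * (1 - fps_X) + fps_X * (HS ?J - HS (colon ?J l))"
    by (simp add: algebra_simps)
  also have "\<dots> = fps_of_poly N * gs ^ k * (gs * (1 - fps_X)) +
      fps_X * fps_of_poly R * ((1 - fps_X) ^ k * gs ^ k)"
    using R Suc.prems(4) by (simp add: gs_power_inverse ac_simps)
  also have "\<dots> = fps_of_poly (N + Polynomial.monom 1 1 * R * [:1, -1:] ^ k) * gs ^ k"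
    unfolding gs_inverse mult_1_right
    by (simp add: fps_of_poly_mult fps_of_poly_add fps_of_poly_power fps_of_poly_1_minus_X
        fps_of_poly_monom_1 algebra_simps del: fps_of_poly_monom fps_of_poly_monom')
  finally have HSl: "HS (idl.span (insert l A \<union> G)) =
      fps_of_poly (N + Polynomial.monom 1 1 * R * [:1, -1:] ^ k) * gs ^ k" using adj by simp
  have "card (insert l A) + k \<le> CARD('n)" using Suc.prems(1,5) lA by simp
  from Suc.IH[OF B HSl this] obtain B' N' where B':
    "finite B'" "B' \<subseteq> forms 1" "vs.independent B'" "insert l A \<subseteq> B'" "card B' =
      card (insert l A) + k"
    "HS (idl.span (B' \<union> G)) = fps_of_poly N'"
    "fle (HS (idl.span (insert l A \<union> G))) (HS (idl.span (B' \<union> G)) * gs ^ k)" by blast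
  have "fle (HS ?J) (HS (adj ?J l) * gs)" using HS_adj_ge[OF J l(1)] by (simp add: gs_geo)
  moreover have "fle (HS (adj ?J l) * gs) (HS (idl.span (B' \<union> G)) * gs ^ k * gs)"
    using fle_mult_right[OF B'(7) gs_nonneg] adj by simp
  ultimately have "fle (HS ?J) (HS (idl.span (B' \<union> G)) * gs ^ Suc k)"
    using fle_trans by (simp add: ac_simps)
  moreover have "card B' = card A + Suc k" using B'(5) Suc.prems(1) lA by simp
  ultimately show ?case using B' by blast
qed

text \<open>The linear forms \<open>ys\<close> completing \<open>A\<close> to a basis are exchanged one by one for general
  elements of degree \<open>e\<close>. A sequence of forms of degrees \<open>d\<^sub>j\<close> is regular iff its quotient has
  Hilbert series \<open>\<Prod>(1 - X ^ d\<^sub>j) / (1 - X) ^ n\<close>; this criterion does not depend on the order, so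
  the sequence without the form \<open>y\<close> to be exchanged is regular too and \<open>y\<close> is a
  nonzerodivisor modulo it. Hence the irrelevant ideal is not associated to it, and a general
  element of degree \<open>e\<close> is a nonzerodivisor as well.\<close>

lemma exchange_step:
  fixes A Gs D :: "('n::finite, 'k::field) mpoly set"
  assumes inf: "infinite (UNIV :: 'k set)" and e: "e \<ge> 1"
    and V: "vs.subspace V" "V \<subseteq> forms e"
    and V_big: "\<And>Q. prm Q \<Longrightarrow> idl.span (set as \<union> set bs) \<subseteq> Q \<Longrightarrow> V \<subseteq> Q \<Longrightarrow> forms 1 \<subseteq> Q"
    and as: "set as \<subseteq> forms 1" and bs: "set bs \<subseteq> forms e" and y: "y \<in> forms 1"
    and len: "Suc (length as) + length bs = CARD('n)"
    and HS: "HS (idl.span (insert y (set as \<union> set bs)) :: ('n, 'k) mpoly set) =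
      fps_of_poly (geosum e) ^ length bs"
  shows "\<exists>g\<in>V. HS (idl.span (insert g (set as \<union> set bs))) =
    fps_of_poly (geosum e) ^ Suc (length bs)"
proof -
  let ?B = "idl.span (set as \<union> set bs)" and ?i = "length bs" and ?E = "fps_of_poly (geosum e)"
    and ?s = "CARD('n)"
  have B: "homog ?B" using as bs by (intro homog_span_forms) blast
  note sub = homogD(1)[OF B]
  have adjy: "adj ?B y = idl.span (insert y (set as \<union> set bs))" by (rule adj_span)
  have As: "homog (idl.span (set as))" using as by (intro homog_span_forms) blast
  \<comment> \<open>The lower estimate comes from counting the forms, the opposite one from the
    given series after adjoining \<open>y\<close>. Together they determine the series without
    \<open>y\<close>.\<close>
  have 1: "fle (HS ({0} :: ('n, 'k) mpoly set)) (HS (idl.span (set as)) * gs ^ length as)"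
    using HS_span_list_ge[OF homog_zero as] by (simp add: gs_geo idl_span_insert_0)
  have 2: "fle (HS (idl.span (set as))) (HS ?B * geo e ^ ?i)"
  proof -
    have "idl.span (idl.span (set as) \<union> set bs) = ?B"
      by (rule antisym; rule idl.span_minimal)
        (auto intro: idl.span_base idl.span_mono[THEN subsetD, of "set as"])
    then show ?thesis using HS_span_list_ge[OF As bs e] by simp
  qed
  have "fle (gs ^ ?s) (HS ?B * geo e ^ ?i * gs ^ length as)"
    using fle_trans[OF 1 fle_mult_right[OF 2 fle_power_nonneg[OF gs_nonneg]]] unfolding HS_zero .
  moreover have "fle (HS ?B * geo e ^ ?i * gs ^ length as) (gs ^ ?s)"
  proof -
    have "fle (HS ?B) (?E ^ ?i * gs)"
      using HS_adj_ge[OF B y] HS adjy by (simp add: gs_geo)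
    then have "fle (HS ?B * (geo e ^ ?i * gs ^ length as)) (?E ^ ?i * gs * (geo e ^ ?i *
      gs ^ length as))"
      by (intro fle_mult_right fle_mult_nonneg fle_power_nonneg gs_nonneg geo_nonneg)
    also have "?E ^ ?i * gs * (geo e ^ ?i * gs ^ length as) = ((1 - fps_X ^ e) * geo e) ^ ?i *
      gs ^ (Suc (length as) + ?i)"
      unfolding fps_geosum by (simp add: power_mult_distrib power_add ac_simps)
    also have "\<dots> = gs ^ ?s" using geo_inverse[OF e] len by simp
    finally show ?thesis by (simp add: ac_simps)
  qed
  ultimately have eq: "HS ?B * geo e ^ ?i * gs ^ length as = gs ^ ?s" by (metis fle_antisym)
  \<comment> \<open>Insertion of factors equal to 1 in order to solve the equation for
    \<open>HS ?B\<close>.\<close>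
  have "HS ?B = HS ?B * ((1 - fps_X ^ e) * geo e) ^ ?i * ((1 - fps_X) ^ length as * gs ^ length as)"
    using geo_inverse[OF e] by (simp add: gs_power_inverse)
  also have "\<dots> = (HS ?B * geo e ^ ?i * gs ^ length as) * (1 - fps_X ^ e) ^ ?i *
    (1 - fps_X) ^ length as"
    by (simp add: power_mult_distrib ac_simps)
  also have "\<dots> = (1 - fps_X ^ e) ^ ?i * gs ^ Suc ?i * ((1 - fps_X) ^ length as * gs ^ length as)"
    unfolding eq len[symmetric] by (simp add: power_add ac_simps)
  also have "\<dots> = ?E ^ ?i * gs"
    unfolding fps_geosum by (simp add: gs_power_inverse power_mult_distrib ac_simps)
  finally have HB: "HS ?B = ?E ^ ?i * gs" .
  have "HS ?B = ?E ^ ?i + fps_X * HS (colon ?B y)"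
    using HS_exact[OF B y] HS adjy by simp
  moreover have "HS ?B = ?E ^ ?i + fps_X * HS ?B"
  proof -
    have "HS ?B * (1 - fps_X) = ?E ^ ?i" unfolding HB by (simp add: mult.assoc gs_inverse)
    then show ?thesis by (simp add: algebra_simps)
  qed
  ultimately have "fps_X * HS (colon ?B y) = fps_X * HS ?B" by simp
  then have "HS ?B = HS (colon ?B y)" by simp
  then have coly: "colon ?B y = ?B"
    using HS_eq_imp[OF B homog_colon[OF B y] subset_colon[OF sub]] by simp
  obtain Qs where Qs: "finite Qs" "\<And>Q. Q \<in> Qs \<Longrightarrow> prm Q \<and> ?B \<subseteq> Q \<and> \<not> forms 1 \<subseteq> Q"
      "\<And>l. l \<notin> \<Union>Qs \<Longrightarrow> \<exists>d0. \<forall>d\<ge>d0. \<forall>u\<in>forms d. u * l \<in> ?B \<longrightarrow> u \<in> ?B"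
    using ex_avoiding_primes[OF B] by metis
  have "\<exists>g\<in>V. g \<notin> \<Union>Qs"
  proof (intro vs_avoid_finite_union[OF inf V(1) Qs(1)])
    fix Q assume "Q \<in> Qs"
    then show "vs.subspace Q \<and> \<not> V \<subseteq> Q"
      using Qs(2)[of Q] vs_subspace_ideal[OF prmD(1), of Q] V_big[of Q] by auto
  qed
  then obtain g where g: "g \<in> V" "g \<notin> \<Union>Qs" by blast
  then have ge: "g \<in> forms e" using V(2) by blast
  obtain d0 where d0: "\<And>d u. d0 \<le> d \<Longrightarrow> u \<in> forms d \<Longrightarrow> u * g \<in> ?B \<Longrightarrow> u \<in> ?B"
    using Qs(3)[OF g(2)] by blast
  have yn: "u * y ^ n \<in> ?B \<Longrightarrow> u \<in> ?B" for u n
  proof (induction n arbitrary: u)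
    case (Suc n)
    then have "u * y \<in> ?B" using Suc.IH[of "u * y"] by (simp add: ac_simps)
    then show ?case using coly by (auto simp: colon_def)
  qed simp
  have ynf: "y ^ n \<in> forms n" for n
    by (induction n) (use one_in_forms forms_mult[OF y] in \<open>auto simp: plus_1_eq_Suc\<close>)
  have "colon ?B g \<subseteq> ?B"
  proof (rule homog_subset_if_forms[OF homog_colon[OF B ge] _ sub], rule subsetI)
    fix d u assume u: "u \<in> colon ?B g \<inter> forms d"
    \<comment> \<open>Multiplication by \<open>y ^ d0\<close> moves \<open>u\<close> into the
      degrees where \<open>g\<close> cancels. The power of \<open>y\<close> cancels in every
      degree.\<close>
    have "y ^ d0 * (u * g) \<in> ?B" using u by (intro idl.subspace_scale[OF sub, of "u *
      g"]) (simp add: colon_def)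
    then have 1: "(u * y ^ d0) * g \<in> ?B" by (simp add: ac_simps)
    have 2: "u * y ^ d0 \<in> forms (d + d0)" using forms_mult[of u d "y ^ d0" d0] u ynf by auto
    have "u * y ^ d0 \<in> ?B" by (rule d0[OF le_add2 2 1])
    then show "u \<in> ?B" by (rule yn)
  qed
  then have "colon ?B g = ?B" using subset_colon[OF sub] by blast
  then have "HS (adj ?B g) = (1 - fps_X ^ e) * HS ?B"
    using HS_exact[OF B ge] by (simp add: algebra_simps)
  also have "\<dots> = ?E ^ Suc ?i" unfolding HB by (simp add: fps_geosum ac_simps)
  finally show ?thesis using g(1) by (auto simp: adj_span)
qed

text \<open>The process starts from a basis of the linear forms, with series 1, and each exchange
  contributes a factor \<open>geosum e\<close>. \<open>V_big\<close> says that only primes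
  containing all linear forms contain \<open>A\<close> and \<open>V\<close>, so a general element of
  \<open>V\<close> avoids the others.\<close>

lemma exchange:
  fixes A :: "('n::finite, 'k::field) mpoly set"
  assumes inf: "infinite (UNIV :: 'k set)" and e: "e \<ge> 1"
    and V: "vs.subspace V" "V \<subseteq> forms e"
    and V_big: "\<And>Q. prm Q \<Longrightarrow> A \<subseteq> Q \<Longrightarrow> V \<subseteq> Q \<Longrightarrow> forms 1 \<subseteq> Q"
    and A: "finite A" "A \<subseteq> forms 1" "vs.independent A"
  shows "\<exists>bs. set bs \<subseteq> V \<and> HS (idl.span (A \<union> set bs)) =
    fps_of_poly (geosum e) ^ (CARD('n) - card A)"
proof -
  obtain D where D: "A \<subseteq> D" "D \<subseteq> forms 1" "vs.independent D" "forms 1 \<subseteq> vs.span D"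
    using vs.maximal_independent_subset_extend[OF A(2,3)] by metis
  have fin: "finite D"
    using vs.independent_finite_dim[OF finite_monomials upto_fd[OF order_refl forms_subset_upto]
      D(2,3)] .
  have cardD: "card D = CARD('n)"
    using vs.basis_card_eq_dim[OF D(2,4,3)] dim_forms_1[where 'n = 'n and 'k = 'k] by simp
  obtain as where as: "set as = A" "distinct as" using finite_distinct_list[OF A(1)] by blast
  obtain ys where ys: "set ys = D - A" "distinct ys" using finite_distinct_list[of "D - A"] fin
    by blast
  have lena: "length as = card A" using as distinct_card by metis
  have leny: "length as + length ys = CARD('n)"
  proof -
    have "length ys = card (D - A)" using ys distinct_card by metis
    then show ?thesis using D(1) fin cardD A(1) card_mono[OF fin D(1)] lena
      by (simp add: card_Diff_subset)
  qed
  have "\<exists>bs. set bs \<subseteq> V \<and> length bs = i \<and>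
      HS (idl.span (A \<union> set (drop i ys) \<union> set bs)) = fps_of_poly (geosum e) ^ i"
    if "i \<le> length ys" for i
    using that
  proof (induction i)
    case 0
    have "A \<union> set ys = D" using ys D(1) by blast
    moreover have "idl.span D = idl.span (forms 1)"
      by (rule antisym[OF idl.span_mono[OF D(2)]], rule idl.span_minimal)
        (use D(4) vs_span_subset_idl_span in auto)
    ultimately show ?case using HS_irrelevant[where 'n = 'n and 'k = 'k]
      by (intro exI[of _ "[]"]) simp
  next
    case (Suc i)
    then obtain bs where bs: "set bs \<subseteq> V" "length bs = i"
      "HS (idl.span (A \<union> set (drop i ys) \<union> set bs)) = fps_of_poly (geosum e) ^ i" by auto
    let ?as = "as @ drop (Suc i) ys" and ?y = "ys ! i"
    have i: "i < length ys" using Suc.prems by simp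
    have dr: "set (drop i ys) = insert ?y (set (drop (Suc i) ys))"
      using Cons_nth_drop_Suc[OF i] by (metis list.simps(15))
    have ysf: "set ys \<subseteq> forms 1" using ys D(2) by blast
    have "\<exists>g\<in>V. HS (idl.span (insert g (set ?as \<union> set bs))) =
      fps_of_poly (geosum e) ^ Suc (length bs)"
    proof (rule exchange_step[OF inf e V])
      show "set ?as \<subseteq> forms 1" using as(1) A(2) ysf set_drop_subset[of "Suc i" ys] by auto
      show "?y \<in> forms 1" using ysf nth_mem[OF i] by blast
      show "Suc (length ?as) + length bs = CARD('n)" using leny bs(2) i by simp
      show "HS (idl.span (insert ?y (set ?as \<union> set bs))) = fps_of_poly (geosum e) ^ length bs"
        using bs(2,3) as(1) dr by (simp add: Un_ac)
      show "set bs \<subseteq> forms e" using bs(1) V(2) by blast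
      fix Q assume Q: "prm Q" "idl.span (set ?as \<union> set bs) \<subseteq> Q" "V \<subseteq> Q"
      have "A \<subseteq> Q" using Q(2) idl.span_superset[of "set ?as \<union> set bs"] as(1) by auto
      then show "forms 1 \<subseteq> Q" using V_big Q by blast
    qed
    then obtain g where "g \<in> V" "HS (idl.span (insert g (set ?as \<union> set bs))) =
      fps_of_poly (geosum e) ^ Suc i"
      using bs(2) by blast
    then show ?case using bs(1,2) as(1) by (intro exI[of _ "g # bs"]) simp
  qed
  from this[of "length ys"] obtain bs where
    "set bs \<subseteq> V" "HS (idl.span (A \<union> set bs)) = fps_of_poly (geosum e) ^ length ys" by auto
  moreover have "length ys = CARD('n) - card A" using leny lena by simp
  ultimately show ?thesis by auto
qed

text \<open>The regular sequence is taken inside the ideal of finite colength, so its quotient maps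
  onto that of the ideal and has the larger series.\<close>

lemma upper_bound_infinite:
  fixes F G :: "('n::finite, 'k::field) mpoly set"
  assumes inf: "infinite (UNIV :: 'k set)" and e: "e \<ge> 1"
    and F: "finite F" "F \<subseteq> forms 1" "vs.independent F" and G: "G \<subseteq> forms e"
    and HS: "HS (idl.span (F \<union> G)) = fps_of_poly N * gs ^ k"
    and le: "card F + k \<le> CARD('n)"
  shows "fle (HS (idl.span (F \<union> G)))
    (fps_of_poly (geosum e) ^ (CARD('n) - card F - k) * gs ^ k)"
proof -
  have G': "G \<subseteq> (\<Union>d. forms d)" using G by blast
  obtain A N' where A: "finite A" "A \<subseteq> forms 1" "vs.independent A" "F \<subseteq> A" "card A = card F + k"
    "HS (idl.span (A \<union> G)) = fps_of_poly N'"
    "fle (HS (idl.span (F \<union> G))) (HS (idl.span (A \<union> G)) * gs ^ k)"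
    using general_linear_sections[OF inf F G' HS le] by blast
  let ?J = "idl.span (A \<union> G)"
  define V where "V = ?J \<inter> forms e"
  have "\<exists>bs. set bs \<subseteq> V \<and> HS (idl.span (A \<union> set bs)) =
    fps_of_poly (geosum e) ^ (CARD('n) - card A)"
  proof (rule exchange[OF inf e _ _ _ A(1-3)])
    show "vs.subspace V" by (simp add: V_def vs.subspace_inter)
    show "V \<subseteq> forms e" by (simp add: V_def)
    fix Q assume Q: "prm Q" "A \<subseteq> Q" "V \<subseteq> Q"
    have "G \<subseteq> Q" using Q(3) G idl.span_superset[of "A \<union> G"] by (auto simp: V_def)
    then have JQ: "?J \<subseteq> Q" using Q by (intro idl.span_minimal prmD(1)) auto
    let ?d = "Suc (Polynomial.degree N')"
    \<comment> \<open>Beyond the degree of the polynomial series the ideal contains all forms. A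
      prime over it therefore contains a power of every linear form.\<close>
    have "HF ?J ?d = 0" using A(6) by (metis HS_nth fps_of_poly_nth coeff_eq_0 lessI)
    then have "?J \<inter> forms ?d = UNIV \<inter> forms ?d"
      by (intro cod_eq_imp[OF forms_subset_upto]) simp_all
    then have fQ: "forms ?d \<subseteq> Q" using JQ by blast
    show "forms 1 \<subseteq> Q"
    proof
      fix v :: "('n, 'k) mpoly" assume v: "v \<in> forms 1"
      have "v ^ n \<in> forms n" for n
        by (induction n) (use one_in_forms forms_mult[OF v] in \<open>auto simp: plus_1_eq_Suc\<close>)
      then have "v ^ ?d \<in> Q" using fQ by blast
      then show "v \<in> Q" by (rule prm_power[OF Q(1)])
    qed
  qed
  then obtain bs where bs: "set bs \<subseteq> V" "HS (idl.span (A \<union> set bs)) =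
    fps_of_poly (geosum e) ^ (CARD('n) - card A)" by blast
  have "idl.span (A \<union> set bs) \<subseteq> ?J"
    using bs(1) by (intro idl.span_minimal) (auto simp: V_def intro: idl.span_base)
  then have "fle (HS ?J) (fps_of_poly (geosum e) ^ (CARD('n) - card F - k))"
    using HS_mono bs(2) A(5) by (metis diff_diff_left)
  from fle_mult_right[OF this fle_power_nonneg[OF gs_nonneg, of k]] show ?thesis
    using fle_trans[OF A(7)] by blast
qed

section \<open>Extension of the base field to its algebraic closure\<close>

text \<open>Over a finite field, 1 plus the product of all X - a has no root.\<close>

lemma infinite_UNIV_alg_closed: "infinite (UNIV :: 'a::alg_closed_field set)"
proof
  assume fin: "finite (UNIV :: 'a set)"
  define p where "p = (\<Prod>a\<in>(UNIV :: 'a set). [:- a, 1:])"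
  have "poly (p + 1) x = 1" for x
    using fin by (auto simp: p_def poly_prod)
  moreover have "Polynomial.degree (p + 1) > 0"
  proof -
    have "Polynomial.degree p = CARD('a)"
      unfolding p_def by (subst degree_prod_eq_sum_degree) auto
    then have "Polynomial.degree p > 0" using fin by (simp add: card_gt_0_iff)
    then show ?thesis by (subst degree_add_eq_left) auto
  qed
  ultimately show False using alg_closed_imp_poly_has_root[of "p + 1"] by auto
qed

definition ext :: "('n::finite, 'k::field) mpoly \<Rightarrow> ('n, 'k alg_closure) mpoly" where
  "ext f = Poly_Mapping.map to_ac f"

lemma lookup_ext [simp]: "lookup (ext f) m = to_ac (lookup f m)"
  by (simp add: ext_def Poly_Mapping.map.rep_eq when_def)

lemma ext_eq_iff: "ext f = ext g \<longleftrightarrow> f = g"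
proof
  assume "ext f = ext g"
  then have "to_ac (lookup f m) = to_ac (lookup g m)" for m
    by (metis lookup_ext)
  then show "f = g" by (intro poly_mapping_eqI) simp
qed simp

lemma inj_ext: "inj ext"
  by (simp add: inj_def ext_eq_iff)

lemma ext_add: "ext (f + g) = ext f + ext g"
  by (rule poly_mapping_eqI) (simp add: lookup_add)

lemma ext_0 [simp]: "ext 0 = 0"
  by (rule poly_mapping_eqI) simp

lemma ext_1: "ext 1 = 1"
  by (rule poly_mapping_eqI) (simp add: lookup_one when_def)

lemma ext_sum: "ext (sum f A) = (\<Sum>x\<in>A. ext (f x))"
  by (induction A rule: infinite_finite_induct) (simp_all add: ext_add)

lemma ext_smul: "ext (smul c f) = smul (to_ac c) (ext f)"
  by (rule poly_mapping_eqI) simp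

lemma ext_single: "ext (single m c) = single m (to_ac c)"
  by (rule poly_mapping_eqI) (simp add: lookup_single when_def)

lemma keys_ext: "keys (ext f) = keys f"
  by (auto simp: in_keys_iff)

lemma ext_mult: "ext (f * g) = ext f * ext g"
  unfolding mult_as_sum[of f g] mult_as_sum[of "ext f" "ext g"] keys_ext
  by (simp add: ext_sum ext_single)

lemma ext_forms: "ext f \<in> forms d \<longleftrightarrow> f \<in> forms d"
  by (simp add: forms_iff)

lemma hcomp_ext: "hcomp d (ext f) = ext (hcomp d f)"
  by (rule poly_mapping_eqI) simp

text \<open>A K-linear functional on the closure brings relations with coefficients in the closure
  down to K. The value 1 at \<open>c0\<close> keeps a chosen coefficient from disappearing.\<close>

lemma ex_coefficient_functional:
  fixes c0 :: "'k::field alg_closure"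
  assumes "c0 \<noteq> 0"
  shows "\<exists>\<phi> :: 'k alg_closure \<Rightarrow> 'k. (\<forall>x y. \<phi> (x + y) = \<phi> x + \<phi> y) \<and>
    (\<forall>c x. \<phi> (x * to_ac c) = \<phi> x * c) \<and> \<phi> c0 = 1"
proof -
  interpret E: Vector_Spaces.vector_space_pair "\<lambda>(c::'k) x. to_ac c * x" "(*) :: 'k \<Rightarrow> 'k \<Rightarrow> 'k"
    by unfold_locales (simp_all add: algebra_simps)
  have "E.vs1.independent {c0}" using assms E.vs1.dependent_single by blast
  then obtain \<phi> where \<phi>: "Vector_Spaces.linear (\<lambda>(c::'k) x. to_ac c * x) (*) \<phi>" "\<forall>x\<in>{c0}. \<phi> x = 1"
    using E.linear_independent_extend[of "{c0}" "\<lambda>_. 1"] by blast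
  interpret \<phi>: Vector_Spaces.linear "\<lambda>(c::'k) x. to_ac c * x" "(*)" \<phi> by (rule \<phi>)
  show ?thesis
    using \<phi>(2) by (intro exI[of _ \<phi>]) (simp add: \<phi>.add \<phi>.scale mult.commute[of _ "to_ac _"])
qed

text \<open>The functional, applied to the coefficients of a nontrivial relation between the
  \<open>ext b\<close>, yields a relation over K between the \<open>b\<close> in which one
  coefficient is 1.\<close>

lemma independent_ext:
  fixes B :: "('n::finite, 'k::field) mpoly set"
  assumes B: "finite B" "vs.independent B"
  shows "vs.independent (ext ` B)"
proof (rule vs.independent_if_scalars_zero)
  fix f :: "('n, 'k alg_closure) mpoly \<Rightarrow> 'k alg_closure" and x
  assume 0: "(\<Sum>x\<in>ext ` B. smul (f x) x) = 0" and "x \<in> ext ` B"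
  then obtain b0 where b0: "b0 \<in> B" "x = ext b0" by blast
  show "f x = 0"
  proof (rule ccontr)
    assume "f x \<noteq> 0"
    then obtain \<phi> :: "'k alg_closure \<Rightarrow> 'k" where \<phi>: "\<And>x y. \<phi> (x + y) = \<phi> x + \<phi> y"
        "\<And>c x. \<phi> (x * to_ac c) = \<phi> x * c" "\<phi> (f x) = 1"
      using ex_coefficient_functional by blast
    have \<phi>0: "\<phi> 0 = 0" using \<phi>(2)[of 0 0] by simp
    have \<phi>s: "\<phi> (sum g A) = (\<Sum>a\<in>A. \<phi> (g a))" for g and A :: "('n, 'k) mpoly set"
      by (induction A rule: infinite_finite_induct) (simp_all add: \<phi> \<phi>0)
    have "(\<Sum>b\<in>B. smul (\<phi> (f (ext b))) b) = 0"
    proof (rule poly_mapping_eqI)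
      fix m
      have "0 = lookup (\<Sum>b\<in>B. smul (f (ext b)) (ext b)) m"
        using 0 by (simp add: sum.reindex inj_on_subset[OF inj_ext] o_def)
      then have "\<phi> (\<Sum>b\<in>B. f (ext b) * to_ac (lookup b m)) = 0"
        using \<phi>0 by (simp add: lookup_sum)
      then show "lookup (\<Sum>b\<in>B. smul (\<phi> (f (ext b))) b) m = lookup 0 m"
        by (simp add: \<phi>s \<phi>(2) lookup_sum)
    qed
    then have "\<phi> (f (ext b0)) = 0" using vs.independentD[OF B(2) B(1) order_refl _ b0(1),
      of "\<lambda>b. \<phi> (f (ext b))"] by simp
    then show False using \<phi>(3) b0 by simp
  qed
qed (use B in simp)

lemma ext_span: "v \<in> vs.span S \<Longrightarrow> ext v \<in> vs.span (ext ` S)"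
proof -
  assume v: "v \<in> vs.span S"
  have "vs.subspace {v. ext v \<in> vs.span (ext ` S)}"
    by (intro vs.subspaceI) (auto simp: ext_add ext_smul vs.span_zero intro: vs.span_add
      vs.span_scale)
  then have "vs.span S \<subseteq> {v. ext v \<in> vs.span (ext ` S)}"
    by (intro vs.span_minimal) (auto intro: vs.span_base)
  then show ?thesis using v by blast
qed

lemma dim_ext:
  assumes "V \<subseteq> forms_upto d"
  shows "vs.dim (vs.span (ext ` V)) = vs.dim V"
proof -
  from vs.fd_basis[OF finite_monomials upto_fd[OF order_refl assms]] obtain B where
    B: "B \<subseteq> V" "V \<subseteq> vs.span B" "vs.independent B" "finite B" "card B = vs.dim V" by metis
  have "ext ` V \<subseteq> vs.span (ext ` B)" using B(2) ext_span by blast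
  moreover have "ext ` B \<subseteq> ext ` V" using B(1) by blast
  ultimately have "card (ext ` B) = vs.dim (ext ` V)"
    using vs.basis_card_eq_dim independent_ext[OF B(4,3)] by blast
  then show ?thesis using B(5) card_image[OF inj_on_subset[OF inj_ext subset_UNIV], of B] by simp
qed

lemma smul_mult_right: "p * smul c x = smul c (p * x)"
  by (simp add: smul_def mult.left_commute)

lemma idl_subspace_ext:
  fixes J :: "('n::finite, 'k::field) mpoly set"
  assumes J: "idl.subspace J"
  shows "idl.subspace (vs.span (ext ` J))"
proof (rule idl.subspaceI)
  fix p x assume x: "x \<in> vs.span (ext ` J)"
  have "vs.subspace {x. p * x \<in> vs.span (ext ` J)}"
    by (intro vs.subspaceI)
      (auto simp: distrib_left vs.span_zero smul_mult_right intro: vs.span_add vs.span_scale)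
  moreover have "p * ext f \<in> vs.span (ext ` J)" if "f \<in> J" for f
  proof -
    \<comment> \<open>Monomials come from K, so only scalars of the closure have to be moved past
      the elements of \<open>J\<close>.\<close>
    have "p = (\<Sum>m\<in>keys p. smul (lookup p m) (ext (single m 1)))"
      using poly_sum_single[of p] by (simp add: smul_single ext_single)
    then have "p * ext f = (\<Sum>m\<in>keys p.
        smul (lookup p m) (ext (single m 1))) * ext f" by simp
    also have "\<dots> = (\<Sum>m\<in>keys p.
        smul (lookup p m) (ext (single m 1 * f)))"
      by (simp add: sum_distrib_right smul_def ext_mult mult.assoc)
    also have "\<dots> \<in> vs.span (ext ` J)"
      using idl.subspace_scale[OF J that] by (intro vs.span_sum vs.span_scale vs.span_base imageI)
    finally show ?thesis .
  qed
  ultimately have "vs.span (ext ` J) \<subseteq> {x. p * x \<in> vs.span (ext ` J)}"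
    by (intro vs.span_minimal) auto
  then show "p * x \<in> vs.span (ext ` J)" using x by blast
qed (auto intro: vs.span_zero vs.span_add)

lemma ext_forms_span:
  fixes J :: "('n::finite, 'k::field) mpoly set"
  assumes J: "homog J"
  shows "vs.span (ext ` J) \<inter> forms d = vs.span (ext ` (J \<inter> forms d))"
proof
  have "vs.subspace {x. hcomp d x \<in> vs.span (ext ` (J \<inter> forms d))}"
    by (intro vs.subspaceI) (auto simp: hcomp_add hcomp_smul vs.span_zero intro: vs.span_add
      vs.span_scale)
  moreover have "hcomp d (ext f) \<in> vs.span (ext ` (J \<inter> forms d))" if "f \<in> J" for f
    unfolding hcomp_ext using homogD(2)[OF J that] by (intro vs.span_base imageI) simp
  ultimately have "vs.span (ext ` J) \<subseteq> {x. hcomp d x \<in> vs.span (ext ` (J \<inter> forms d))}"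
    by (intro vs.span_minimal) auto
  then show "vs.span (ext ` J) \<inter> forms d \<subseteq> vs.span (ext ` (J \<inter> forms d))"
    using hcomp_form[of _ d d] by fastforce
  have "ext ` (J \<inter> forms d) \<subseteq> forms d" by (auto simp: ext_forms)
  then have "vs.span (ext ` (J \<inter> forms d)) \<subseteq> forms d" by (rule vs.span_minimal) simp
  moreover have "vs.span (ext ` (J \<inter> forms d)) \<subseteq> vs.span (ext ` J)"
    by (rule vs.span_mono) blast
  ultimately show "vs.span (ext ` (J \<inter> forms d)) \<subseteq> vs.span (ext ` J) \<inter> forms d" by blast
qed

lemma HS_ext:
  fixes J :: "('n::finite, 'k::field) mpoly set"
  assumes J: "homog J"
  shows "HS (vs.span (ext ` J)) = HS J"
proof (rule fps_ext)
  fix d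
  have *: "vs.dim (vs.span (ext ` K) \<inter> forms d) = vs.dim (K \<inter> forms d)"
    if "homog K" for K :: "('n, 'k) mpoly set"
    unfolding ext_forms_span[OF that] using forms_subset_upto by (intro dim_ext) blast
  have "1 \<in> vs.span (ext ` (UNIV :: ('n, 'k) mpoly set))"
    using ext_1 by (metis UNIV_I image_eqI vs.span_base)
  then have U: "vs.span (ext ` (UNIV :: ('n, 'k) mpoly set)) = UNIV"
    using proper_iff[OF idl_subspace_ext[of "UNIV :: ('n, 'k) mpoly set"]] by simp
  show "fps_nth (HS (vs.span (ext ` J))) d = fps_nth (HS J) d"
    using *[OF J] *[OF homog_UNIV] U by (simp add: cod_def)
qed

lemma idl_span_ext: "idl.span (ext ` G) = vs.span (ext ` idl.span G)"
proof
  show "idl.span (ext ` G) \<subseteq> vs.span (ext ` idl.span G)"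
    by (rule idl.span_minimal[OF _ idl_subspace_ext]) (auto intro: vs.span_base idl.span_base)
  have "idl.subspace {f. ext f \<in> idl.span (ext ` G)}"
    by (intro idl.subspaceI) (auto simp: ext_add ext_mult idl.span_zero intro: idl.span_add
      idl.span_scale)
  then have "idl.span G \<subseteq> {f. ext f \<in> idl.span (ext ` G)}"
    by (intro idl.span_minimal) (auto intro: idl.span_base)
  then show "vs.span (ext ` idl.span G) \<subseteq> idl.span (ext ` G)"
    by (intro vs.span_minimal) auto
qed

text \<open>Degrees, independence, cardinality and Hilbert series all survive the extension to the
  closure, which is infinite.\<close>

lemma HS_upper_bound:
  fixes F G :: "('n::finite, 'k::field) mpoly set"
  assumes e: "e \<ge> 1" and F: "finite F" "F \<subseteq> forms 1" "vs.independent F" and G: "G \<subseteq> forms e"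
    and HS: "HS (idl.span (F \<union> G)) = fps_of_poly N * gs ^ k"
    and le: "card F + k \<le> CARD('n)"
  shows "fle (HS (idl.span (F \<union> G)))
    (fps_of_poly (geosum e) ^ (CARD('n) - card F - k) * gs ^ k)"
proof -
  have J: "homog (idl.span (F \<union> G))" using F(2) G by (intro homog_span_forms) blast
  have eq: "HS (idl.span (ext ` F \<union> ext ` G)) = HS (idl.span (F \<union> G))"
    by (metis HS_ext[OF J] idl_span_ext image_Un)
  have c: "card (ext ` F) = card F"
    using card_image[OF inj_on_subset[OF inj_ext subset_UNIV]] .
  have "fle (HS (idl.span (ext ` F \<union> ext ` G)))
      (fps_of_poly (geosum e) ^ (CARD('n) - card (ext ` F) - k) * gs ^ k)"
    using F G HS le eq c
    by (intro upper_bound_infinite[OF infinite_UNIV_alg_closed e _ _ independent_ext])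
      (auto simp: ext_forms subset_iff)
  then show ?thesis by (simp only: eq c)
qed

section \<open>Translation to the ring structures of HOL-Algebra\<close>

lemma polyring_simps [simp]:
  "carrier polyring = UNIV" "x \<otimes>\<^bsub>polyring\<^esub> y = x * y" "x \<oplus>\<^bsub>polyring\<^esub> y = x + y"
  "\<one>\<^bsub>polyring\<^esub> = 1" "\<zero>\<^bsub>polyring\<^esub> = 0"
  by (simp_all add: polyring_def ring_of_type_algebra_def)

lemma cring_polyring: "cring polyring"
  unfolding polyring_def by (rule cring_from_type_algebra)

lemma ring_polyring: "ring polyring"
  using cring_polyring by (rule cring.axioms)

lemma a_inv_polyring [simp]: "\<ominus>\<^bsub>polyring\<^esub> x = - x"
proof -
  interpret cring polyring by (rule cring_polyring)
  show ?thesis by (rule minus_equality) simp_all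
qed

lemma ideal_polyring_iff: "ideal J polyring \<longleftrightarrow> idl.subspace J"
proof
  assume J: "ideal J polyring"
  show "idl.subspace J"
  proof (rule idl.subspaceI)
    show "0 \<in> J" using additive_subgroup.zero_closed[OF ideal.axioms(1)[OF J]] by simp
    show "x + y \<in> J" if "x \<in> J" "y \<in> J" for x y
      using additive_subgroup.a_closed[OF ideal.axioms(1)[OF J] that] by simp
    show "c * x \<in> J" if "x \<in> J" for c x
      using ideal.I_l_closed[OF J that, of c] by simp
  qed
next
  assume J: "idl.subspace J"
  interpret cring polyring by (rule cring_polyring)
  show "ideal J polyring"
  proof (rule idealI[OF ring_polyring])
    show "subgroup J (add_monoid polyring)"
    proof (rule add.subgroupI)
      show "J \<noteq> {}" using idl.subspace_0[OF J] by blast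
    qed (use J in \<open>auto simp: idl.subspace_neg idl.subspace_add\<close>)
    show "x \<otimes>\<^bsub>polyring\<^esub> a \<in> J" "a \<otimes>\<^bsub>polyring\<^esub> x \<in> J" if "a \<in> J" for a x
      using idl.subspace_scale[OF J that, of x] by (simp_all add: mult.commute)
  qed
qed

lemma Idl_polyring: "Idl\<^bsub>polyring\<^esub> G = idl.span G"
  unfolding genideal_def ideal_polyring_iff
  using idl.span_minimal[of G] idl.span_superset[of G] idl.subspace_span[of G] by blast

lemma primeideal_polyring_iff: "primeideal P polyring \<longleftrightarrow> prm P"
proof
  assume P: "primeideal P polyring"
  then have "idl.subspace P" using primeideal.axioms(1) ideal_polyring_iff by blast
  then show "prm P"
    using primeideal.I_prime[OF P] primeideal.I_notcarr[OF P] unfolding prm_def by auto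
next
  assume P: "prm P"
  show "primeideal P polyring"
    by (rule primeidealI[OF _ cring_polyring])
      (use prmD(1,2)[OF P] prmD(3)[OF P] in \<open>auto simp: ideal_polyring_iff\<close>)
qed

lemma prime_chain_polyring_iff: "prime_chain polyring n C \<longleftrightarrow> pchain n C"
  by (simp add: prime_chain_def pchain_def primeideal_polyring_iff)

lemma colon_ideal_polyring: "colon_ideal polyring I {f} = colon I f"
  by (auto simp: colon_ideal_def colon_def)

lemma assoc_primes_polyring_iff: "P \<in> assoc_primes polyring I \<longleftrightarrow> prm P \<and> (\<exists>f. P = colon I f)"
  by (simp add: assoc_primes_def primeideal_polyring_iff colon_ideal_polyring)

lemma Sup_enat_set_eq:
  assumes "P k" "\<And>n. P n \<Longrightarrow> n \<le> k"
  shows "Sup {enat n |n. P n} = enat k"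
  by (rule antisym) (use assms in \<open>auto intro!: Sup_least Sup_upper\<close>)

lemma prime_height_linear:
  assumes "L \<subseteq> forms 1"
  shows "prime_height polyring (idl.span L) = enat (vs.dim L)"
  unfolding prime_height_def prime_chain_polyring_iff
  using linear_chain_below[OF assms] chain_length_below_linear[OF assms]
  by (intro Sup_enat_set_eq) blast+

lemma prime_height_mono:
  assumes "P \<subseteq> Q" "prm Q"
  shows "prime_height polyring P \<le> prime_height polyring Q"
  unfolding prime_height_def prime_chain_polyring_iff
proof (rule Sup_mono)
  fix a assume "a \<in> {enat n |n. \<exists>C. pchain n C \<and> C n = P}"
  then obtain n C where C: "a = enat n" "pchain n C" "C n = P" by blast
  \<comment> \<open>Enlarging the last prime of the chain preserves the strict inclusions.\<close>
  define D where "D = (\<lambda>i. if i = n then Q else C i)"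
  have "pchain n D" using C assms by (auto simp: pchain_def D_def)
  moreover have "D n = Q" by (simp add: D_def)
  ultimately show "\<exists>b\<in>{enat n |n. \<exists>C. pchain n C \<and> C n = Q}. a \<le> b" using C(1) by blast
qed

section \<open>The residue class ring\<close>

lemma residue_class_eq_iff:
  assumes J: "idl.subspace J"
  shows "residue_class J x = residue_class J y \<longleftrightarrow> x - y \<in> J"
proof -
  have r: "residue_class J x = (\<lambda>h. h + x) ` J" for x
    by (auto simp: residue_class_def a_r_coset_def')
  show ?thesis
  proof
    assume "residue_class J x = residue_class J y"
    moreover have "x \<in> residue_class J x"
      unfolding r using idl.subspace_0[OF J] by (metis add_0 image_eqI)
    ultimately show "x - y \<in> J" unfolding r by auto
  next
    assume *: "x - y \<in> J"
    have "h + x \<in> (\<lambda>h. h + y) ` J" if "h \<in> J" for h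
      using idl.subspace_add[OF J that *] by (intro image_eqI[of _ _ "h + (x - y)"]) auto
    moreover have "h + y \<in> (\<lambda>h. h + x) ` J" if "h \<in> J" for h
      using idl.subspace_diff[OF J that *] by (intro image_eqI[of _ _ "h - (x - y)"]) auto
    ultimately show "residue_class J x = residue_class J y" unfolding r by blast
  qed
qed

lemma residue_class_hom:
  assumes J: "idl.subspace J"
  shows "ring_hom_ring polyring (polyring Quot J) (residue_class J)"
proof -
  have "residue_class J = (+>\<^bsub>polyring\<^esub>) J" by (rule ext) (simp add: residue_class_def)
  then show ?thesis
    using ideal.rcos_ring_hom_ring[of J polyring] J ideal_polyring_iff by metis
qed

lemma Quot_simps:
  assumes J: "idl.subspace J"
  shows "residue_class J x \<otimes>\<^bsub>polyring Quot J\<^esub> residue_class J y = residue_class J (x * y)"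
    and "residue_class J x \<oplus>\<^bsub>polyring Quot J\<^esub> residue_class J y = residue_class J (x + y)"
    and "\<one>\<^bsub>polyring Quot J\<^esub> = residue_class J 1"
    and "\<zero>\<^bsub>polyring Quot J\<^esub> = residue_class J 0"
    and "carrier (polyring Quot J) = Set.range (residue_class J)"
proof -
  interpret h: ring_hom_ring polyring "polyring Quot J" "residue_class J"
    by (rule residue_class_hom[OF J])
  show "residue_class J x \<otimes>\<^bsub>polyring Quot J\<^esub> residue_class J y = residue_class J (x * y)"
    using h.hom_mult[of x y] by simp
  show "residue_class J x \<oplus>\<^bsub>polyring Quot J\<^esub> residue_class J y = residue_class J (x + y)"
    using h.hom_add[of x y] by simp
  show "\<one>\<^bsub>polyring Quot J\<^esub> = residue_class J 1" using h.hom_one by simp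
  show "\<zero>\<^bsub>polyring Quot J\<^esub> = residue_class J 0" using h.hom_zero by simp
  show "carrier (polyring Quot J) = Set.range (residue_class J)"
    by (auto simp: FactRing_def A_RCOSETS_def RCOSETS_def a_r_coset_def residue_class_def)
qed

lemma ring_Quot: "idl.subspace J \<Longrightarrow> ring (polyring Quot J)"
  using ideal.quotient_is_ring ideal_polyring_iff by blast

lemma cring_Quot: "idl.subspace J \<Longrightarrow> cring (polyring Quot J)"
  using ideal.quotient_is_cring[OF _ cring_polyring] ideal_polyring_iff by blast

lemma prime_chain_Quot_imp:
  assumes J: "idl.subspace J" and C: "prime_chain (polyring Quot J) n C"
  shows "\<exists>D. pchain n D \<and> J \<subseteq> D 0"
proof -
  interpret h: ring_hom_ring polyring "polyring Quot J" "residue_class J"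
    by (rule residue_class_hom[OF J])
  define D where "D i = {r. residue_class J r \<in> C i}" for i
  have pr: "primeideal (C i) (polyring Quot J)" if "i \<le> n" for i
    using C that by (simp add: prime_chain_def)
  have "prm (D i)" if "i \<le> n" for i
    using h.primeideal_vimage[OF cring_polyring pr[OF that]]
    by (simp add: D_def primeideal_polyring_iff)
  moreover have "D i \<subset> D (Suc i)" if "i < n" for i
  proof -
    have lt: "C i \<subset> C (Suc i)" using C that by (simp add: prime_chain_def)
    then obtain c where c: "c \<in> C (Suc i)" "c \<notin> C i" by blast
    have "c \<in> carrier (polyring Quot J)"
      using ideal.Icarr[OF primeideal.axioms(1)[OF pr[of "Suc i"]] c(1)] that by simp
    then obtain x where "c = residue_class J x" unfolding Quot_simps(5)[OF J] by blast
    then show ?thesis using lt c by (auto simp: D_def)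
  qed
  moreover have "J \<subseteq> D 0"
  proof
    fix x assume "x \<in> J"
    then have "residue_class J x = \<zero>\<^bsub>polyring Quot J\<^esub>"
      unfolding Quot_simps(4)[OF J] residue_class_eq_iff[OF J] by simp
    then show "x \<in> D 0"
      using additive_subgroup.zero_closed[OF ideal.axioms(1)[OF primeideal.axioms(1)[OF pr[of 0]]]]
      by (simp add: D_def)
  qed
  ultimately show ?thesis unfolding pchain_def by blast
qed

lemma pchain_imp_prime_chain_Quot:
  assumes J: "idl.subspace J" and D: "pchain n D" "J \<subseteq> D 0"
  shows "prime_chain (polyring Quot J) n (\<lambda>i. residue_class J ` D i)"
proof -
  have JD: "J \<subseteq> D i" if "i \<le> n" for i
    using that
  proof (induction i)
    case (Suc i)
    then have "D i \<subset> D (Suc i)" using D(1) by (simp add: pchain_def)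
    then show ?case using Suc by auto
  qed (use D in simp)
  \<comment> \<open>Since \<open>D i\<close> contains \<open>J\<close>, membership of a class is
    membership of any representative. Primality and strictness of the images follow from
    this.\<close>
  have mem: "residue_class J x \<in> residue_class J ` D i \<longleftrightarrow> x \<in> D i" if "i \<le> n" for x i
  proof
    have Ds: "idl.subspace (D i)" using D(1) that prmD(1) by (auto simp: pchain_def)
    assume "residue_class J x \<in> residue_class J ` D i"
    then obtain y where "y \<in> D i" "x - y \<in> J" using residue_class_eq_iff[OF J] by blast
    then show "x \<in> D i" using idl.subspace_add[OF Ds, of "x - y" y] JD[OF that] by auto
  qed simp
  have "primeideal (residue_class J ` D i) (polyring Quot J)" if i: "i \<le> n" for i
  proof (rule primeidealI[OF _ cring_Quot[OF J]])
    have P: "prm (D i)" using D(1) i by (simp add: pchain_def)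
    have "residue_class J = (+>\<^bsub>polyring\<^esub>) J" by (rule HOL.ext) (simp add: residue_class_def)
    then show "ideal (residue_class J ` D i) (polyring Quot J)"
      using ring.ring_ideal_imp_quot_ideal[OF ring_polyring] J prmD(1)[OF P] ideal_polyring_iff
        by metis
    have "1 \<notin> D i" using P proper_iff prmD by blast
    then have "residue_class J 1 \<notin> residue_class J ` D i" using mem[OF i] by simp
    then show "carrier (polyring Quot J) \<noteq> residue_class J ` D i"
      unfolding Quot_simps(5)[OF J] by blast
    fix a b assume "a \<in> carrier (polyring Quot J)" "b \<in> carrier (polyring Quot J)"
      and ab: "a \<otimes>\<^bsub>polyring Quot J\<^esub> b \<in> residue_class J ` D i"
    then obtain x y where xy: "a = residue_class J x" "b = residue_class J y"
      unfolding Quot_simps(5)[OF J] by blast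
    then have "x * y \<in> D i" using ab mem[OF i] by (simp add: Quot_simps(1)[OF J])
    then show "a \<in> residue_class J ` D i \<or> b \<in> residue_class J ` D i"
      using prmD(3)[OF P] xy by blast
  qed
  moreover have "residue_class J ` D i \<subset> residue_class J ` D (Suc i)" if "i < n" for i
  proof -
    have lt: "D i \<subset> D (Suc i)" using D(1) that by (simp add: pchain_def)
    then obtain x where "x \<in> D (Suc i)" "x \<notin> D i" by blast
    then have "residue_class J x \<in> residue_class J ` D (Suc i)"
      "residue_class J x \<notin> residue_class J ` D i"
      using mem[of i x] that by auto
    then show ?thesis using lt by blast
  qed
  ultimately show ?thesis by (simp add: prime_chain_def)
qed

lemma krull_dim_Quot:
  assumes J: "idl.subspace J" and "pchain k C" "J \<subseteq> C 0"
    and "\<And>n D. pchain n D \<Longrightarrow> J \<subseteq> D 0 \<Longrightarrow> n \<le> k"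
  shows "krull_dim (polyring Quot J) = enat k"
  unfolding krull_dim_def
proof (rule Sup_enat_set_eq)
  show "\<exists>C. prime_chain (polyring Quot J) k C"
    using pchain_imp_prime_chain_Quot[OF J assms(2,3)] by blast
  show "n \<le> k" if "\<exists>C. prime_chain (polyring Quot J) n C" for n
    using that prime_chain_Quot_imp[OF J] assms(4) by blast
qed

lemma subfield_scalars:
  assumes J: "idl.subspace J" "J \<noteq> UNIV"
  shows "subfield (scalars J) (polyring Quot J)"
proof -
  let ?K = "Set.range (single 0) :: ('a::finite, 'b::field) mpoly set"
  interpret R: cring "polyring :: ('a, 'b) mpoly ring" by (rule cring_polyring)
  have 1: "(1 :: ('a, 'b) mpoly) = single 0 1" by simp
  have "subring ?K polyring"
  proof (rule R.subringI)
    show "\<one>\<^bsub>polyring\<^esub> \<in> ?K" using 1 by (metis polyring_simps(4) rangeI)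
    show "\<ominus>\<^bsub>polyring\<^esub> h \<in> ?K" if "h \<in> ?K" for h
      using that by (auto simp flip: single_uminus)
    show "h1 \<otimes>\<^bsub>polyring\<^esub> h2 \<in> ?K" "h1 \<oplus>\<^bsub>polyring\<^esub> h2 \<in> ?K" if "h1 \<in> ?K" "h2 \<in> ?K" for h1 h2
      using that by (auto simp: mult_single simp flip: single_add)
  qed simp
  then have "subcring ?K polyring" by (rule R.subcringI')
  moreover have "Units (polyring \<lparr> carrier := ?K \<rparr>) = ?K - {\<zero>\<^bsub>polyring\<^esub>}"
  proof -
    have "\<exists>x\<in>?K. x * single 0 c = 1 \<and> single 0 c * x = 1" if "c \<noteq> 0" for c
      using that by (intro bexI[of _ "single 0 (1 / c)"]) (simp_all add: mult_single)
    moreover have "c \<noteq> 0" if "(x :: ('a, 'b) mpoly) * single 0 c = 1" for c x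
      using that by auto
    moreover have "single 0 c = (0 :: ('a, 'b) mpoly) \<longleftrightarrow> c = 0" for c
      by (metis single_zero lookup_single_eq lookup_zero)
    ultimately show ?thesis unfolding Units_def by auto
  qed
  ultimately have K: "subfield ?K polyring" by (rule R.subfieldI)
  interpret h: ring_hom_ring polyring "polyring Quot J" "residue_class J"
    by (rule residue_class_hom[OF J(1)])
  \<comment> \<open>Properness of \<open>J\<close> makes 1 and 0 different in the quotient, so the
    image of the field K is again a field.\<close>
  have "1 \<notin> J" using J proper_iff by blast
  then have "\<one>\<^bsub>polyring Quot J\<^esub> \<noteq> \<zero>\<^bsub>polyring Quot J\<^esub>"
    unfolding Quot_simps[OF J(1)] residue_class_eq_iff[OF J(1)] by simp
  then have "subfield (residue_class J ` ?K) (polyring Quot J)"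
    using h.img_is_subfield(2)[OF K] by blast
  moreover have "residue_class J ` ?K = scalars J" by (auto simp: scalars_def)
  ultimately show ?thesis by simp
qed

lemma Span_residue_classes:
  assumes J: "idl.subspace J"
  shows "ring.Span (polyring Quot J) (scalars J) (map (residue_class J) us) =
    residue_class J ` vs.span (set us)"
proof (induction us)
  case Nil
  then show ?case using ring.Span.simps[OF ring_Quot[OF J]] by (simp add: Quot_simps(4)[OF J])
next
  case (Cons u us)
  have "ring.Span (polyring Quot J) (scalars J) (map (residue_class J) (u # us)) =
    ring.line_extension (polyring Quot J) (scalars J) (residue_class J u) (residue_class J `
      vs.span (set us))"
    using Cons by (simp add: ring.Span.simps[OF ring_Quot[OF J]])
  also have "\<dots> = residue_class J ` vs.span (set (u # us))"
  proof (intro equalityI subsetI)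
    fix x assume "x \<in> ring.line_extension (polyring Quot J) (scalars J) (residue_class J u)
      (residue_class J ` vs.span (set us))"
    then obtain c v where "v \<in> vs.span (set us)"
      "x = residue_class J (single 0 c) \<otimes>\<^bsub>polyring Quot J\<^esub> residue_class J u
        \<oplus>\<^bsub>polyring Quot J\<^esub> residue_class J v"
      unfolding ring.line_extension_mem_iff[OF ring_Quot[OF J]] scalars_def by blast
    then have "x = residue_class J (smul c u + v)" "smul c u + v \<in> vs.span (insert u (set us))"
      by (auto simp: Quot_simps[OF J] smul_def[symmetric] vs.span_breakdown_eq intro: exI[of _ c])
    then show "x \<in> residue_class J ` vs.span (set (u # us))" by simp
  next
    fix x assume "x \<in> residue_class J ` vs.span (set (u # us))"
    then obtain w c where w: "x = residue_class J w" "w - smul c u \<in> vs.span (set us)"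
      by (auto simp: vs.span_breakdown_eq)
    have "x = residue_class J (single 0 c) \<otimes>\<^bsub>polyring Quot J\<^esub> residue_class J u
        \<oplus>\<^bsub>polyring Quot J\<^esub> residue_class J (w - smul c u)"
      by (simp add: Quot_simps[OF J] smul_def[symmetric] w(1))
    then show "x \<in> ring.line_extension (polyring Quot J) (scalars J) (residue_class J u)
      (residue_class J ` vs.span (set us))"
      unfolding ring.line_extension_mem_iff[OF ring_Quot[OF J]] scalars_def using w(2) by blast
  qed
  finally show ?case .
qed

text \<open>Independence modulo \<open>J\<close> lifts to the polynomials themselves. Distinctness
  makes the length \<open>r\<close> of the list the cardinality of \<open>F\<close>.\<close>

lemma independent_residue_classes_imp:
  assumes J: "idl.subspace J"
    and "ring.independent (polyring Quot J) (scalars J) (map (residue_class J) us)"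
  shows "vs.independent (set us) \<and> distinct us"
  using assms(2)
proof (induction us)
  case (Cons u us)
  have ind: "ring.independent (polyring Quot J) (scalars J) (map (residue_class J) us)"
    and notin: "residue_class J u \<notin> ring.Span (polyring Quot J) (scalars J) (map (residue_class
      J) us)"
    using Cons.prems ring.independent_backwards[OF ring_Quot[OF J]] by force+
  have "u \<notin> vs.span (set us)" using notin unfolding Span_residue_classes[OF J] by blast
  then show ?case using Cons.IH[OF ind] vs.independent_insertI vs.span_base by auto
qed (simp add: vs.independent_empty)

text \<open>Extend a basis of \<open>J \<inter> V\<close> to one of \<open>V\<close>: the classes of
  the added vectors form a basis of the image of \<open>V\<close>.\<close>

lemma dim_residue_classes:
  assumes J: "idl.subspace J" "J \<noteq> UNIV" and V: "vs.subspace V" "V \<subseteq> forms_upto d"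
  shows "int (ring.dim (polyring Quot J) (scalars J) (residue_class J ` V)) = cod V J"
proof -
  have JV: "J \<inter> V \<subseteq> vs.span (monomials d)" using upto_fd[OF order_refl, of "J \<inter> V"] V by blast
  obtain B0 where B0: "B0 \<subseteq> J \<inter> V" "J \<inter> V \<subseteq> vs.span B0" "vs.independent B0" "card B0 =
    vs.dim (J \<inter> V)"
    using vs.fd_basis[OF finite_monomials JV] by metis
  have "B0 \<subseteq> V" using B0(1) by blast
  then obtain B where B: "B0 \<subseteq> B" "B \<subseteq> V" "vs.independent B" "V \<subseteq> vs.span B"
    using vs.maximal_independent_subset_extend[OF _ B0(3)] by metis
  have fin: "finite B"
    using vs.independent_finite_dim[OF finite_monomials upto_fd[OF order_refl V(2)] B(2,3)] .
  have cardB: "card B = vs.dim V" using vs.basis_card_eq_dim[OF B(2,4,3)] .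
  obtain us where us: "set us = B - B0" "distinct us" using finite_distinct_list[of "B - B0"]
    fin by blast
  have "ring.independent (polyring Quot J) (scalars J) (map (residue_class J) ws)"
    if "set ws \<subseteq> B - B0" "distinct ws" for ws
    using that
  proof (induction ws)
    case Nil
    then show ?case by (simp add: ring.independent.li_Nil[OF ring_Quot[OF J(1)]])
  next
    case (Cons w ws)
    have "residue_class J w \<notin> residue_class J ` vs.span (set ws)"
    proof
      assume "residue_class J w \<in> residue_class J ` vs.span (set ws)"
      then obtain v where v: "v \<in> vs.span (set ws)" "w - v \<in> J"
        using residue_class_eq_iff[OF J(1)] by blast
      have wsV: "set ws \<subseteq> V" and wV: "w \<in> V" using Cons.prems B(2) by auto
      have "v \<in> V" using v(1) vs.span_minimal[OF wsV V(1)] by blast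
      then have "w - v \<in> J \<inter> V" using v(2) vs.subspace_diff[OF V(1) wV] by blast
      then have "w - v \<in> vs.span (B0 \<union> set ws)"
        using B0(2) vs.span_mono[of B0 "B0 \<union> set ws"] by blast
      moreover have "v \<in> vs.span (B0 \<union> set ws)" using v(1) vs.span_mono[of "set ws"
        "B0 \<union> set ws"] by blast
      ultimately have "w \<in> vs.span (B0 \<union> set ws)" using vs.span_add[of "w - v" _ v] by fastforce
      moreover have "B0 \<union> set ws \<subseteq> B - {w}" using Cons.prems B(1) by auto
      ultimately have "w \<in> vs.span (B - {w})" using vs.span_mono by blast
      moreover have "w \<in> B" using Cons.prems by auto
      ultimately show False using B(3) unfolding vs.dependent_def by blast
    qed
    then show ?case
      using Cons by (simp add: ring.independent.li_Cons[OF ring_Quot[OF J(1)]]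
        Span_residue_classes[OF J(1)]
          Quot_simps(5)[OF J(1)])
  qed
  then have "ring.independent (polyring Quot J) (scalars J) (map (residue_class J) us)" using us
    by blast
  then have "ring.dimension (polyring Quot J) (length us) (scalars J) (residue_class J ` vs.span
    (set us))"
    using ring.dimension_independent[OF ring_Quot[OF J(1)]] Span_residue_classes[OF J(1), of us]
      by fastforce
  moreover have "residue_class J ` vs.span (set us) = residue_class J ` V"
  proof
    have "vs.span (set us) \<subseteq> V" using us(1) B(2) by (intro vs.span_minimal V(1)) blast
    then show "residue_class J ` vs.span (set us) \<subseteq> residue_class J ` V" by blast
    show "residue_class J ` V \<subseteq> residue_class J ` vs.span (set us)"
    proof
      fix x assume "x \<in> residue_class J ` V"
      then obtain v where v: "v \<in> V" "x = residue_class J v" by blast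
      have "B = B0 \<union> set us" using us(1) B(1) by blast
      then have "v \<in> vs.span (B0 \<union> set us)" using v(1) B(4) by auto
      then obtain a b where ab: "v = a + b" "a \<in> vs.span B0" "b \<in> vs.span (set us)"
        unfolding vs.span_Un by blast
      have "B0 \<subseteq> J" using B0(1) by blast
      then have "a \<in> J" using ab(2) vs.span_minimal[of B0 J] J(1) by auto
      then have "x = residue_class J b" using ab(1) v(2) residue_class_eq_iff[OF J(1)] by simp
      then show "x \<in> residue_class J ` vs.span (set us)" using ab(3) by blast
    qed
  qed
  ultimately have "ring.dim (polyring Quot J) (scalars J) (residue_class J ` V) = length us"
    using ring.dimI[OF ring_Quot[OF J(1)] subfield_scalars[OF J]] by (simp add: over_def)
  moreover have "length us = card (B - B0)" using us distinct_card by metis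
  moreover have "card (B - B0) = card B - card B0" "card B0 \<le> card B"
    using B(1) fin by (simp_all add: card_Diff_subset finite_subset card_mono)
  ultimately show ?thesis using cardB B0(4) by (simp add: cod_def)
qed

lemma hilbert_function_eq:
  assumes "idl.subspace J" "J \<noteq> UNIV"
  shows "int (hilbert_function J d) = HF J d"
  unfolding hilbert_function_def
  using dim_residue_classes[OF assms vs_subspace_forms forms_subset_upto] .

text \<open>For positive \<open>k\<close> the factorial in the degree cancels that of the limit. For
  \<open>k = 0\<close> the series is the polynomial \<open>N\<close>, and the length of the quotient
  is the sum of its coefficients.\<close>

lemma quot_degree_eq:
  assumes J: "homog J" "J \<noteq> UNIV" and k: "krull_dim (polyring Quot J) = enat k"
    and HS: "HS J = fps_of_poly N * gs ^ k"
  shows "quot_degree J = real_of_int (poly N 1)"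
proof (cases k)
  case 0
  note sub = homogD(1)[OF J(1)]
  let ?D = "Polynomial.degree N"
  have HF: "HF J d = coeff N d" for d
    using HS 0 by (metis HS_nth fps_of_poly_nth mult.right_neutral power_0)
  have "carrier (polyring Quot J) = residue_class J ` forms_upto ?D"
  proof
    show "carrier (polyring Quot J) \<subseteq> residue_class J ` forms_upto ?D"
    proof
      fix x assume "x \<in> carrier (polyring Quot J)"
      then obtain f where f: "x = residue_class J f" unfolding Quot_simps(5)[OF sub] by blast
      obtain M where "f \<in> forms_upto M" using ex_upto by blast
      then have "f \<in> forms_upto (?D + M)" using upto_mono[of M "?D + M"] by auto
      then have sum: "f = (\<Sum>d\<le>?D + M. hcomp d f)" by (rule sum_hcomp)
      define g where "g = (\<Sum>d\<le>?D. hcomp d f)"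
      have "f - g = (\<Sum>d\<in>{..?D + M} - {..?D}. hcomp d f)"
        by (subst sum) (simp add: g_def sum_diff)
      also have "\<dots> \<in> J"
      proof (rule idl.subspace_sum[OF sub])
        fix d assume "d \<in> {..?D + M} - {..?D}"
        then have "HF J d = HF UNIV d" using HF by (simp add: coeff_eq_0)
        then have "J \<inter> forms d = UNIV \<inter> forms d"
          using sub by (intro cod_eq_imp[OF forms_subset_upto]) simp_all
        then show "hcomp d f \<in> J" using hcomp_in_forms by blast
      qed
      finally have "x = residue_class J g" using f residue_class_eq_iff[OF sub] by simp
      moreover have "g \<in> forms_upto ?D"
        unfolding g_def
      proof (rule vs.subspace_sum[OF vs_subspace_upto])
        fix d assume "d \<in> {..?D}"
        then have "hcomp d f \<in> forms_upto d" "d \<le> ?D"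
          using forms_subset_upto[of d] hcomp_in_forms[of d f] by auto
        then show "hcomp d f \<in> forms_upto ?D" using upto_mono[of d ?D] by blast
      qed
      ultimately show "x \<in> residue_class J ` forms_upto ?D" by blast
    qed
    show "residue_class J ` forms_upto ?D \<subseteq> carrier (polyring Quot J)"
      unfolding Quot_simps(5)[OF sub] by blast
  qed
  then have "int (ring.dim (polyring Quot J) (scalars J) (carrier (polyring Quot J))) = HFa J ?D"
    using dim_residue_classes[OF sub J(2) vs_subspace_upto order_refl] by simp
  also have "\<dots> = poly N 1" by (simp add: HFa_sum[OF J(1)] HF poly_altdef)
  finally show ?thesis using k 0 by (simp add: quot_degree_def)
next
  case (Suc j)
  have "real (hilbert_function J d) = real_of_int (fps_nth (fps_of_poly N * gs ^ Suc j) d)" for d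
    using hilbert_function_eq[OF homogD(1)[OF J(1)] J(2), of d] HS[unfolded Suc]
    by (metis HS_nth of_int_of_nat_eq)
  then have "(\<lambda>d. real (hilbert_function J d) / real d ^ j) \<longlonglongrightarrow> real_of_int (poly N 1) / fact j"
    using rational_fps_limit[of N j] by simp
  then have "lim (\<lambda>d. real (hilbert_function J d) / real d ^ j) = real_of_int (poly N 1) / fact j"
    by (rule limI)
  then show ?thesis using k Suc by (simp add: quot_degree_def)
qed

section \<open>Ideals with linear associated primes\<close>

lemma fps_geosum_nonneg: "fle 0 (fps_of_poly (geosum e))"
  by (auto simp: fle_def geosum_def coeff_sum intro!: sum_nonneg)

text \<open>Cohen-Macaulayness is not needed here: the generators need not be known to form a regular
  sequence for the coefficientwise inequality \<open>HS_span_list_ge\<close>.\<close>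

lemma complete_intersection_lower_bound:
  fixes I :: "('n::finite, 'k::field) mpoly set"
  assumes I: "I = idl.span (set bs)" and bs: "set bs \<subseteq> forms e" and e: "e \<ge> 1"
    and HS: "HS I = fps_of_poly N * gs ^ k"
    and k: "k + length bs = CARD('n)"
  shows "int e ^ length bs \<le> poly N 1"
proof -
  let ?h = "length bs" and ?s = "CARD('n)"
  have "fle (gs ^ ?s) (HS I * geo e ^ ?h)"
    using HS_span_list_ge[OF homog_zero bs e] by (simp add: HS_zero idl_span_insert_0 I)
  \<comment> \<open>This factor turns \<open>geo e ^ ?h\<close> into \<open>gs ^ ?h\<close>. Both
    sides then are a polynomial times \<open>gs ^ ?s\<close>, and the values at 1 can be
    compared.\<close>
  then have "fle (gs ^ ?s * fps_of_poly (geosum e) ^ ?h) (HS I * geo e ^ ?h *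
    fps_of_poly (geosum e) ^ ?h)"
    by (rule fle_mult_right[OF _ fle_power_nonneg[OF fps_geosum_nonneg]])
  also have "gs ^ ?s * fps_of_poly (geosum e) ^ ?h = fps_of_poly (geosum e ^ ?h) * gs ^ ?s"
    by (simp add: fps_of_poly_power mult.commute)
  also have "HS I * geo e ^ ?h * fps_of_poly (geosum e) ^ ?h =
      HS I * ((1 - fps_X ^ e) * geo e) ^ ?h * gs ^ ?h"
    unfolding fps_geosum by (simp add: power_mult_distrib ac_simps)
  also have "\<dots> = fps_of_poly N * gs ^ ?s"
    using geo_inverse[OF e] k by (simp add: HS power_add mult.assoc flip: k)
  finally have "poly (geosum e ^ ?h) 1 \<le> poly N 1" by (rule rational_fps_le)
  then show ?thesis by (simp add: geosum_eval poly_power)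
qed

text \<open>A system with the fewest elements is irredundant. Since
  \<open>minimally_generated_in_degree\<close> quantifies over all minimal systems, one must exist
  for it to yield generators of degree \<open>e\<close>.\<close>

lemma ex_minimal_homogeneous_generators:
  assumes "graded_ideal I"
  shows "\<exists>G. finite G \<and> minimal_homogeneous_generators I G"
proof -
  obtain G0 where G0: "G0 \<subseteq> (\<Union>d. forms d)" "I = idl.span G0"
    using assms unfolding graded_ideal_def Idl_polyring by blast
  obtain G1 where G1: "G1 \<subseteq> G0" "finite G1" "idl.span G1 = I"
    using finite_ideal_generators[of G0] G0(2) by blast
  define P where "P G \<longleftrightarrow> finite G \<and> G \<subseteq> (\<Union>d. forms d) \<and> idl.span G = I" for G
  have "P G1" using G0 G1 by (auto simp: P_def)
  then obtain G where G: "P G" "\<And>G'. P G' \<Longrightarrow> card G \<le> card G'"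
    using ex_has_least_nat[of P G1 card] by blast
  have "idl.span (G - {g}) \<noteq> I" if "g \<in> G" for g
  proof -
    have "card (G - {g}) < card G" using G(1) that by (intro psubset_card_mono) (auto simp: P_def)
    then have "\<not> P (G - {g})" using G(2)[of "G - {g}"] by linarith
    then show ?thesis using G(1) by (auto simp: P_def)
  qed
  then show ?thesis
    using G(1) unfolding minimal_homogeneous_generators_def Idl_polyring P_def by blast
qed

text \<open>The generators in \<open>G0\<close> need not be homogeneous. As the ideal vanishes below degree \<open>e\<close>,
  only the
  constant terms of the coefficients contribute in degree \<open>e\<close>.\<close>

lemma span_hcomp_generators:
  assumes G: "G \<subseteq> forms e" and eq: "idl.span G = idl.span G0"
  shows "idl.span (hcomp e ` G0) = idl.span G0"
proof
  have hI: "homog (idl.span G0)" unfolding eq[symmetric] using G by (intro homog_span_forms) blast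
  show "idl.span (hcomp e ` G0) \<subseteq> idl.span G0"
    by (intro idl.span_minimal) (auto intro: homogD(2)[OF hI] idl.span_base)
  have low: "hcomp d f = 0" if "f \<in> idl.span G0" "d < e" for d f
  proof -
    have "idl.subspace {f. \<forall>d<e. hcomp d f = 0}"
      by (intro idl.subspaceI) (auto simp: hcomp_add hcomp_mult)
    moreover have "G \<subseteq> {f. \<forall>d<e. hcomp d f = 0}" using G by (auto simp: hcomp_form)
    ultimately have "idl.span G \<subseteq> {f. \<forall>d<e. hcomp d f = 0}" by (rule idl.span_minimal[rotated])
    then show ?thesis using that eq by blast
  qed
  \<comment> \<open>Membership in the ideal belongs to \<open>?S\<close> because closure under
    multiplication uses that the components of \<open>f\<close> below degree \<open>e\<close>
    vanish.\<close>
  let ?S = "{f \<in> idl.span G0. hcomp e f \<in> idl.span (hcomp e ` G0)}"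
  have "idl.subspace ?S"
  proof (rule idl.subspaceI)
    fix a f assume f: "f \<in> ?S"
    have "hcomp e (a * f) = (\<Sum>i\<le>e. if i = 0 then hcomp 0 a * hcomp e f else 0)"
      unfolding hcomp_mult by (rule sum.cong) (use f low[of f] in auto)
    also have "\<dots> = hcomp 0 a * hcomp e f" by (simp add: sum.delta)
    finally show "a * f \<in> ?S" using f by (auto intro: idl.span_scale)
  qed (auto simp: hcomp_add idl.span_zero intro: idl.span_add)
  then have "idl.span G0 \<subseteq> ?S" by (intro idl.span_minimal) (auto intro: idl.span_base)
  then have "hcomp e g \<in> idl.span (hcomp e ` G0)" if "g \<in> G" for g
    using that eq idl.span_base[of g G] by auto
  moreover have "hcomp e g = g" if "g \<in> G" for g using that G hcomp_form[of g e e] by auto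
  ultimately have "G \<subseteq> idl.span (hcomp e ` G0)" by (metis subsetI)
  then show "idl.span G0 \<subseteq> idl.span (hcomp e ` G0)"
    unfolding eq[symmetric] by (intro idl.span_minimal) simp_all
qed

text \<open>All associated primes have the height of a linear one, and every prime over
  \<open>I\<close> contains an associated prime, so this is the height of \<open>I\<close>. In
  particular it is finite, and \<open>the_enat\<close> in \<open>ht\<close> loses nothing.\<close>

lemma unmixed_linear_height:
  fixes I :: "('n::finite, 'k::field) mpoly set"
  assumes I: "unmixed polyring I"
    and lin: "\<forall>P\<in>assoc_primes polyring I. generated_by_linear_forms P"
  shows "\<And>P. P \<in> assoc_primes polyring I \<Longrightarrow>
      \<exists>L\<subseteq>forms 1. P = idl.span L \<and> vs.dim L = ht I"
    and "ideal_height polyring I = enat (ht I)"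
    and "assoc_primes polyring I \<noteq> {}"
proof -
  have sub: "idl.subspace I" and proper: "I \<noteq> UNIV"
    using I by (auto simp: unmixed_def ideal_polyring_iff)
  obtain P0 f where P0: "prm P0" "P0 = colon I f"
    using ex_assoc_prime_above_colon[OF sub, of 1] proper_iff[OF sub] proper by metis
  then have P0a: "P0 \<in> assoc_primes polyring I" by (auto simp: assoc_primes_polyring_iff)
  then show "assoc_primes polyring I \<noteq> {}" by blast
  have linE: "\<exists>L\<subseteq>forms 1. P = idl.span L \<and> prime_height polyring P = enat (vs.dim L)"
    if "P \<in> assoc_primes polyring I" for P
    using lin that prime_height_linear unfolding generated_by_linear_forms_def Idl_polyring by metis
  obtain L0 :: "('n, 'k) mpoly set" where L0: "prime_height polyring P0 = enat (vs.dim L0)"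
    using linE[OF P0a] by blast
  have same: "prime_height polyring P = enat (vs.dim L0)" if "P \<in> assoc_primes polyring I" for P
    using I P0a that L0 by (metis unmixed_def)
  have ih: "ideal_height polyring I = enat (vs.dim L0)"
    unfolding ideal_height_def
  proof (rule antisym)
    have "I \<subseteq> P0" using P0(2) subset_colon[OF sub] by simp
    then show "Inf {prime_height polyring P |P. primeideal P polyring \<and> I \<subseteq> P} \<le> enat (vs.dim L0)"
      using P0(1) L0 by (intro Inf_lower CollectI exI[of _ P0]) (auto simp: primeideal_polyring_iff)
    show "enat (vs.dim L0) \<le> Inf {prime_height polyring P |P. primeideal P polyring \<and> I \<subseteq> P}"
    proof (rule Inf_greatest)
      fix x assume "x \<in> {prime_height polyring P |P. primeideal P polyring \<and> I \<subseteq> P}"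
      then obtain Q where Q: "x = prime_height polyring Q" "prm Q" "I \<subseteq> Q"
        by (auto simp: primeideal_polyring_iff)
      obtain P g where P: "prm P" "P \<subseteq> Q" "P = colon I g"
        using ex_assoc_prime_below[OF sub Q(2,3)] by blast
      then have "P \<in> assoc_primes polyring I" by (auto simp: assoc_primes_polyring_iff)
      from same[OF this] show "enat (vs.dim L0) \<le> x"
        using prime_height_mono[OF P(2) Q(2)] Q(1) by simp
    qed
  qed
  then have h: "ht I = vs.dim L0" by (simp add: ht_def)
  then show "ideal_height polyring I = enat (ht I)" using ih by simp
  show "\<exists>L\<subseteq>forms 1. P = idl.span L \<and> vs.dim L = ht I" if "P \<in> assoc_primes polyring I" for P
    using linE[OF that] same[OF that] h by force
qed

text \<open>Primes over \<open>J\<close> contain linear primes of height \<open>ht I\<close>, which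
  bounds the pole order and all chains by CARD('n) - ht I. The chain above \<open>P\<close> shows
  that the Krull dimension attains this value, so \<open>poly N 1\<close> is the degree.\<close>

lemma quot_degree_between:
  fixes I J :: "('n::finite, 'k::field) mpoly set"
  assumes I: "unmixed polyring I"
    and lin: "\<forall>P\<in>assoc_primes polyring I. generated_by_linear_forms P"
    and J: "homog J" "I \<subseteq> J" and P: "P \<in> assoc_primes polyring I" "J \<subseteq> P"
  shows "\<exists>N. HS J = fps_of_poly N * gs ^ (CARD('n) - ht I) \<and>
    quot_degree J = real_of_int (poly N 1) \<and> 0 \<le> poly N 1"
proof -
  let ?k = "CARD('n) - ht I"
  note htI = unmixed_linear_height[OF I lin]
  have subI: "idl.subspace I" using I by (auto simp: unmixed_def ideal_polyring_iff)
  have above: "\<exists>L\<subseteq>forms 1. idl.span L \<subseteq> Q \<and> CARD('n) - vs.dim L = ?k"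
    if Q: "prm Q" "I \<subseteq> Q" for Q
  proof -
    obtain P' g where P': "prm P'" "P' \<subseteq> Q" "P' = colon I g"
      using ex_assoc_prime_below[OF subI Q] by blast
    then have "P' \<in> assoc_primes polyring I" by (auto simp: assoc_primes_polyring_iff)
    then show ?thesis using htI(1) P'(2) by metis
  qed
  obtain M where M: "fle (HS J) (fps_of_poly M * gs ^ ?k)"
    using HS_growth[OF J(1)] above J(2) by (metis (no_types, lifting) subset_trans)
  obtain n N0 where "HS J = fps_of_poly N0 * gs ^ n" using hilbert_serre[OF J(1)] by blast
  from reduce_pole_order[OF this HS_nonneg M] obtain N where N: "HS J = fps_of_poly N * gs ^ ?k"
    by blast
  obtain L where L: "L \<subseteq> forms 1" "P = idl.span L" "vs.dim L = ht I" using htI(1)[OF P(1)] by blast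
  have proper: "J \<noteq> UNIV"
    using P(2) L prmD(2)[OF linear_ideal_prime[OF L(1)]] by auto
  obtain C where C: "pchain ?k C" "C 0 = P" using linear_chain_above[OF L(1)] L by auto
  have "krull_dim (polyring Quot J) = enat ?k"
  proof (rule krull_dim_Quot[OF homogD(1)[OF J(1)] C(1)])
    show "J \<subseteq> C 0" using C(2) P(2) by simp
    fix n D assume D: "pchain n D" "J \<subseteq> D 0"
    then have "prm (D 0)" "I \<subseteq> D 0" using J(2) by (auto simp: pchain_def)
    then obtain L' where "L' \<subseteq> forms 1" "idl.span L' \<subseteq> D 0" "CARD('n) - vs.dim L' = ?k"
      using above by blast
    then show "n \<le> ?k" using chain_length_above_linear[OF _ D(1), of L'] by simp
  qed
  then have "quot_degree J = real_of_int (poly N 1)" using quot_degree_eq[OF J(1) proper _ N]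
    by blast
  moreover have "poly 0 1 \<le> poly N 1" by (rule rational_fps_le[of _ ?k]) (simp flip: N)
  ultimately show ?thesis using N by auto
qed

text \<open>A \<open>g\<close> outside \<open>I\<close> with \<open>g * F\<close> in
  \<open>I\<close> puts \<open>F\<close> into \<open>colon I g\<close>, hence into an associated
  prime. The conclusion names a finite set of integers so that the maximum in \<open>hyp\<close> is
  taken over a finite set.\<close>

lemma quot_degree_F_set:
  fixes I :: "('n::finite, 'k::field) mpoly set"
  assumes I: "unmixed polyring I"
    and lin: "\<forall>P\<in>assoc_primes polyring I. generated_by_linear_forms P"
    and G: "I = idl.span G" "G \<subseteq> forms e" and e: "e \<ge> 1"
    and F: "F \<in> F_sets I 1 r" and r: "r \<le> ht I"
  shows "quot_degree (Idl\<^bsub>polyring\<^esub> (I \<union> F)) \<in> real_of_int ` {0..int e ^ (ht I - r)}"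
proof -
  let ?s = "CARD('n)" and ?J = "idl.span (I \<union> F)"
  have sub: "idl.subspace I" using G(1) by simp
  obtain fs where F1: "F \<subseteq> forms 1" and fs: "length fs = r" "set fs = F"
    "ring.independent (polyring Quot I) (scalars I) (map (residue_class I) fs)"
    and colon: "colon_ideal polyring I (Idl\<^bsub>polyring\<^esub> F) \<noteq> I"
    using F unfolding F_sets_def by blast
  have ind: "vs.independent F" "card F = r" "finite F"
    using independent_residue_classes_imp[OF sub fs(3)] fs(1,2) distinct_card by auto
  have "I \<subseteq> colon_ideal polyring I (Idl\<^bsub>polyring\<^esub> F)"
    using idl.subspace_scale[OF sub] by (auto simp: colon_ideal_def mult.commute)
  then obtain g where g: "g \<notin> I" "g \<in> colon_ideal polyring I (Idl\<^bsub>polyring\<^esub> F)" using colon by blast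
  have "F \<subseteq> colon I g"
    using g(2) idl.span_superset[of F] by (auto simp: colon_ideal_def Idl_polyring colon_def
      mult.commute)
  moreover obtain P f where P: "prm P" "P = colon I f" "colon I g \<subseteq> P"
    using ex_assoc_prime_above_colon[OF sub g(1)] by blast
  ultimately have "I \<union> F \<subseteq> P" using subset_colon[OF sub, of f] by auto
  then have JP: "?J \<subseteq> P" by (intro idl.span_minimal prmD(1) P(1))
  have Pa: "P \<in> assoc_primes polyring I" using P by (auto simp: assoc_primes_polyring_iff)
  have J: "?J = idl.span (F \<union> G)"
    unfolding G(1) by (rule antisym; rule idl.span_minimal)
      (auto intro: idl.span_base idl.span_mono[THEN subsetD, of G])
  have hJ: "homog ?J" unfolding J using F1 G(2) by (intro homog_span_forms) blast
  have "I \<subseteq> ?J" using idl.span_superset[of "I \<union> F"] by blast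
  then obtain N where N: "HS ?J = fps_of_poly N * gs ^ (?s - ht I)"
      "quot_degree ?J = real_of_int (poly N 1)" "0 \<le> poly N 1"
    using quot_degree_between[OF I lin hJ _ Pa JP] by blast
  have hs: "ht I \<le> ?s" using unmixed_linear_height(1)[OF I lin Pa] dim_linear_le by metis
  \<comment> \<open>Since \<open>card F = r\<close>, the exponent is s - r - (s - ht I) = ht I -
    r.\<close>
  have "fle (HS (idl.span (F \<union> G))) (fps_of_poly (geosum e) ^ (?s - card F - (?s - ht I)) *
    gs ^ (?s - ht I))"
    by (rule HS_upper_bound[OF e ind(3) F1 ind(1) G(2)]) (use N(1) J ind(2) r hs in auto)
  then have "fle (fps_of_poly N * gs ^ (?s - ht I)) (fps_of_poly (geosum e ^ (ht I - r)) *
    gs ^ (?s - ht I))"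
    using N(1) J ind(2) hs r by (simp add: fps_of_poly_power)
  then have "poly N 1 \<le> poly (geosum e ^ (ht I - r)) 1" by (rule rational_fps_le)
  then have "poly N 1 \<in> {0..int e ^ (ht I - r)}" using N(3) by (simp add: poly_power geosum_eval)
  then show ?thesis unfolding Idl_polyring N(2) by blast
qed

theorem corollary6p6:
  fixes I :: "('n::finite, 'k::field) mpoly set" and e r :: nat
  assumes "unmixed polyring I"
    and "graded_ideal I"
    and "I \<noteq> {0}"
    and "minimally_generated_in_degree I e"
    and "e \<ge> 2"
    and "\<forall>P\<in>assoc_primes polyring I. generated_by_linear_forms P"
    and "1 \<le> r" and "r \<le> ht I"
  shows "hyp I 1 r \<le> real e ^ (ht I - r) \<and>
         delta I 1 r \<ge> quot_degree I - real e ^ (ht I - r) \<and>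
         (complete_intersection polyring I \<longrightarrow>
            delta I 1 r \<ge> real e ^ ht I - real e ^ (ht I - r))"
proof -
  let ?s = "CARD('n)"
  note htI = unmixed_linear_height[OF assms(1,6)]
  have sub: "idl.subspace I" using assms(1) by (auto simp: unmixed_def ideal_polyring_iff)
  obtain G where "minimal_homogeneous_generators I G"
    using ex_minimal_homogeneous_generators[OF assms(2)] by blast
  then have G: "I = idl.span G" "G \<subseteq> forms e"
    using assms(4) by (auto simp: minimally_generated_in_degree_def
      minimal_homogeneous_generators_def Idl_polyring)
  have e: "e \<ge> 1" using assms(5) by simp
  have hyp: "hyp I 1 r \<le> real e ^ (ht I - r)"
  proof (cases "F_sets I 1 r = {}")
    case False
    let ?A = "{quot_degree (Idl\<^bsub>polyring\<^esub> (I \<union> F)) |F. F \<in> F_sets I 1 r}"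
    \<comment> \<open>\<open>Max\<close> is meaningful only on a finite set. \<open>F_sets\<close>
      may be infinite, but the degrees are integers in a bounded range.\<close>
    have sub: "?A \<subseteq> real_of_int ` {0..int e ^ (ht I - r)}"
      using quot_degree_F_set[OF assms(1,6) G e _ assms(8)] by blast
    then have "finite ?A" by (rule finite_subset) simp
    moreover have "?A \<noteq> {}" using False by blast
    ultimately have "Max ?A \<in> ?A" by (rule Max_in)
    then obtain n where "Max ?A = real_of_int n" "n \<le> int e ^ (ht I - r)" using sub by auto
    then have "Max ?A \<le> real_of_int (int e ^ (ht I - r))" by (simp only: of_int_le_iff)
    then show ?thesis using False by (simp add: hyp_def)
  qed (simp add: hyp_def)
  moreover have "real e ^ ht I \<le> quot_degree I" if "complete_intersection polyring I"
  proof -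
    obtain P where P: "P \<in> assoc_primes polyring I" using htI(3) by blast
    then have IP: "I \<subseteq> P" using subset_colon[OF sub] by (auto simp: assoc_primes_polyring_iff)
    have "homog I" unfolding G(1) using G(2) by (intro homog_span_forms) blast
    then obtain N where N: "HS I = fps_of_poly N * gs ^ (?s - ht I)" "quot_degree I =
      real_of_int (poly N 1)"
      using quot_degree_between[OF assms(1,6) _ order_refl P IP] by blast
    from that[unfolded complete_intersection_def Idl_polyring] obtain G0
      where "G0 \<subseteq> carrier polyring \<and> finite G0 \<and>
        enat (card G0) = ideal_height polyring I \<and> I = idl.span G0" ..
    then have G0: "finite G0" "enat (card G0) = ideal_height polyring I" "I = idl.span G0" by blast+
    have card: "card G0 = ht I" using htI(2) G0(2) by simp
    \<comment> \<open>A list keeps the number of generators at \<open>ht I\<close> even if different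
      generators have the same component of degree \<open>e\<close>.\<close>
    obtain bs where bs: "set bs = G0" "distinct bs" using finite_distinct_list[OF G0(1)] by blast
    have len: "length bs = ht I" using bs card distinct_card by metis
    have hs: "ht I \<le> ?s" using htI(1)[OF P] dim_linear_le by metis
    have "I = idl.span (set (map (hcomp e) bs))"
      using span_hcomp_generators[OF G(2)] G(1) G0(3) bs(1) by simp
    then have "int e ^ length (map (hcomp e) bs) \<le> poly N 1"
      by (rule complete_intersection_lower_bound[OF _ _ e N(1)]) (use hs len in auto)
    then have "real_of_int (int e ^ ht I) \<le> real_of_int (poly N 1)"
      using len by (simp only: of_int_le_iff length_map)
    then show ?thesis using N(2) by simp
  qed
  ultimately show ?thesis unfolding delta_def by force
qed


end
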